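(* Let an $SO(3)$-structure be given, with invariant forms $\sigma$, $\eta_0,\eta_1,\eta_2$, $\hat\gamma$. For an invariant $k$-form $\alpha$, the exterior derivative $d\alpha$ at a point depends on the intrinsic torsion $\tau\in T^*\otimes\mathfrak{so}(3)^\perp$ through an $SO(3)$-equivariant linear map $l_\alpha$; say that $d\alpha$ determines the module $(T^*\otimes\mathfrak{so}(3)^\perp)/\ker l_\alpha$. Then: (1) $d\sigma$ determines a module isomorphic to $3\mathbb R\oplus 2V\oplus 2S^2_0(V)$, and as $SO(3)\times SL(2,\mathbb R)$-module to $B^3\oplus A^2\otimes B^1\oplus A^4\otimes B^1$; (2) each $d\eta_i$ ($i=0,1,2$) determines a module isomorphic to $\mathbb R\oplus 2V\oplus S^2_0(V)$, and these three are in direct sum (i.e. the rank of $\tau\mapsto(l_{\eta_0}\tau,l_{\eta_1}\tau,l_{\eta_2}\tau)$ equals the sum of the ranks of the $l_{\eta_i}$); (3) $d\hat\gamma$ determines a module isomorphic to $\mathbb R\oplus 3V\oplus S^2_0(V)$; (4) the $d\eta_i$ and $d\hat\gamma$ altogether determine (i.e. the intrinsic torsion space modulo the common kernel of $l_{\eta_0},l_{\eta_1},l_{\eta_2},l_{\hat\gamma}$ is) the $SO(3)\times SL(2,\mathbb R)$-module $B^3\oplus A^2\otimes B^1\oplus A^2\otimes B^3\oplus A^4\otimes B^3$. In particular, the only intrinsic torsion component not determined by the exterior derivatives of invariant forms is the $14$-dimensional module $A^6\otimes B^1$.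
   Context: Let $e^1,\dots,e^6$ be the standard basis of $(\mathbb R^6)^*$, $e^{ij}=e^i\wedge e^j$ etc. Let $\sigma=e^{12}+e^{34}+e^{56}$, $\eta^\theta=(\cos\theta\, e^1+\sin\theta\, e^2)\wedge(\cos\theta\, e^3+\sin\theta\, e^4)\wedge(\cos\theta\, e^5+\sin\theta\, e^6)$, $\eta_0=\eta^0,\eta_1=\eta^{2\pi/3},\eta_2=\eta^{-2\pi/3}$. The common stabilizer in $GL(6,\mathbb R)$ of these forms is a copy of $SO(3)\subset SO(6)$ acting on $T=\mathbb R^6\cong V\oplus V$ ($V$ the 3-dimensional irreducible representation); its centralizer is $GL(2,\mathbb R)$, acting identically on each plane $\mathrm{span}(e^{2i-1},e^{2i})$. An $SO(3)$-structure on a 6-manifold is a reduction of the frame bundle to this $SO(3)$, equivalently forms $(\sigma,\eta_0,\eta_1,\eta_2)$ pointwise of this model form. Put $\gamma=\tfrac43(\eta_0+\eta_1+\eta_2)$; it defines an almost complex structure $J$ (the one for which $\gamma+i\hat\gamma$ is of type $(3,0)$) and $\hat\gamma=J\gamma$ is the unique 3-form with $\gamma+i\hat\gamma$ decomposable and compatible with the orientation. The intrinsic torsion is the projection of the torsion of any connection on the reduction to the cokernel of the alternating map $T^*\otimes\mathfrak{so}(3)\to\Lambda^2T^*\otimes T$, identified with $T^*\otimes\mathfrak{so}(3)^\perp$. $S^2_0(V)$ is the 5-dimensional irreducible $SO(3)$-representation. $A^p$, $B^q$ denote the $(p+1)$-dimensional irreducible representations of $SO(3)$ and of $SL(2,\mathbb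 R)$.
   Formalization: In (1) the SO(3)-module is 4ℝ⊕2V⊕2S²₀(V), not 3ℝ⊕2V⊕2S²₀(V): the stated B³⊕A²⊗B¹⊕A⁴⊗B¹ has dimension 20 and restricts to 4ℝ⊕2V⊕2S²₀(V), while the printed sum has dimension 19. *)

theory Defs
  imports "HOL-Analysis.Analysis" "HOL-Library.Multiset" "HOL-Library.Function_Algebras"
begin

text \<open>Coordinates. Indices are 0-based: the covector e^(x+1) of the paper has index x < 6,
  and x corresponds to (x div 2, x mod 2) under T^* = V \<otimes> R^2, i.e. the plane
  span(e^(2i-1), e^(2i)) of the paper is {2(i-1), 2(i-1)+1}.
  Matrices are functions nat => nat => real (only the entries with small indices matter).\<close>

type_synonym mat = "nat \<Rightarrow> nat \<Rightarrow> real"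

definition det3 :: "mat \<Rightarrow> real" where
  "det3 m = m 0 0 * (m 1 1 * m 2 2 - m 1 2 * m 2 1)
          - m 0 1 * (m 1 0 * m 2 2 - m 1 2 * m 2 0)
          + m 0 2 * (m 1 0 * m 2 1 - m 1 1 * m 2 0)"

definition SO3 :: "mat set" where
  "SO3 = {g. (\<forall>i j. \<not> (i < 3 \<and> j < 3) \<longrightarrow> g i j = 0)
            \<and> (\<forall>i<3. \<forall>j<3. (\<Sum>k<3. g i k * g j k) = (if i = j then 1 else 0))
            \<and> det3 g = 1}"

definition SL2 :: "mat set" where
  "SL2 = {h. (\<forall>i j. \<not> (i < 2 \<and> j < 2) \<longrightarrow> h i j = 0)
            \<and> h 0 0 * h 1 1 - h 0 1 * h 1 0 = 1}"

definition id2 :: mat where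
  "id2 = (\<lambda>i j. if i < 2 \<and> i = j then 1 else 0)"

definition G_SO3_SL2 :: "(mat \<times> mat) set" where
  "G_SO3_SL2 = SO3 \<times> SL2"

definition G_SO3 :: "(mat \<times> mat) set" where
  "G_SO3 = {(g, id2) | g. g \<in> SO3}"

text \<open>Action on covector components (T^* = V \<otimes> R^2): g \<otimes> h;
  on vector components (T): the inverse transpose g \<otimes> h^(-T) (g is orthogonal).\<close>

definition covact :: "mat \<Rightarrow> mat \<Rightarrow> mat" where
  "covact g h x x' = (if x < 6 \<and> x' < 6 then g (x div 2) (x' div 2) * h (x mod 2) (x' mod 2) else 0)"

definition invT2 :: "mat \<Rightarrow> mat" where
  "invT2 h = (\<lambda>i j. if i = 0 \<and> j = 0 then h 1 1 else if i = 0 \<and> j = 1 then - h 1 0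
                  else if i = 1 \<and> j = 0 then - h 0 1 else if i = 1 \<and> j = 1 then h 0 0 else 0)"

definition vecact :: "mat \<Rightarrow> mat \<Rightarrow> mat" where
  "vecact g h = covact g (invT2 h)"

text \<open>A torsion tensor t \<in> \<Lambda>^2 T^* \<otimes> T: T(e_x, e_y) = \<Sum>_z t x y z e_z.\<close>

type_synonym torsion = "nat \<Rightarrow> nat \<Rightarrow> nat \<Rightarrow> real"

definition torsion_space :: "torsion set" where
  "torsion_space = {t. (\<forall>x y z. t x y z = - t y x z)
                      \<and> (\<forall>x y z. \<not> (x < 6 \<and> y < 6 \<and> z < 6) \<longrightarrow> t x y z = 0)}"

definition tadd :: "torsion \<Rightarrow> torsion \<Rightarrow> torsion" where
  "tadd t s = (\<lambda>x y z. t x y z + s x y z)"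

definition tscale :: "real \<Rightarrow> torsion \<Rightarrow> torsion" where
  "tscale c t = (\<lambda>x y z. c * t x y z)"

definition torsion_act :: "mat \<Rightarrow> mat \<Rightarrow> torsion \<Rightarrow> torsion" where
  "torsion_act g h t = (\<lambda>x y z. \<Sum>x'<6. \<Sum>y'<6. \<Sum>z'<6.
       covact g h x x' * covact g h y y' * vecact g h z z' * t x' y' z')"

text \<open>A k-form is given by its components alpha [x_1,...,x_k] = alpha(e_{x_1},...,e_{x_k}).\<close>

type_synonym form = "nat list \<Rightarrow> real"

text \<open>The map l_alpha: for an invariant k-form alpha (parallel for any connection on the
  reduction) and a connection with torsion t, the exterior derivative is
  d alpha (X_0,...,X_k) = \<Sum>_{i<j} (-1)^(i+j) alpha(T(X_i,X_j), X_0,..^i..^j..,X_k).\<close>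

definition dform :: "form \<Rightarrow> nat \<Rightarrow> torsion \<Rightarrow> form" where
  "dform \<alpha> k t = (\<lambda>L. if length L = Suc k \<and> set L \<subseteq> {..<6} then
      (\<Sum>i<Suc k. \<Sum>j\<in>{Suc i..<Suc k}. (-1) ^ (i + j) *
          (\<Sum>z<6. t (L ! i) (L ! j) z * \<alpha> (z # [L ! m. m \<leftarrow> [0..<Suc k], m \<noteq> i \<and> m \<noteq> j])))
    else 0)"

definition sigma :: form where
  "sigma L = (case L of [x, y] \<Rightarrow>
       (\<Sum>i<3. (if x = 2*i \<and> y = 2*i+1 then 1 else 0) - (if x = 2*i+1 \<and> y = 2*i then 1 else 0))
     | _ \<Rightarrow> 0)"

definition ucov :: "real \<Rightarrow> nat \<Rightarrow> nat \<Rightarrow> real" where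
  "ucov \<theta> i x = (if x = 2*i then cos \<theta> else if x = 2*i+1 then sin \<theta> else 0)"

text \<open>eta^theta = u_1 \<and> u_2 \<and> u_3, evaluated as a determinant.\<close>

definition eta_theta :: "real \<Rightarrow> form" where
  "eta_theta \<theta> L = (case L of [x, y, z] \<Rightarrow>
       det3 (\<lambda>i j. if i < 3 \<and> j < 3 then ucov \<theta> i ([x, y, z] ! j) else 0)
     | _ \<Rightarrow> 0)"

definition eta :: "nat \<Rightarrow> form" where
  "eta i = (if i = 0 then eta_theta 0 else if i = 1 then eta_theta (2*pi/3) else eta_theta (-2*pi/3))"

definition gamma :: form where
  "gamma = (\<lambda>L. 4/3 * (eta 0 L + eta 1 L + eta 2 L))"

text \<open>gamma = Re((e^1+ie^2)(e^3+ie^4)(e^5+ie^6)) = e^135 - e^146 - e^236 - e^245, and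
  J gamma = Im(...) = e^136 + e^145 + e^235 - e^246, which equals the following combination.\<close>

definition gamma_hat :: form where
  "gamma_hat = (\<lambda>L. 4/3 * (eta_theta (pi/6) L + eta_theta (5*pi/6) L + eta_theta (-pi/2) L))"

text \<open>A list S of pairs (k,q) stands for the direct sum over its entries of A^(2k) \<otimes> B^q,
  realised as tensors F j I J (j = summand index, I an index list of length k over {0,1,2},
  J an index list of length q over {0,1}) that are symmetric in I, symmetric in J and
  trace-free in I: A^(2k) = S^k_0(R^3), B^q = S^q(R^2).\<close>

type_synonym modelem = "nat \<Rightarrow> nat list \<Rightarrow> nat list \<Rightarrow> real"

definition idx_lists :: "nat \<Rightarrow> nat \<Rightarrow> nat list set" where
  "idx_lists n k = {I. length I = k \<and> set I \<subseteq> {..<n}}"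

definition irrep_sum :: "(nat \<times> nat) list \<Rightarrow> modelem set" where
  "irrep_sum S = {F.
      (\<forall>j I J. \<not> (j < length S \<and> I \<in> idx_lists 3 (fst (S ! j)) \<and> J \<in> idx_lists 2 (snd (S ! j)))
                \<longrightarrow> F j I J = 0)
    \<and> (\<forall>j I I' J. mset I = mset I' \<longrightarrow> F j I J = F j I' J)
    \<and> (\<forall>j I J J'. mset J = mset J' \<longrightarrow> F j I J = F j I J')
    \<and> (\<forall>j I J. (\<Sum>a<3. F j (a # a # I) J) = 0)}"

definition irrep_act :: "mat \<Rightarrow> mat \<Rightarrow> modelem \<Rightarrow> modelem" where
  "irrep_act g h F = (\<lambda>j I J. \<Sum>I'\<in>idx_lists 3 (length I). \<Sum>J'\<in>idx_lists 2 (length J).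
       (\<Prod>m<length I. g (I ! m) (I' ! m)) * (\<Prod>m<length J. h (J ! m) (J' ! m)) * F j I' J')"

definition madd :: "modelem \<Rightarrow> modelem \<Rightarrow> modelem" where
  "madd F F' = (\<lambda>j I J. F j I J + F' j I J)"

definition mscale :: "real \<Rightarrow> modelem \<Rightarrow> modelem" where
  "mscale c F = (\<lambda>j I J. c * F j I J)"

text \<open>quotient_iso G D N S: the G-module D/N (D a subspace of torsion tensors, N \<subseteq> D) is
  isomorphic to the model module S, expressed via the first isomorphism theorem: there is a
  G-equivariant linear map from D onto the model module whose kernel is N.\<close>

definition quotient_iso :: "(mat \<times> mat) set \<Rightarrow> torsion set \<Rightarrow> torsion set \<Rightarrow> (nat \<times> nat) list \<Rightarrow> bool" where
  "quotient_iso G D N S \<longleftrightarrow> (\<exists>\<phi>.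
       (\<forall>t\<in>D. \<phi> t \<in> irrep_sum S)
     \<and> (\<forall>t\<in>D. \<forall>s\<in>D. \<phi> (tadd t s) = madd (\<phi> t) (\<phi> s))
     \<and> (\<forall>c. \<forall>t\<in>D. \<phi> (tscale c t) = mscale c (\<phi> t))
     \<and> (\<forall>(g, h)\<in>G. \<forall>t\<in>D. \<phi> (torsion_act g h t) = irrep_act g h (\<phi> t))
     \<and> irrep_sum S \<subseteq> \<phi> ` D
     \<and> (\<forall>t\<in>D. \<phi> t = (\<lambda>_ _ _. 0) \<longleftrightarrow> t \<in> N))"

definition kerd :: "form \<Rightarrow> nat \<Rightarrow> torsion set" where
  "kerd \<alpha> k = {t \<in> torsion_space. dform \<alpha> k t = (\<lambda>_. 0)}"

definition frank :: "(torsion \<Rightarrow> 'a \<Rightarrow> real) \<Rightarrow> nat" where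
  "frank f = vector_space.dim (\<lambda>c (v :: 'a \<Rightarrow> real) x. c * v x) (f ` torsion_space)"

text \<open>Image of the alternating map T^* \<otimes> so(3) \<rightarrow> \<Lambda>^2 T^* \<otimes> T, a \<mapsto> ((X,Y) \<mapsto> a(X)Y - a(Y)X).
  so(3) acts on T = V \<otimes> R^2 by E_c \<otimes> id, with E_c the standard basis of skew 3x3 matrices.\<close>

definition so3_basis :: "nat \<Rightarrow> mat" where
  "so3_basis c = (\<lambda>i j.
      if c = 0 then (if i = 2 \<and> j = 1 then 1 else if i = 1 \<and> j = 2 then -1 else 0)
      else if c = 1 then (if i = 0 \<and> j = 2 then 1 else if i = 2 \<and> j = 0 then -1 else 0)
      else (if i = 1 \<and> j = 0 then 1 else if i = 0 \<and> j = 1 then -1 else 0))"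

definition so3_on_T :: "nat \<Rightarrow> mat" where
  "so3_on_T c z y = (if z < 6 \<and> y < 6 \<and> z mod 2 = y mod 2 then so3_basis c (z div 2) (y div 2) else 0)"

definition alt_so3 :: "torsion set" where
  "alt_so3 = {t. \<exists>f :: nat \<Rightarrow> nat \<Rightarrow> real. t = (\<lambda>x y z.
      if x < 6 \<and> y < 6 \<and> z < 6 then
        (\<Sum>c<3. f x c * so3_on_T c z y - f y c * so3_on_T c z x)
      else 0)}"

end

theory Submission
  imports Defs
begin

text \<open>
  Lowering the vector index with \<open>sigma\<close> turns a torsion tensor into a tensor on \<open>V \<otimes> R\<^sup>2\<close>, on which
  contractions, cross products and permutations of indices commute with \<open>SO(3) \<times> SL(2)\<close>. The invariant
  3-forms span a copy of \<open>B\<^sup>3\<close>, and their derivatives factor through the two tensors \<open>Nten\<close>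
  (values in \<open>V \<otimes> V \<otimes> B\<^sup>3\<close>) and \<open>Qten\<close> (values in \<open>A\<^sup>2 \<otimes> B\<^sup>1\<close>): trace, antisymmetric and traceless
  symmetric part of \<open>Nten\<close> together with \<open>Qten\<close> give the four summands of (4), and contracting with the
  coefficient vector of a single form gives (2) and (3). For \<open>eta\<close> at an angle with direction \<open>v\<close> only the
  values of cubic forms on \<open>v\<close> and two further vectors enter, and those for the three angles are linearly
  independent. Likewise \<open>d sigma\<close> is the cyclic sum \<open>Wten\<close>. Where all of these vanish, a torsion is
  determined by a tensor \<open>yv\<close>, which is exactly an element of \<open>T\<^sup>* \<otimes> so(3)\<close>, and by the
  symmetric traceless \<open>Sten\<close>, which spans \<open>A\<^sup>6 \<otimes> B\<^sup>1\<close>.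
\<close>

subsection \<open>Equivariant operations on tensors\<close>

text \<open>Every isomorphism is an explicit list of intertwiners; surjectivity comes from explicit
  preimages and kernels from linear identities between components. To keep equivariance cheap,
  tensors of all degrees share one type and the operations act on leading indices; other positions
  are reached by cyclic rotation. Why an eta form sees two copies of V and \<open>gamma_hat\<close>
  three: the V-part of the derivative of a cubic form x takes values in S^2R^2 and is built from
  contractions with x. For a cube v^3 these are multiples of v, which leaves only the plane v R^2;
  \<open>gamma_hat\<close> is not a cube and reaches all of S^2R^2. Dimensions check the result: d
  sigma gives 20, the 3-forms give 42, a B^3 of dimension 4 is common to both, and 14 remain, so 20
  + 42 - 4 + 14 = 72 = 6 * 12. The other 18 of the 90 torsion components form the image of T^*
  \<otimes> so(3).\<close>

type_synonym tensor = "nat list \<Rightarrow> nat list \<Rightarrow> real"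

text \<open>The action preserves the lengths of both index lists, so it treats all degrees at once,
  and degree-changing operations such as contractions can commute with it. It is
  \<open>irrep_act\<close> on a single summand.\<close>

definition tact :: "mat \<Rightarrow> mat \<Rightarrow> tensor \<Rightarrow> tensor" where
  "tact g h F = (\<lambda>I J. \<Sum>I'\<in>idx_lists 3 (length I). \<Sum>J'\<in>idx_lists 2 (length J).
       (\<Prod>m<length I. g (I ! m) (I' ! m)) * (\<Prod>m<length J. h (J ! m) (J' ! m)) * F I' J')"

definition smul :: "real \<Rightarrow> tensor \<Rightarrow> tensor" where
  "smul c F = (\<lambda>I J. c * F I J)"

lemma smul_apply [simp]: "smul c F I J = c * F I J"
  by (simp add: smul_def)

lemma irrep_act_component: "irrep_act g h F j = tact g h (F j)"
  by (simp add: irrep_act_def tact_def)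

lemma sum_lt_2: "(\<Sum>i<2. f i) = f 0 + f (1::nat)" for f :: "nat \<Rightarrow> real"
  by (simp add: eval_nat_numeral)

lemma sum_lt_3: "(\<Sum>i<3. f i) = f 0 + f 1 + f (2::nat)" for f :: "nat \<Rightarrow> real"
  by (simp add: eval_nat_numeral)

lemma all_lt_2: "(\<forall>i<2. P i) \<longleftrightarrow> P 0 \<and> P (1::nat)"
  by (auto simp: eval_nat_numeral less_Suc_eq)

lemma all_lt_3: "(\<forall>i<3. P i) \<longleftrightarrow> P 0 \<and> P 1 \<and> P (2::nat)"
  by (auto simp: eval_nat_numeral less_Suc_eq)

lemma idx_lists_0: "idx_lists n 0 = {[]}"
  by (auto simp: idx_lists_def)

lemma finite_idx_lists: "finite (idx_lists n k)"
  using finite_lists_length_eq[of "{..<n}" k] by (simp add: idx_lists_def conj_commute)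

lemma idx_lists_Suc: "idx_lists n (Suc k) = (\<lambda>(a, I). a # I) ` ({..<n} \<times> idx_lists n k)"
  by (force simp: idx_lists_def length_Suc_conv)

lemma sum_idx_lists_Suc:
  "(\<Sum>I\<in>idx_lists n (Suc k). f I) = (\<Sum>a<n. \<Sum>I\<in>idx_lists n k. f (a # I))" for f :: "nat list \<Rightarrow> real"
  unfolding idx_lists_Suc
  by (subst sum.reindex) (auto simp: inj_on_def sum.cartesian_product o_def split_def)

lemma tact_Nil: "tact g h F [] [] = F [] []"
  by (simp add: tact_def idx_lists_0)

lemma tact_Cons_I: "tact g h F (i # I) J = (\<Sum>a<3. g i a * tact g h (\<lambda>I' J'. F (a # I') J') I J)"
  by (simp add: tact_def sum_idx_lists_Suc sum_distrib_left prod.lessThan_Suc_shift mult.assoc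
      del: prod.lessThan_Suc)

lemma tact_Cons_J: "tact g h F I (i # J) = (\<Sum>a<2. h i a * tact g h (\<lambda>I' J'. F I' (a # J')) I J)"
proof -
  have "tact g h F I (i # J) = (\<Sum>I'\<in>idx_lists 3 (length I). \<Sum>a<2. \<Sum>J'\<in>idx_lists 2 (length J).
      h i a * ((\<Prod>m<length I. g (I ! m) (I' ! m)) * (\<Prod>m<length J. h (J ! m) (J' ! m)) * F I' (a # J')))"
    by (simp add: tact_def sum_idx_lists_Suc prod.lessThan_Suc_shift mult_ac del: prod.lessThan_Suc)
  also have "\<dots> = (\<Sum>a<2. \<Sum>I'\<in>idx_lists 3 (length I). \<Sum>J'\<in>idx_lists 2 (length J).
      h i a * ((\<Prod>m<length I. g (I ! m) (I' ! m)) * (\<Prod>m<length J. h (J ! m) (J' ! m)) * F I' (a # J')))"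
    by (rule sum.swap)
  finally show ?thesis by (simp add: tact_def sum_distrib_left)
qed

lemma tact_add: "tact g h (F + G) = tact g h F + tact g h G"
  by (simp add: tact_def fun_eq_iff sum.distrib distrib_left)

lemma tact_diff: "tact g h (F - G) = tact g h F - tact g h G"
  by (simp add: tact_def fun_eq_iff sum_subtractf right_diff_distrib)

lemma tact_smul: "tact g h (smul c F) = smul c (tact g h F)"
  by (simp add: tact_def fun_eq_iff sum_distrib_left mult_ac)

lemma tact_sum: "tact g h (\<lambda>I J. \<Sum>a\<in>A. F a I J) I J = (\<Sum>a\<in>A. tact g h (F a) I J)"
proof (induction A rule: infinite_finite_induct)
  case (insert x A)
  have "(\<lambda>I J. \<Sum>a\<in>insert x A. F a I J) = F x + (\<lambda>I J. \<Sum>a\<in>A. F a I J)"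
    using insert by (simp add: fun_eq_iff)
  with insert show ?case by (simp add: tact_add)
qed (simp_all add: tact_def)

lemma tact_mult: "tact g h (\<lambda>I J. c * F I J) I J = c * tact g h F I J"
  using tact_smul[of g h c F] by (simp add: smul_def fun_eq_iff)

lemma tact_zero: "tact g h (\<lambda>I J. 0) I J = 0"
  by (simp add: tact_def)

text \<open>Rotation moves the leading index to the end, so its equivariance needs the action
  expanded along the last index as well as along the first.\<close>

lemma tact_snoc_I: "tact g h F (I @ [i]) J = (\<Sum>a<3. g i a * tact g h (\<lambda>I' J'. F (I' @ [a]) J') I J)"
proof (induction I arbitrary: F)
  case Nil
  show ?case unfolding append_Nil tact_Cons_I
    by (rule sum.cong[OF refl]) (simp add: tact_def idx_lists_0)
next
  case (Cons k I)
  have "tact g h F ((k # I) @ [i]) J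
      = (\<Sum>b<3. \<Sum>a<3. g k b * (g i a * tact g h (\<lambda>I' J'. F (b # I' @ [a]) J') I J))"
    by (simp add: tact_Cons_I Cons.IH sum_distrib_left)
  also have "\<dots> = (\<Sum>a<3. \<Sum>b<3. g k b * (g i a * tact g h (\<lambda>I' J'. F (b # I' @ [a]) J') I J))"
    by (rule sum.swap)
  also have "\<dots> = (\<Sum>a<3. g i a * tact g h (\<lambda>I' J'. F (I' @ [a]) J') (k # I) J)"
    by (simp add: tact_Cons_I sum_distrib_left mult_ac)
  finally show ?case .
qed

lemma tact_snoc_J: "tact g h F I (J @ [i]) = (\<Sum>a<2. h i a * tact g h (\<lambda>I' J'. F I' (J' @ [a])) I J)"
proof (induction J arbitrary: F)
  case Nil
  show ?case unfolding append_Nil tact_Cons_J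
    by (rule sum.cong[OF refl]) (simp add: tact_def idx_lists_0)
next
  case (Cons k J)
  have "tact g h F I ((k # J) @ [i])
      = (\<Sum>b<2. \<Sum>a<2. h k b * (h i a * tact g h (\<lambda>I' J'. F I' (b # J' @ [a])) I J))"
    by (simp add: tact_Cons_J Cons.IH sum_distrib_left)
  also have "\<dots> = (\<Sum>a<2. \<Sum>b<2. h k b * (h i a * tact g h (\<lambda>I' J'. F I' (b # J' @ [a])) I J))"
    by (rule sum.swap)
  also have "\<dots> = (\<Sum>a<2. h i a * tact g h (\<lambda>I' J'. F I' (J' @ [a])) I (k # J))"
    by (simp add: tact_Cons_J sum_distrib_left mult_ac)
  finally show ?case .
qed

text \<open>Half the Vandermonde product is the sign of a permutation of 0, 1, 2 and vanishes on
  repetitions; in this form antisymmetry is a polynomial identity.\<close>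

definition eps3 :: "nat \<Rightarrow> nat \<Rightarrow> nat \<Rightarrow> real" where
  "eps3 i j k = (if i < 3 \<and> j < 3 \<and> k < 3
     then (real j - real i) * (real k - real j) * (real k - real i) / 2 else 0)"

definition trI :: "tensor \<Rightarrow> tensor" where
  "trI F = (\<lambda>I J. \<Sum>a<3. F (a # a # I) J)"

definition crI :: "tensor \<Rightarrow> tensor" where
  "crI F = (\<lambda>I J. case I of [] \<Rightarrow> 0 | k # I' \<Rightarrow> \<Sum>i<3. \<Sum>j<3. eps3 k i j * F (i # j # I') J)"

definition dltI :: "tensor \<Rightarrow> tensor" where
  "dltI F = (\<lambda>I J. case I of i # j # I' \<Rightarrow> if i = j \<and> i < 3 then F I' J else 0 | _ \<Rightarrow> 0)"

definition epJ :: "tensor \<Rightarrow> tensor" where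
  "epJ F = (\<lambda>I J. F I (0 # 1 # J) - F I (1 # 0 # J))"

definition rotI :: "tensor \<Rightarrow> tensor" where
  "rotI F = (\<lambda>I J. F (rotate1 I) J)"

definition rotJ :: "tensor \<Rightarrow> tensor" where
  "rotJ F = (\<lambda>I J. F I (rotate1 J))"

text \<open>Pairing the R^2-indices with fixed coefficients breaks SL(2), so this operation is
  equivariant for SO(3) alone. Placing the result at \<open>J = []\<close> makes it a tensor of
  degree 0 in R^2.\<close>

definition slice :: "nat \<Rightarrow> (nat list \<Rightarrow> real) \<Rightarrow> tensor \<Rightarrow> tensor" where
  "slice n C F = (\<lambda>I J. if J = [] then \<Sum>K\<in>idx_lists 2 n. C K * F I K else 0)"

text \<open>Orthogonality and \<open>det g = 1\<close> say that \<open>g\<close> equals its cofactor matrix.\<close>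

definition cof :: "mat \<Rightarrow> mat" where
  "cof g i j = g ((i+1) mod 3) ((j+1) mod 3) * g ((i+2) mod 3) ((j+2) mod 3)
     - g ((i+1) mod 3) ((j+2) mod 3) * g ((i+2) mod 3) ((j+1) mod 3)"

text \<open>The adjugate identity adj(g) g = det(g) 1, checked entry by entry.\<close>

lemma cof_mult:
  assumes "det3 g = 1" "i < 3" "j < 3"
  shows "(\<Sum>k<3. cof g k i * g k j) = (if i = j then 1 else 0)"
proof -
  have "\<forall>i<3. \<forall>j<3. (\<Sum>k<3. cof g k i * g k j) = (if i = j then det3 g else 0)"
    by (simp add: all_lt_3 sum_lt_3 cof_def det3_def) (simp add: algebra_simps eval_nat_numeral)
  with assms show ?thesis by simp
qed

lemma SO3_out: "g \<in> SO3 \<Longrightarrow> \<not> (i < 3 \<and> j < 3) \<Longrightarrow> g i j = 0"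
  by (auto simp: SO3_def)

lemma SO3_row: "g \<in> SO3 \<Longrightarrow> i < 3 \<Longrightarrow> j < 3 \<Longrightarrow> (\<Sum>k<3. g i k * g j k) = (if i = j then 1 else 0)"
  by (auto simp: SO3_def)

lemma SO3_cof:
  assumes g: "g \<in> SO3" and "k < 3" "m < 3"
  shows "cof g k m = g k m"
proof -
  have det: "det3 g = 1" using g by (simp add: SO3_def)
  have "g k m = (\<Sum>l<3. (if m = l then 1 else 0) * g k l)"
    using \<open>m < 3\<close> by (simp add: sum.delta if_distrib[of "\<lambda>x. x * _"] cong: if_cong)
  also have "\<dots> = (\<Sum>l<3. (\<Sum>p<3. cof g p m * g p l) * g k l)"
    using cof_mult[OF det \<open>m < 3\<close>] by (intro sum.cong) auto
  also have "\<dots> = (\<Sum>p<3. cof g p m * (\<Sum>l<3. g p l * g k l))"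
    unfolding sum_distrib_left sum_distrib_right by (subst sum.swap) (simp add: mult_ac)
  also have "\<dots> = (\<Sum>p<3. cof g p m * (if p = k then 1 else 0))"
    using SO3_row[OF g _ \<open>k < 3\<close>] by (intro sum.cong) auto
  also have "\<dots> = cof g k m"
    using \<open>k < 3\<close> by (simp add: if_distrib[of "\<lambda>x. _ * x"] cong: if_cong)
  finally show ?thesis by simp
qed

text \<open>\<open>SO3\<close> is defined by orthonormal rows; for columns one factor is replaced by
  its cofactor, which turns the sum into the adjugate identity.\<close>

lemma SO3_col:
  assumes g: "g \<in> SO3" and "i < 3" "j < 3"
  shows "(\<Sum>k<3. g k i * g k j) = (if i = j then 1 else 0)"
proof -
  have "(\<Sum>k<3. g k i * g k j) = (\<Sum>k<3. cof g k i * g k j)"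
    using SO3_cof[OF g _ \<open>i < 3\<close>] by (intro sum.cong) auto
  then show ?thesis using cof_mult[of g i j] assms by (simp add: SO3_def)
qed

lemma SO3_eps:
  assumes g: "g \<in> SO3" and "b < 3" "c < 3"
  shows "(\<Sum>i<3. \<Sum>j<3. eps3 k i j * (g i b * g j c)) = (\<Sum>m<3. g k m * eps3 m b c)"
proof (cases "k < 3")
  case True
  \<comment> \<open>With cofactors on the right the identity holds for every matrix; membership in
    SO(3) enters only when \<open>cof g\<close> is replaced by \<open>g\<close>.\<close>
  have *: "\<forall>k<3. \<forall>b<3. \<forall>c<3. (\<Sum>i<3. \<Sum>j<3. eps3 k i j * (g i b * g j c)) = (\<Sum>m<3. cof g k m * eps3 m b c)"
    by (simp add: all_lt_3 sum_lt_3 cof_def eps3_def)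
       (simp add: eval_nat_numeral field_simps)
  have "(\<Sum>i<3. \<Sum>j<3. eps3 k i j * (g i b * g j c)) = (\<Sum>m<3. cof g k m * eps3 m b c)"
    using * True assms by blast
  also have "\<dots> = (\<Sum>m<3. g k m * eps3 m b c)"
    using SO3_cof[OF g True] by (intro sum.cong) auto
  finally show ?thesis .
next
  case False
  then show ?thesis using SO3_out[OF g] by (simp add: eps3_def)
qed

definition nat_op :: "(mat \<times> mat) set \<Rightarrow> (tensor \<Rightarrow> tensor) \<Rightarrow> bool" where
  "nat_op G T \<longleftrightarrow> (\<forall>F F'. T (F + F') = T F + T F') \<and> (\<forall>c F. T (smul c F) = smul c (T F))
     \<and> (\<forall>g h F. (g, h) \<in> G \<longrightarrow> T (tact g h F) = tact g h (T F))"

lemma G_SO3_subset: "G_SO3 \<subseteq> G_SO3_SL2"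
  by (auto simp: G_SO3_def G_SO3_SL2_def SL2_def id2_def)

lemma nat_op_trI: "nat_op G_SO3_SL2 trI"
proof -
  have "trI (tact g h F) I J = tact g h (trI F) I J" if g: "g \<in> SO3" for g h F I J
  proof -
    let ?H = "\<lambda>b c. tact g h (\<lambda>I' J'. F (b # c # I') J') I J"
    have "trI (tact g h F) I J = (\<Sum>a<3. \<Sum>b<3. \<Sum>c<3. (g a b * g a c) * ?H b c)"
      by (simp add: trI_def tact_Cons_I sum_distrib_left mult.assoc)
    also have "\<dots> = (\<Sum>b<3. \<Sum>a<3. \<Sum>c<3. (g a b * g a c) * ?H b c)"
      by (rule sum.swap)
    also have "\<dots> = (\<Sum>b<3. \<Sum>c<3. \<Sum>a<3. (g a b * g a c) * ?H b c)"
      by (rule sum.cong[OF refl], rule sum.swap)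
    also have "\<dots> = (\<Sum>b<3. \<Sum>c<3. (if b = c then 1 else 0) * ?H b c)"
      by (intro sum.cong refl) (simp add: SO3_col[OF g, symmetric] sum_distrib_right)
    also have "\<dots> = (\<Sum>b<3. ?H b b)"
      by (intro sum.cong refl) (simp add: if_distrib[of "\<lambda>x. x * _"] cong: if_cong)
    also have "\<dots> = tact g h (trI F) I J"
      by (simp add: trI_def tact_sum)
    finally show ?thesis .
  qed
  then show ?thesis
    by (auto simp: nat_op_def G_SO3_SL2_def fun_eq_iff)
       (auto simp: trI_def sum.distrib sum_distrib_left)
qed

lemma nat_op_crI: "nat_op G_SO3_SL2 crI"
proof -
  have "crI (tact g h F) I J = tact g h (crI F) I J" if g: "g \<in> SO3" for g h F I J
  proof (cases I)
    case Nil
    then show ?thesis by (simp add: crI_def tact_def idx_lists_0)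
  next
    case (Cons k I')
    let ?H = "\<lambda>b c. tact g h (\<lambda>I' J'. F (b # c # I') J') I' J"
    have "crI (tact g h F) I J = (\<Sum>i<3. \<Sum>j<3. \<Sum>b<3. \<Sum>c<3. (eps3 k i j * (g i b * g j c)) * ?H b c)"
      by (simp add: crI_def Cons tact_Cons_I sum_distrib_left mult.assoc)
    also have "\<dots> = (\<Sum>i<3. \<Sum>b<3. \<Sum>j<3. \<Sum>c<3. (eps3 k i j * (g i b * g j c)) * ?H b c)"
      by (rule sum.cong[OF refl], rule sum.swap)
    also have "\<dots> = (\<Sum>b<3. \<Sum>i<3. \<Sum>j<3. \<Sum>c<3. (eps3 k i j * (g i b * g j c)) * ?H b c)"
      by (rule sum.swap)
    also have "\<dots> = (\<Sum>b<3. \<Sum>i<3. \<Sum>c<3. \<Sum>j<3. (eps3 k i j * (g i b * g j c)) * ?H b c)"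
      by (rule sum.cong[OF refl], rule sum.cong[OF refl], rule sum.swap)
    also have "\<dots> = (\<Sum>b<3. \<Sum>c<3. \<Sum>i<3. \<Sum>j<3. (eps3 k i j * (g i b * g j c)) * ?H b c)"
      by (rule sum.cong[OF refl], rule sum.swap)
    also have "\<dots> = (\<Sum>b<3. \<Sum>c<3. (\<Sum>m<3. g k m * eps3 m b c) * ?H b c)"
      by (intro sum.cong refl) (simp add: SO3_eps[OF g, symmetric] sum_distrib_right)
    also have "\<dots> = (\<Sum>b<3. \<Sum>c<3. \<Sum>m<3. g k m * (eps3 m b c * ?H b c))"
      by (simp add: sum_distrib_right mult.assoc)
    also have "\<dots> = (\<Sum>b<3. \<Sum>m<3. \<Sum>c<3. g k m * (eps3 m b c * ?H b c))"
      by (rule sum.cong[OF refl], rule sum.swap)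
    also have "\<dots> = (\<Sum>m<3. \<Sum>b<3. \<Sum>c<3. g k m * (eps3 m b c * ?H b c))"
      by (rule sum.swap)
    also have "\<dots> = tact g h (crI F) I J"
      by (simp add: Cons tact_Cons_I crI_def tact_sum tact_mult sum_distrib_left)
    finally show ?thesis .
  qed
  then show ?thesis
    by (auto simp: nat_op_def G_SO3_SL2_def fun_eq_iff)
       (auto simp: crI_def sum.distrib sum_distrib_left distrib_left mult_ac split: list.split)
qed

lemma nat_op_dltI: "nat_op G_SO3_SL2 dltI"
proof -
  have "dltI (tact g h F) I J = tact g h (dltI F) I J" if g: "g \<in> SO3" for g h F I J
  proof (cases "\<exists>i j I'. I = i # j # I'")
    case False
    then have I: "I = [] \<or> (\<exists>i. I = [i])" by (metis list.exhaust)
    then have "dltI (tact g h F) I J = 0" by (auto simp: dltI_def)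
    moreover have "tact g h (dltI F) I J = 0"
      using I by (auto simp: tact_Cons_I dltI_def) (auto simp: tact_def idx_lists_0)
    ultimately show ?thesis by simp
  next
    case True
    then obtain i j I' where I: "I = i # j # I'" by blast
    have "tact g h (dltI F) I J
        = (\<Sum>a<3. \<Sum>b<3. g i a * (g j b * tact g h (\<lambda>I' J'. if a = b then F I' J' else 0) I' J))"
      by (simp add: I tact_Cons_I dltI_def sum_distrib_left)
    also have "\<dots> = (\<Sum>a<3. \<Sum>b<3. if a = b then g i a * (g j b * tact g h F I' J) else 0)"
      by (intro sum.cong refl) (auto simp: tact_zero)
    also have "\<dots> = (\<Sum>a<3. g i a * g j a) * tact g h F I' J"
      by (simp add: sum_distrib_right mult.assoc)
    also have "\<dots> = dltI (tact g h F) I J"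
    proof (cases "i < 3 \<and> j < 3")
      case True
      then show ?thesis by (simp add: SO3_row[OF g] dltI_def I)
    next
      case False
      then have "(\<Sum>a<3. g i a * g j a) = 0" using SO3_out[OF g] by (intro sum.neutral) auto
      then show ?thesis using False by (auto simp: dltI_def I)
    qed
    finally show ?thesis by simp
  qed
  then show ?thesis
    by (auto simp: nat_op_def G_SO3_SL2_def fun_eq_iff)
       (auto simp: dltI_def split: list.split)
qed

lemma nat_op_epJ: "nat_op G_SO3_SL2 epJ"
proof -
  have "epJ (tact g h F) I J = tact g h (epJ F) I J" if h: "h \<in> SL2" for g h F I J
  proof -
    let ?H = "\<lambda>b c. tact g h (\<lambda>I' J'. F I' (b # c # J')) I J"
    have det: "h 0 0 * h 1 1 - h 0 1 * h 1 0 = 1" using h by (simp add: SL2_def)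
    have "epJ (tact g h F) I J = (h 0 0 * h 1 1 - h 0 1 * h 1 0) * (?H 0 1 - ?H 1 0)"
      by (simp add: epJ_def tact_Cons_J sum_lt_2 algebra_simps)
    also have "\<dots> = tact g h (epJ F) I J"
      using tact_diff[of g h "\<lambda>I' J'. F I' (0 # 1 # J')" "\<lambda>I' J'. F I' (1 # 0 # J')"]
      unfolding det epJ_def fun_diff_def by (simp add: fun_eq_iff)
    finally show ?thesis .
  qed
  then show ?thesis
    by (auto simp: nat_op_def G_SO3_SL2_def fun_eq_iff)
       (auto simp: epJ_def algebra_simps)
qed

lemma nat_op_rotI: "nat_op G_SO3_SL2 rotI"
proof -
  have "rotI (tact g h F) I J = tact g h (rotI F) I J" for g h F I J
  proof (cases I)
    case Nil
    then show ?thesis by (simp add: rotI_def tact_def idx_lists_0)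
  next
    case (Cons i I')
    then show ?thesis by (simp add: rotI_def tact_snoc_I tact_Cons_I)
  qed
  then show ?thesis
    by (auto simp: nat_op_def fun_eq_iff) (auto simp: rotI_def)
qed

lemma nat_op_rotJ: "nat_op G_SO3_SL2 rotJ"
proof -
  have "rotJ (tact g h F) I J = tact g h (rotJ F) I J" for g h F I J
  proof (cases J)
    case Nil
    then show ?thesis by (simp add: rotJ_def tact_def idx_lists_0)
  next
    case (Cons i J')
    then show ?thesis by (simp add: rotJ_def tact_snoc_J tact_Cons_J)
  qed
  then show ?thesis
    by (auto simp: nat_op_def fun_eq_iff) (auto simp: rotJ_def)
qed

text \<open>\<open>id2\<close> acts trivially only on indices below 2, since it is zero elsewhere;
  hence the range condition on \<open>J\<close>.\<close>

lemma tact_id2: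
  assumes "J \<in> idx_lists 2 n"
  shows "tact g id2 F I J = tact g id2 (\<lambda>I' _. F I' J) I []"
  using assms
proof (induction J arbitrary: F n)
  case Nil
  show ?case by (simp add: tact_def idx_lists_0)
next
  case (Cons a J)
  then have a: "a < 2" and J: "J \<in> idx_lists 2 (length J)" by (auto simp: idx_lists_def)
  have "tact g id2 F I (a # J) = tact g id2 (\<lambda>I' J'. F I' (a # J')) I J"
    using a by (auto simp: tact_Cons_J id2_def if_distrib[of "\<lambda>x. x * _"] cong: if_cong)
  also have "\<dots> = tact g id2 (\<lambda>I' _. F I' (a # J)) I []"
    by (rule Cons.IH[OF J])
  finally show ?case .
qed

lemma nat_op_slice: "nat_op G_SO3 (slice n C)"
proof -
  have "slice n C (tact g id2 F) I J = tact g id2 (slice n C F) I J" for g F I J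
  proof (cases J)
    case Nil
    have "slice n C (tact g id2 F) I J = (\<Sum>K\<in>idx_lists 2 n. C K * tact g id2 (\<lambda>I' _. F I' K) I [])"
      using tact_id2 by (simp add: Nil slice_def)
    also have "\<dots> = tact g id2 (\<lambda>I' _. \<Sum>K\<in>idx_lists 2 n. C K * F I' K) I []"
      by (simp add: tact_sum tact_mult)
    also have "\<dots> = tact g id2 (slice n C F) I J"
      by (simp add: Nil slice_def tact_def idx_lists_0)
    finally show ?thesis .
  next
    case (Cons a J')
    then show ?thesis by (simp add: slice_def tact_Cons_J tact_zero)
  qed
  then have "slice n C (tact g id2 F) = tact g id2 (slice n C F)" for g F
    by (intro ext)
  moreover have "slice n C (F + F') = slice n C F + slice n C F'" for F F'
    by (simp add: slice_def fun_eq_iff sum.distrib distrib_left)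
  moreover have "slice n C (smul c F) = smul c (slice n C F)" for c F
    by (simp add: slice_def fun_eq_iff sum_distrib_left mult_ac)
  ultimately show ?thesis
    by (auto simp: nat_op_def G_SO3_def)
qed

section \<open>Torsion tensors as tensors on V \<otimes> R^2\<close>

definition intertw :: "(mat \<times> mat) set \<Rightarrow> (torsion \<Rightarrow> tensor) \<Rightarrow> bool" where
  "intertw G \<Phi> \<longleftrightarrow> (\<forall>t s. \<Phi> (tadd t s) = \<Phi> t + \<Phi> s) \<and> (\<forall>c t. \<Phi> (tscale c t) = smul c (\<Phi> t))
     \<and> (\<forall>g h t. (g, h) \<in> G \<longrightarrow> \<Phi> (torsion_act g h t) = tact g h (\<Phi> t))"

lemma intertw_comp: "intertw G \<Phi> \<Longrightarrow> nat_op G T \<Longrightarrow> intertw G (\<lambda>t. T (\<Phi> t))"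
  unfolding intertw_def nat_op_def by simp

lemma intertw_add: "intertw G \<Phi> \<Longrightarrow> intertw G \<Psi> \<Longrightarrow> intertw G (\<lambda>t. \<Phi> t + \<Psi> t)"
  unfolding intertw_def by (simp add: tact_add) (simp add: fun_eq_iff algebra_simps)

lemma intertw_smul: "intertw G \<Phi> \<Longrightarrow> intertw G (\<lambda>t. smul c (\<Phi> t))"
  unfolding intertw_def by (simp add: tact_smul) (simp add: fun_eq_iff algebra_simps)

lemma intertw_diff: "intertw G \<Phi> \<Longrightarrow> intertw G \<Psi> \<Longrightarrow> intertw G (\<lambda>t. \<Phi> t - \<Psi> t)"
  unfolding intertw_def by (simp add: tact_diff) (simp add: fun_eq_iff algebra_simps)

lemma intertw_mono: "intertw G \<Phi> \<Longrightarrow> H \<subseteq> G \<Longrightarrow> intertw H \<Phi>"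
  unfolding intertw_def by blast

lemma sum_lt_6: "(\<Sum>x<6. f x) = (\<Sum>i<3. \<Sum>a<2. f (2 * i + a))" for f :: "nat \<Rightarrow> real"
  by (simp add: sum_lt_3 sum_lt_2) (simp add: eval_nat_numeral)

text \<open>The vector index is lowered with \<open>sigma\<close>, which identifies it with a covector index
  as \<open>SO(3) \<times> SL(2)\<close>-module.\<close>

definition low :: "torsion \<Rightarrow> tensor" where
  "low t = (\<lambda>I J. case (I, J) of ([i, j, k], [a, b, c]) \<Rightarrow>
      if i < 3 \<and> j < 3 \<and> k < 3 \<and> a < 2 \<and> b < 2 \<and> c < 2
      then (if c = 0 then t (2*i+a) (2*j+b) (2*k+1) else - t (2*i+a) (2*j+b) (2*k))
      else 0 | _ \<Rightarrow> 0)"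

lemma tact_in_range:
  assumes "g \<in> SO3" "h \<in> SL2" "\<not> (set I \<subseteq> {..<3} \<and> set J \<subseteq> {..<2})"
  shows "tact g h F I J = 0"
proof -
  have "(\<Prod>m<length I. g (I ! m) (I' ! m)) * (\<Prod>m<length J. h (J ! m) (J' ! m)) = 0" for I' J'
  proof (cases "set I \<subseteq> {..<3}")
    case False
    then obtain m where m: "m < length I" "\<not> I ! m < 3"
      by (metis in_set_conv_nth lessThan_iff subsetI)
    then have "(\<Prod>m<length I. g (I ! m) (I' ! m)) = 0"
      using SO3_out[OF assms(1)] by (intro prod_zero bexI[of _ m]) auto
    then show ?thesis by simp
  next
    case True
    then have "\<not> set J \<subseteq> {..<2}" using assms by blast
    then obtain m where m: "m < length J" "\<not> J ! m < 2"
      by (metis in_set_conv_nth lessThan_iff subsetI)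
    then have "(\<Prod>m<length J. h (J ! m) (J' ! m)) = 0"
      using assms(2) by (intro prod_zero bexI[of _ m]) (auto simp: SL2_def)
    then show ?thesis by simp
  qed
  then show ?thesis unfolding tact_def by (simp only: mult_zero_left sum.neutral_const)
qed

lemma covact_pair:
  "i < 3 \<Longrightarrow> i' < 3 \<Longrightarrow> a < 2 \<Longrightarrow> a' < 2 \<Longrightarrow> covact g h (2*i+a) (2*i'+a') = g i i' * h a a'"
  by (auto simp: covact_def)

lemma low_short: "length I \<noteq> 3 \<or> length J \<noteq> 3 \<Longrightarrow> low t I J = 0"
  by (auto simp: low_def split: list.splits)

lemma tact_short:
  assumes "\<And>I J. length I \<noteq> m \<or> length J \<noteq> n \<Longrightarrow> F I J = 0" "length I \<noteq> m \<or> length J \<noteq> n"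
  shows "tact g h F I J = 0"
  unfolding tact_def using assms by (intro sum.neutral ballI) (auto simp: idx_lists_def)

lemma sum_regroup:
  "(\<Sum>a\<in>A. \<Sum>j\<in>B. \<Sum>b\<in>C. \<Sum>k\<in>D. f a j b k) = (\<Sum>j\<in>B. \<Sum>k\<in>D. \<Sum>a\<in>A. \<Sum>b\<in>C. f a j b k)"
  for f :: "nat \<Rightarrow> nat \<Rightarrow> nat \<Rightarrow> nat \<Rightarrow> real"
proof -
  have "(\<Sum>a\<in>A. \<Sum>b\<in>C. \<Sum>k\<in>D. f a j b k) = (\<Sum>k\<in>D. \<Sum>a\<in>A. \<Sum>b\<in>C. f a j b k)" for j
  proof -
    have "(\<Sum>a\<in>A. \<Sum>b\<in>C. \<Sum>k\<in>D. f a j b k) = (\<Sum>a\<in>A. \<Sum>k\<in>D. \<Sum>b\<in>C. f a j b k)"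
      by (rule sum.cong[OF refl], rule sum.swap)
    also have "\<dots> = (\<Sum>k\<in>D. \<Sum>a\<in>A. \<Sum>b\<in>C. f a j b k)"
      by (rule sum.swap)
    finally show ?thesis .
  qed
  then show ?thesis by (subst sum.swap) simp
qed

text \<open>The area form identifies the standard representation of SL(2) with its dual: exchanging
  0 and 1 with a sign in both indices of \<open>invT2 h\<close> returns \<open>h\<close>.
  \<open>low\<close> performs this exchange on the vector index, and the two cases of
  \<open>c\<close> differ by that sign.\<close>

lemma low_torsion_act:
  assumes g: "g \<in> SO3" and h: "h \<in> SL2"
  shows "low (torsion_act g h t) I J = tact g h (low t) I J"
proof (cases "I \<in> idx_lists 3 3 \<and> J \<in> idx_lists 2 3")
  case False
  show ?thesis
  proof (cases "length I = 3 \<and> length J = 3")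
    case True
    then have *: "\<not> (set I \<subseteq> {..<3} \<and> set J \<subseteq> {..<2})"
      using False by (auto simp: idx_lists_def)
    have "low (torsion_act g h t) I J = 0"
      using True * by (auto simp: low_def split: list.splits)
    then show ?thesis using tact_in_range[OF g h *] by simp
  next
    case False
    then show ?thesis using low_short tact_short[of 3 3 "low t"] by auto
  qed
next
  case True
  then obtain i j k a b c where IJ: "I = [i, j, k]" "J = [a, b, c]"
    and lt: "i < 3" "j < 3" "k < 3" "a < 2" "b < 2" "c < 2"
    by (auto simp: idx_lists_def numeral_3_eq_3 length_Suc_conv)
  let ?R = "\<lambda>c. \<Sum>i'<3. \<Sum>a'<2. \<Sum>j'<3. \<Sum>b'<2. \<Sum>k'<3.
     g i i' * h a a' * (g j j' * h b b') * g k k' *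
     (invT2 h c 0 * t (2*i'+a') (2*j'+b') (2*k') + invT2 h c 1 * t (2*i'+a') (2*j'+b') (2*k'+1))"
  have act: "torsion_act g h t (2*i+a) (2*j+b) (2*k+d) = ?R d" if "d < 2" for d
  proof -
    have "torsion_act g h t (2*i+a) (2*j+b) (2*k+d) =
      (\<Sum>i'<3. \<Sum>a'<2. \<Sum>j'<3. \<Sum>b'<2. \<Sum>k'<3. \<Sum>c'<2.
        g i i' * h a a' * (g j j' * h b b') * (g k k' * invT2 h d c') * t (2*i'+a') (2*j'+b') (2*k'+c'))"
      using lt that unfolding torsion_act_def sum_lt_6 vecact_def
      by (intro sum.cong refl) (simp only: covact_pair lessThan_iff)
    also have "\<dots> = ?R d"
      by (intro sum.cong refl) (simp add: sum_lt_2 distrib_left mult.assoc)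
    finally show ?thesis .
  qed
  have *: "tact g h (low t) I J =
    (\<Sum>i'<3. \<Sum>j'<3. \<Sum>k'<3. \<Sum>a'<2. \<Sum>b'<2. \<Sum>c'<2. g i i' * (g j j' * (g k k' * (h a a' * (h b b' * (h c c' *
       low t [i',j',k'] [a',b',c']))))))"
    unfolding IJ by (simp only: tact_Cons_I) (simp add: tact_Cons_J tact_Nil sum_distrib_left)
  have c: "c = 0 \<or> c = 1" using lt by auto
  then have "low (torsion_act g h t) I J = (\<Sum>i'<3. \<Sum>a'<2. \<Sum>j'<3. \<Sum>b'<2. \<Sum>k'<3. \<Sum>c'<2.
     g i i' * (g j j' * (g k k' * (h a a' * (h b b' * (h c c' * low t [i',j',k'] [a',b',c']))))))"
  proof
    assume c: "c = 0"
    have "low (torsion_act g h t) I J = ?R 1"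
      using act[of 1] lt by (simp add: low_def IJ c)
    also have "\<dots> = (\<Sum>i'<3. \<Sum>a'<2. \<Sum>j'<3. \<Sum>b'<2. \<Sum>k'<3. \<Sum>c'<2.
     g i i' * (g j j' * (g k k' * (h a a' * (h b b' * (h c c' * low t [i',j',k'] [a',b',c']))))))"
      by (intro sum.cong refl) (simp add: sum_lt_2 low_def invT2_def c algebra_simps)
    finally show ?thesis .
  next
    assume c: "c = 1"
    have "low (torsion_act g h t) I J = - ?R 0"
      using act[of 0] lt by (simp add: low_def IJ c)
    also have "\<dots> = (\<Sum>i'<3. \<Sum>a'<2. \<Sum>j'<3. \<Sum>b'<2. \<Sum>k'<3. \<Sum>c'<2.
     g i i' * (g j j' * (g k k' * (h a a' * (h b b' * (h c c' * low t [i',j',k'] [a',b',c']))))))"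
      unfolding sum_negf[symmetric]
      by (intro sum.cong refl) (simp add: sum_lt_2 low_def invT2_def c algebra_simps)
    finally show ?thesis .
  qed
  also have "\<dots> = tact g h (low t) I J"
    unfolding * by (rule sum.cong[OF refl], rule sum_regroup)
  finally show ?thesis .
qed

lemma intertw_low: "intertw G_SO3_SL2 low"
proof -
  have "low (tadd t s) = low t + low s" for t s
    by (auto simp: low_def tadd_def fun_eq_iff split: list.split)
  moreover have "low (tscale c t) = smul c (low t)" for c t
    by (auto simp: low_def tscale_def fun_eq_iff split: list.split)
  ultimately show ?thesis
    using low_torsion_act by (auto simp: intertw_def G_SO3_SL2_def fun_eq_iff)
qed

subsection \<open>Irreducible components and quotients\<close>

definition supp :: "nat \<Rightarrow> nat \<Rightarrow> tensor \<Rightarrow> bool" where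
  "supp k q F \<longleftrightarrow> (\<forall>I J. \<not> (I \<in> idx_lists 3 k \<and> J \<in> idx_lists 2 q) \<longrightarrow> F I J = 0)"

definition irr :: "nat \<times> nat \<Rightarrow> tensor \<Rightarrow> bool" where
  "irr s F \<longleftrightarrow> supp (fst s) (snd s) F \<and> (\<forall>I I' J. mset I = mset I' \<longrightarrow> F I J = F I' J)
     \<and> (\<forall>I J J'. mset J = mset J' \<longrightarrow> F I J = F I J') \<and> (\<forall>I J. trI F I J = 0)"

lemma irrep_sum_iff:
  "F \<in> irrep_sum S \<longleftrightarrow> (\<forall>j<length S. irr (S ! j) (F j)) \<and> (\<forall>j. \<not> j < length S \<longrightarrow> F j = (\<lambda>I J. 0))"
proof
  assume F: "F \<in> irrep_sum S"
  then show "(\<forall>j<length S. irr (S ! j) (F j)) \<and> (\<forall>j. \<not> j < length S \<longrightarrow> F j = (\<lambda>I J. 0))"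
    unfolding irrep_sum_def irr_def supp_def trI_def fun_eq_iff mem_Collect_eq by blast
next
  assume F: "(\<forall>j<length S. irr (S ! j) (F j)) \<and> (\<forall>j. \<not> j < length S \<longrightarrow> F j = (\<lambda>I J. 0))"
  then have z: "F j I J = 0" if "\<not> j < length S" for j I J
    using that by simp
  have irr: "irr (S ! j) (F j)" if "j < length S" for j
    using F that by blast
  have "F j I J = F j I' J" if "mset I = mset I'" for j I I' J
    using irr[of j, unfolded irr_def] z[of j] that by (cases "j < length S") metis+
  moreover have "F j I J = F j I J'" if "mset J = mset J'" for j I J J'
    using irr[of j, unfolded irr_def] z[of j] that by (cases "j < length S") metis+
  moreover have "(\<Sum>a<3. F j (a # a # I) J) = 0" for j I J
    using irr[of j, unfolded irr_def trI_def] z[of j] by (cases "j < length S") (blast, simp)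
  moreover have "F j I J = 0"
    if "\<not> (j < length S \<and> I \<in> idx_lists 3 (fst (S ! j)) \<and> J \<in> idx_lists 2 (snd (S ! j)))" for j I J
    using irr[of j, unfolded irr_def supp_def] z[of j] that by (cases "j < length S") metis+
  ultimately show "F \<in> irrep_sum S"
    unfolding irrep_sum_def mem_Collect_eq by blast
qed

text \<open>One intertwiner per summand is stacked into a single map. Surjectivity and kernel are
  required jointly, because several summands may be isomorphic to each other.\<close>

lemma quotient_isoI:
  assumes len: "length \<Phi> = length S"
    and tw: "\<And>j. j < length S \<Longrightarrow> intertw G (\<Phi> ! j)"
    and irr: "\<And>j t. j < length S \<Longrightarrow> t \<in> D \<Longrightarrow> irr (S ! j) ((\<Phi> ! j) t)"
    and surj: "\<And>F. (\<And>j. j < length S \<Longrightarrow> irr (S ! j) (F j)) \<Longrightarrow> \<exists>t\<in>D. \<forall>j<length S. (\<Phi> ! j) t = F j"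
    and ker: "\<And>t. t \<in> D \<Longrightarrow> (\<forall>j<length S. \<forall>I J. (\<Phi> ! j) t I J = 0) \<longleftrightarrow> t \<in> N"
  shows "quotient_iso G D N S"
proof -
  define \<phi> where "\<phi> t j = (if j < length S then (\<Phi> ! j) t else (\<lambda>I J. 0))" for t j
  have 1: "\<phi> t \<in> irrep_sum S" if "t \<in> D" for t
    using irr that by (auto simp: irrep_sum_iff \<phi>_def)
  have 2: "\<phi> (tadd t s) = madd (\<phi> t) (\<phi> s)" for t s
  proof (intro ext)
    fix j I J
    show "\<phi> (tadd t s) j I J = madd (\<phi> t) (\<phi> s) j I J"
      using tw[of j] by (cases "j < length S") (simp_all add: \<phi>_def madd_def intertw_def)
  qed
  have 3: "\<phi> (tscale c t) = mscale c (\<phi> t)" for c t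
  proof (intro ext)
    fix j I J
    show "\<phi> (tscale c t) j I J = mscale c (\<phi> t) j I J"
      using tw[of j] by (cases "j < length S") (simp_all add: \<phi>_def mscale_def intertw_def)
  qed
  have 4: "\<phi> (torsion_act g h t) = irrep_act g h (\<phi> t)" if "(g, h) \<in> G" for g h t
  proof
    fix j
    show "\<phi> (torsion_act g h t) j = irrep_act g h (\<phi> t) j"
      using tw[of j] that unfolding irrep_act_component
      by (cases "j < length S") (auto simp: \<phi>_def intertw_def tact_zero fun_eq_iff)
  qed
  have 5: "irrep_sum S \<subseteq> \<phi> ` D"
  proof
    fix F assume F: "F \<in> irrep_sum S"
    then obtain t where t: "t \<in> D" "\<forall>j<length S. (\<Phi> ! j) t = F j"
      using surj[of F] by (auto simp: irrep_sum_iff)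
    have "F = \<phi> t" using t F by (auto simp: \<phi>_def irrep_sum_iff fun_eq_iff)
    with t show "F \<in> \<phi> ` D" by blast
  qed
  have 6: "\<phi> t = (\<lambda>_ _ _. 0) \<longleftrightarrow> t \<in> N" if "t \<in> D" for t
    unfolding ker[OF that, symmetric] by (auto simp: \<phi>_def fun_eq_iff)
  show ?thesis
    unfolding quotient_iso_def
  proof (intro exI[of _ \<phi>] conjI ballI allI)
    fix p t assume "p \<in> G"
    then show "case p of (g, h) \<Rightarrow> \<forall>t\<in>D. \<phi> (torsion_act g h t) = irrep_act g h (\<phi> t)"
      using 4 by (cases p) simp
  qed (use 1 2 3 5 6 in simp_all)
qed

section \<open>Degrees and symmetries of tensors\<close>

lemma supp_low: "supp 3 3 (low t)"
  by (auto simp: supp_def low_def idx_lists_def split: list.split)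

lemma supp_trI: "supp (Suc (Suc k)) q F \<Longrightarrow> supp k q (trI F)"
  unfolding supp_def trI_def idx_lists_def by (intro allI impI sum.neutral) auto

lemma supp_crI: "supp (Suc (Suc k)) q F \<Longrightarrow> supp (Suc k) q (crI F)"
proof -
  assume F: "supp (Suc (Suc k)) q F"
  show ?thesis
    unfolding supp_def
  proof (intro allI impI)
    fix I J assume IJ: "\<not> (I \<in> idx_lists 3 (Suc k) \<and> J \<in> idx_lists 2 q)"
    have "eps3 l i j * F (i # j # I') J = 0" if "I = l # I'" for l i j I'
    proof (cases "l < 3 \<and> i < 3 \<and> j < 3")
      case True
      then have "F (i # j # I') J = 0"
        using F IJ that by (auto simp: supp_def idx_lists_def)
      then show ?thesis by simp
    next
      case False
      then show ?thesis by (auto simp: eps3_def)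
    qed
    then have "(\<Sum>i<3. \<Sum>j<3. eps3 l i j * F (i # j # I') J) = 0" if "I = l # I'" for l I'
      using that by (intro sum.neutral ballI) blast
    then show "crI F I J = 0" by (cases I) (simp_all add: crI_def)
  qed
qed

lemma supp_dltI: "supp k q F \<Longrightarrow> supp (Suc (Suc k)) q (dltI F)"
  unfolding supp_def dltI_def idx_lists_def by (auto split: list.split)

lemma supp_epJ: "supp k (Suc (Suc q)) F \<Longrightarrow> supp k q (epJ F)"
  unfolding supp_def epJ_def idx_lists_def by auto

lemma supp_rotI: "supp k q F \<Longrightarrow> supp k q (rotI F)"
  unfolding supp_def rotI_def idx_lists_def by auto

lemma supp_rotJ: "supp k q F \<Longrightarrow> supp k q (rotJ F)"
  unfolding supp_def rotJ_def idx_lists_def by auto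

lemma supp_add: "supp k q F \<Longrightarrow> supp k q G \<Longrightarrow> supp k q (F + G)"
  unfolding supp_def by auto

lemma supp_diff: "supp k q F \<Longrightarrow> supp k q G \<Longrightarrow> supp k q (F - G)"
  unfolding supp_def by auto

lemma supp_smul: "supp k q F \<Longrightarrow> supp k q (smul c F)"
  unfolding supp_def by auto

lemma supp_slice: "supp k q F \<Longrightarrow> supp k 0 (slice n C F)"
  unfolding supp_def slice_def idx_lists_def by auto

lemma supp_eqI:
  assumes "supp k q F" "supp k q G" "\<And>I J. I \<in> idx_lists 3 k \<Longrightarrow> J \<in> idx_lists 2 q \<Longrightarrow> F I J = G I J"
  shows "F = G"
  using assms unfolding supp_def fun_eq_iff by metis

text \<open>Invariance under rotation and under transposition of the first two entries generates
  invariance under all permutations of three entries.\<close>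

definition symlist :: "nat \<Rightarrow> nat \<Rightarrow> (nat list \<Rightarrow> real) \<Rightarrow> bool" where
  "symlist n k f \<longleftrightarrow> (k = 2 \<longrightarrow> (\<forall>a<n. \<forall>b<n. f [a, b] = f [b, a])) \<and>
     (k = 3 \<longrightarrow> (\<forall>a<n. \<forall>b<n. \<forall>c<n. f [a, b, c] = f [b, a, c] \<and> f [a, b, c] = f [b, c, a]))"

lemma mset_pair_eq: "{#a, b#} = {#c, d#} \<longleftrightarrow> a = c \<and> b = d \<or> a = d \<and> b = (c::nat)"
  by (auto simp: add_eq_conv_ex)

lemma mset_triple_eq:
  "{#a, b, c#} = {#x, y, z#} \<longleftrightarrow> a = x \<and> {#b, c#} = {#y, z#} \<or> a = y \<and> {#b,c#} = {#x,z#} \<or> a = z \<and> {#b,c#} = {#x,y::nat#}"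
  (is "?L = ?R")
proof
  assume L: ?L
  then have "a \<in># {#x,y,z#}" by (metis union_single_eq_member)
  then have "a = x \<or> a = y \<or> a = z" by simp
  then show ?R using L by (elim disjE) (simp_all add: add_mset_commute)
qed (auto simp: add_mset_commute)

lemma symlist_mset:
  assumes "symlist n k f" "k \<le> 3" "I \<in> idx_lists n k" "mset I = mset I'"
  shows "f I = f I'"
proof -
  have len: "length I' = length I" and set: "set I' = set I"
    using assms(4) by (metis size_mset, metis set_mset_mset)
  consider "k = 0" | "k = 1" | "k = 2" | "k = 3" using assms(2) by linarith
  then show ?thesis
  proof cases
    case 1
    then show ?thesis using assms len by (auto simp: idx_lists_def)
  next
    case 2
    then obtain a where "I = [a]" using assms(3) by (auto simp: idx_lists_def length_Suc_conv)
    then show ?thesis using assms(4) by auto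
  next
    case 3
    then obtain a b where I: "I = [a, b]" "a < n" "b < n"
      using assms(3) by (auto simp: idx_lists_def length_Suc_conv numeral_2_eq_2)
    then obtain c d where I': "I' = [c, d]" using len by (auto simp: length_Suc_conv)
    show ?thesis using assms(1,4) 3 I(2,3) unfolding I(1) I' symlist_def
      by (auto simp: mset_pair_eq)
  next
    case 4
    then obtain a b c where I: "I = [a, b, c]" "a < n" "b < n" "c < n"
      using assms(3) by (auto simp: idx_lists_def length_Suc_conv numeral_3_eq_3)
    then obtain x y z where I': "I' = [x, y, z]" using len by (auto simp: length_Suc_conv)
    have eqs: "f [b, a, c] = f [a, b, c]" "f [b, c, a] = f [a, b, c]" "f [c, a, b] = f [a, b, c]"
      "f [a, c, b] = f [c, a, b]" "f [c, b, a] = f [b, c, a]"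
      using assms(1)[unfolded symlist_def] 4 I(2-4) by metis+
    have "(x, y, z) \<in> {(a,b,c), (a,c,b), (b,a,c), (b,c,a), (c,a,b), (c,b,a)}"
      using assms(4) unfolding I(1) I' by (auto simp: mset_pair_eq mset_triple_eq)
    then show ?thesis unfolding I(1) I'
      by (elim insertE) (auto simp: eqs)
  qed
qed

text \<open>In degree at most three the generators recorded in \<open>symlist\<close> give all
  permutations, and index lists of other lengths or ranges are handled by the support.\<close>

lemma irrI:
  assumes F: "supp k q F" and "k \<le> 3" "q \<le> 3"
    and I: "\<And>J. J \<in> idx_lists 2 q \<Longrightarrow> symlist 3 k (\<lambda>I. F I J)"
    and J: "\<And>I. I \<in> idx_lists 3 k \<Longrightarrow> symlist 2 q (F I)"
    and tr: "\<And>J. J \<in> idx_lists 2 q \<Longrightarrow> k = 2 \<Longrightarrow> trI F [] J = 0"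
      "\<And>J i. J \<in> idx_lists 2 q \<Longrightarrow> k = 3 \<Longrightarrow> i < 3 \<Longrightarrow> trI F [i] J = 0"
  shows "irr (k, q) F"
proof -
  have mem: "I' \<in> idx_lists n k \<longleftrightarrow> I \<in> idx_lists n k" if "mset I = mset I'" for I I' n k
    using mset_eq_length[OF that] mset_eq_setD[OF that] by (simp add: idx_lists_def)
  have 1: "F I J = F I' J" if "mset I = mset I'" for I I' J
  proof (cases "I \<in> idx_lists 3 k \<and> J \<in> idx_lists 2 q")
    case True
    then show ?thesis using symlist_mset[OF I[of J] \<open>k \<le> 3\<close> _ that] by simp
  next
    case False
    then show ?thesis using F mem[OF that] by (auto simp: supp_def)
  qed
  have 2: "F I J = F I J'" if "mset J = mset J'" for I J J'
  proof (cases "I \<in> idx_lists 3 k \<and> J \<in> idx_lists 2 q")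
    case True
    then show ?thesis using symlist_mset[OF J[of I] \<open>q \<le> 3\<close> _ that] by simp
  next
    case False
    then show ?thesis using F mem[OF that] by (auto simp: supp_def)
  qed
  have 3: "trI F I J = 0" for I J
  proof (cases "J \<in> idx_lists 2 q \<and> set I \<subseteq> {..<3} \<and> Suc (Suc (length I)) = k")
    case True
    then consider "k = 2" "I = []" | i where "k = 3" "I = [i]" "i < 3"
      using \<open>k \<le> 3\<close> by (cases I) (auto simp: le_Suc_eq numeral_3_eq_3)
    then show ?thesis using tr True by cases auto
  next
    case False
    then have "F (a # a # I) J = 0" if "a < 3" for a
    proof -
      have "\<not> (a # a # I \<in> idx_lists 3 k \<and> J \<in> idx_lists 2 q)"
        using False by (auto simp: idx_lists_def)
      then show ?thesis using F unfolding supp_def by blast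
    qed
    then show ?thesis by (simp add: trI_def)
  qed
  show ?thesis unfolding irr_def fst_conv snd_conv using F 1 2 3 by blast
qed

subsection \<open>Derivatives of the invariant 3-forms\<close>

text \<open>A torsion is skew in its two arguments, so antisymmetrising their V-indices extracts the
  \<Lambda>^2V \<otimes> S^2R^2 part of \<Lambda>^2(V \<otimes> R^2).\<close>

definition crlow :: "torsion \<Rightarrow> tensor" where
  "crlow t = crI (low t)"

text \<open>On a torsion tensor \<open>crlow\<close> is already symmetric in its first two
  R^2-indices, so the cyclic sum is a full symmetrisation: it projects S^2R^2 \<otimes> R^2 to
  B^3.\<close>

definition Nten :: "torsion \<Rightarrow> tensor" where
  "Nten t = crlow t + rotJ (crlow t) + rotJ (rotJ (crlow t))"

definition Rten :: "torsion \<Rightarrow> tensor" where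
  "Rten t = trI (rotI (rotI (low t)))"

text \<open>The first term is minus the trace 1-form of the torsion; the second contracts the
  R^2-indices of the two arguments instead. This difference of the two is what the derivatives of
  3-forms contain.\<close>

definition Qten :: "torsion \<Rightarrow> tensor" where
  "Qten t = epJ (rotJ (rotJ (Rten t))) - epJ (Rten t)"

text \<open>\<open>kform x\<close> is \<open>x 0 e^135 + x 1 (e^136 + e^145 + e^235) + x 2 (e^146 + e^236 + e^245) + x 3 e^246\<close>.\<close>

definition kform :: "(nat \<Rightarrow> real) \<Rightarrow> form" where
  "kform x L = (case L of [a, b, c] \<Rightarrow>
     eps3 (a div 2) (b div 2) (c div 2) * x (a mod 2 + b mod 2 + c mod 2) | _ \<Rightarrow> 0)"

lemma sum_lt_6_expand: "(\<Sum>i<6. f i) = f 0 + f 1 + f 2 + f 3 + f 4 + f (5::nat)" for f :: "nat \<Rightarrow> real"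
  by (simp add: eval_nat_numeral)

lemma dform_3:
  assumes "w < 6" "x < 6" "y < 6" "z < 6"
  shows "dform \<alpha> 3 t [w, x, y, z] =
    - (\<Sum>v<6. t w x v * \<alpha> [v, y, z]) + (\<Sum>v<6. t w y v * \<alpha> [v, x, z]) - (\<Sum>v<6. t w z v * \<alpha> [v, x, y])
    - (\<Sum>v<6. t x y v * \<alpha> [v, w, z]) + (\<Sum>v<6. t x z v * \<alpha> [v, w, y]) - (\<Sum>v<6. t y z v * \<alpha> [v, w, x])"
proof -
  let ?L = "[w, x, y, z]"
  define T where "T i j = (-1) ^ (i + j) * (\<Sum>v<6. t (?L ! i) (?L ! j) v *
    \<alpha> (v # [?L ! m. m \<leftarrow> [0,1,2,3], m \<noteq> i \<and> m \<noteq> j]))" for i j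
  have S: "{..<4} = {0,1,2,3::nat}" "{Suc 0..<4} = {1,2,3::nat}" "{Suc (Suc 0)..<4} = {2,3::nat}"
    "{3..<4} = {3::nat}" by auto
  have L: "length ?L = Suc 3 \<and> set ?L \<subseteq> {..<6}" using assms by simp
  have U: "[0..<Suc 3] = [0,1,2,3]" by (simp add: upt_rec)
  have "dform \<alpha> 3 t ?L = (\<Sum>i<Suc 3. \<Sum>j\<in>{Suc i..<Suc 3}. T i j)"
    unfolding dform_def T_def U if_P[OF L] by (rule refl)
  also have "\<dots> = T 0 1 + T 0 2 + T 0 3 + T 1 2 + T 1 3 + T 2 3"
    by (simp add: S)
  finally show ?thesis by (simp add: T_def)
qed

lemma dform_2:
  assumes "x < 6" "y < 6" "z < 6"
  shows "dform \<alpha> 2 t [x, y, z] =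
    - (\<Sum>v<6. t x y v * \<alpha> [v, z]) + (\<Sum>v<6. t x z v * \<alpha> [v, y]) - (\<Sum>v<6. t y z v * \<alpha> [v, x])"
proof -
  let ?L = "[x, y, z]"
  define T where "T i j = (-1) ^ (i + j) * (\<Sum>v<6. t (?L ! i) (?L ! j) v *
    \<alpha> (v # [?L ! m. m \<leftarrow> [0,1,2], m \<noteq> i \<and> m \<noteq> j]))" for i j
  have S: "{..<3} = {0,1,2::nat}" "{Suc 0..<3} = {1,2::nat}" "{Suc (Suc 0)..<3} = {2::nat}" by auto
  have L: "length ?L = Suc 2 \<and> set ?L \<subseteq> {..<6}" using assms by simp
  have U: "[0..<Suc 2] = [0,1,2]" by (simp add: upt_rec)
  have "dform \<alpha> 2 t ?L = (\<Sum>i<Suc 2. \<Sum>j\<in>{Suc i..<Suc 2}. T i j)"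
    unfolding dform_def T_def U if_P[OF L] by (rule refl)
  also have "\<dots> = T 0 1 + T 0 2 + T 1 2"
    by (simp add: S)
  finally show ?thesis by (simp add: T_def)
qed

text \<open>The SL(2)-invariant symplectic pairing of B^3 between the cubic \<open>x\<close> and
  \<open>Nten t\<close>, divided by 6; the factors 3 count the words with the given number of
  ones.\<close>

definition Nx :: "(nat \<Rightarrow> real) \<Rightarrow> torsion \<Rightarrow> nat \<Rightarrow> nat \<Rightarrow> real" where
  "Nx x t p q = (x 3 * Nten t [p, q] [0,0,0] - 3 * x 2 * Nten t [p, q] [0,0,1]
     + 3 * x 1 * Nten t [p, q] [0,1,1] - x 0 * Nten t [p, q] [1,1,1]) / 6"

text \<open>Component n of an element of S^2R^2: a sixth of the double contraction (second
  transvectant) of \<open>x\<close> with \<open>crI (Nten t)\<close> plus a third of the single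
  contraction of \<open>x\<close> with \<open>Qten t\<close>, both formed with the area form of R^2
  and symmetrised.\<close>

definition Mx :: "(nat \<Rightarrow> real) \<Rightarrow> torsion \<Rightarrow> nat \<Rightarrow> nat \<Rightarrow> real" where
  "Mx x t n m = (let C = crI (Nten t) [m]; Q = Qten t [m] in
     if n = 0 then x 0 * (C [0,1,1] / 6 - Q [1] / 3) + x 1 * (Q [0] / 3 - C [0,0,1] / 3) + x 2 * C [0,0,0] / 6
     else if n = 1 then (x 0 * C [1,1,1] / 6 - x 1 * (2 * Q [1] / 3 + C [0,1,1] / 6)
       + x 2 * (2 * Q [0] / 3 - C [0,0,1] / 6) + x 3 * C [0,0,0] / 6) / 2
     else x 1 * C [1,1,1] / 6 - x 2 * (C [0,1,1] / 3 + Q [1] / 3) + x 3 * (Q [0] / 3 + C [0,0,1] / 6))"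

lemma torsion_swap: "t \<in> torsion_space \<Longrightarrow> t y x z = - t x y z"
  unfolding torsion_space_def by blast

lemma torsion_antisym: "t \<in> torsion_space \<Longrightarrow> x < y \<Longrightarrow> t y x z = - t x y z"
  by (rule torsion_swap)

lemma torsion_diag: "t \<in> torsion_space \<Longrightarrow> t x x z = 0"
  using torsion_swap[of t x x z] by linarith

definition cyc3 :: "(nat \<times> nat \<times> nat) set" where
  "cyc3 = {(0, 1, 2), (1, 2, 0), (2, 0, 1)}"

lemma eps3_values:
  "eps3 0 1 2 = 1" "eps3 1 2 0 = 1" "eps3 2 0 1 = 1" "eps3 0 2 1 = -1" "eps3 2 1 0 = -1" "eps3 1 0 2 = -1"
  "eps3 i i k = 0" "eps3 i k k = 0" "eps3 i k i = 0"
  by (simp_all add: eps3_def)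

lemmas expand_ops = crlow_def Nten_def Rten_def Qten_def trI_def crI_def rotI_def rotJ_def epJ_def
  sum_lt_3 eps3_values[simplified] low_def

lemmas num_simps = numeral_2_eq_2[symmetric]

lemma dform_kform_A:
  assumes "t \<in> torsion_space" "(m, p, q) \<in> cyc3"
  shows "dform (kform x) 3 t [2*p, 2*p+1, 2*q, 2*q+1] = Nx x t m m"
  using assms(2) unfolding cyc3_def
  by (elim insertE emptyE; simp add: dform_3 kform_def sum_lt_6_expand Nx_def expand_ops
      torsion_antisym[OF assms(1)] torsion_diag[OF assms(1)] num_simps; simp add: field_simps)

text \<open>In the two mixed components the sum isolates the S^2R^2-valued part and the difference
  the symmetric part of \<open>Nx\<close>.\<close>

lemma dform_kform_B:
  assumes "t \<in> torsion_space" "(m, p, q) \<in> cyc3"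
  shows "dform (kform x) 3 t [2*m, 2*m+1, 2*p, 2*q] = Mx x t 0 m"
    "dform (kform x) 3 t [2*m, 2*m+1, 2*p+1, 2*q+1] = Mx x t 2 m"
    "dform (kform x) 3 t [2*m, 2*m+1, 2*p, 2*q+1] = Mx x t 1 m - (Nx x t p q + Nx x t q p) / 2"
    "dform (kform x) 3 t [2*m, 2*m+1, 2*p+1, 2*q] = Mx x t 1 m + (Nx x t p q + Nx x t q p) / 2"
  using assms(2) unfolding cyc3_def
  by (elim insertE emptyE; simp add: dform_3 kform_def sum_lt_6_expand Mx_def Nx_def expand_ops
      torsion_antisym[OF assms(1)] torsion_diag[OF assms(1)] num_simps; simp add: field_simps)+

text \<open>Four indices spread over three planes must contain a full plane: of the 15 components, 3
  contain two full planes and 12 contain one plane and one index from each of the other two.\<close>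

lemma alternating4_zero:
  fixes f :: "nat \<Rightarrow> nat \<Rightarrow> nat \<Rightarrow> nat \<Rightarrow> real"
  assumes s1: "\<And>w x y z. f x w y z = - f w x y z" and s2: "\<And>w x y z. f w y x z = - f w x y z"
    and s3: "\<And>w x y z. f w x z y = - f w x y z"
    and z: "\<And>m p q. (m, p, q) \<in> cyc3 \<Longrightarrow> f (2*p) (2*p+1) (2*q) (2*q+1) = 0"
      "\<And>m p q a b. (m, p, q) \<in> cyc3 \<Longrightarrow> a < 2 \<Longrightarrow> b < 2 \<Longrightarrow> f (2*m) (2*m+1) (2*p+a) (2*q+b) = 0"
    and lt: "w < 6" "x < 6" "y < 6" "z < 6"
  shows "f w x y z = 0"
proof -
  have d: "f w w y z = 0" "f w y y z = 0" "f w x y y = 0" for w x y z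
    using s1[of w w y z] s2[of w y y z] s3[of w x y y] by linarith+
  have c: "(0, 1, 2) \<in> cyc3" "(1, 2, 0) \<in> cyc3" "(2, 0, 1) \<in> cyc3" by (simp_all add: cyc3_def)
  have zz: "f 2 3 4 5 = 0" "f 4 5 0 1 = 0" "f 0 1 2 3 = 0"
    "f 0 1 2 4 = 0" "f 0 1 2 5 = 0" "f 0 1 3 4 = 0" "f 0 1 3 5 = 0"
    "f 2 3 4 0 = 0" "f 2 3 4 1 = 0" "f 2 3 5 0 = 0" "f 2 3 5 1 = 0"
    "f 4 5 0 2 = 0" "f 4 5 0 3 = 0" "f 4 5 1 2 = 0" "f 4 5 1 3 = 0"
    using z(1)[OF c(1)] z(1)[OF c(2)] z(1)[OF c(3)]
      z(2)[OF c(1), of 0 0] z(2)[OF c(1), of 0 1] z(2)[OF c(1), of 1 0] z(2)[OF c(1), of 1 1]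
      z(2)[OF c(2), of 0 0] z(2)[OF c(2), of 0 1] z(2)[OF c(2), of 1 0] z(2)[OF c(2), of 1 1]
      z(2)[OF c(3), of 0 0] z(2)[OF c(3), of 0 1] z(2)[OF c(3), of 1 0] z(2)[OF c(3), of 1 1]
    by simp_all
  have base: "f 0 1 2 3 = 0" "f 0 1 2 4 = 0" "f 0 1 2 5 = 0" "f 0 1 3 4 = 0" "f 0 1 3 5 = 0" "f 0 1 4 5 = 0"
    "f 0 2 3 4 = 0" "f 0 2 3 5 = 0" "f 0 2 4 5 = 0" "f 0 3 4 5 = 0" "f 1 2 3 4 = 0" "f 1 2 3 5 = 0"
    "f 1 2 4 5 = 0" "f 1 3 4 5 = 0" "f 2 3 4 5 = 0"
    by (simp_all del: One_nat_def add: zz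
      s2[of 0 1 4 5] s1[of 0 4 1 5] s3[of 4 0 1 5] s2[of 4 0 5 1]
      s2[of 0 2 4 5] s1[of 0 4 2 5] s3[of 4 0 2 5] s2[of 4 0 5 2]
      s2[of 0 3 4 5] s1[of 0 4 3 5] s3[of 4 0 3 5] s2[of 4 0 5 3]
      s2[of 1 2 4 5] s1[of 1 4 2 5] s3[of 4 1 2 5] s2[of 4 1 5 2]
      s2[of 1 3 4 5] s1[of 1 4 3 5] s3[of 4 1 3 5] s2[of 4 1 5 3]
      s1[of 0 2 3 4] s2[of 2 0 3 4] s3[of 2 3 0 4]
      s1[of 0 2 3 5] s2[of 2 0 3 5] s3[of 2 3 0 5]
      s1[of 1 2 3 4] s2[of 2 1 3 4] s3[of 2 3 1 4]
      s1[of 1 2 3 5] s2[of 2 1 3 5] s3[of 2 3 1 5])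
  have sorted: "f w x y z = 0" if "w < x" "x < y" "y < z" "z < 6" for w x y z
  proof -
    have "\<forall>z<6. \<forall>y<z. \<forall>x<y. \<forall>w<x. f w x y z = 0"
      using base by (simp add: All_less_Suc eval_nat_numeral)
    then show ?thesis using that by blast
  qed
  have 3: "f w x y z = 0" if "w < x" "x < y" "y < 6" "z < 6" for w x y z
  proof (cases z w rule: linorder_cases)
    case less
    then have "f z w x y = 0" using sorted that by simp
    then show ?thesis using s1[of z w x y] s2[of w z x y] s3[of w x z y] by simp
  next
    case equal
    then show ?thesis using d(1)[of w x y] s2[of w w x y] s3[of w x w y] by simp
  next
    case greater
    then show ?thesis
    proof (cases z x rule: linorder_cases)
      case less
      then have "f w z x y = 0" using sorted that \<open>w < z\<close> by simp
      then show ?thesis using s2[of w z x y] s3[of w x z y] by simp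
    next
      case equal
      then show ?thesis using d(2)[of w x y] s3[of w x x y] by simp
    next
      case greater
      then show ?thesis using sorted[of w x z y] sorted[of w x y z] that d(3)[of w x y] s3[of w x z y]
        by (cases z y rule: linorder_cases) auto
    qed
  qed
  have 2: "f w x y z = 0" if "w < x" "x < 6" "y < 6" "z < 6" for w x y z
  proof (cases y w rule: linorder_cases)
    case less
    then have "f y w x z = 0" using 3 that by simp
    then show ?thesis using s1[of y w x z] s2[of w y x z] by simp
  next
    case equal
    then show ?thesis using d(1)[of w x z] s2[of w w x z] by simp
  next
    case greater
    then show ?thesis using 3[of w x y z] 3[of w y x z] that d(2)[of w x z] s2[of w y x z]
      by (cases x y rule: linorder_cases) auto
  qed
  show ?thesis using 2[of w x y z] 2[of x w y z] d(1)[of w y z] s1[of w x y z] lt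
    by (cases w x rule: linorder_cases) auto
qed

lemma eps3_swap: "eps3 i k j = - eps3 i j k"
  by (simp add: eps3_def field_simps)

lemma kform_swap: "kform x [v, b, a] = - kform x [v, a, b]"
  using eps3_swap[of "v div 2" "b div 2" "a div 2"]
  by (simp add: kform_def add.commute add.left_commute)

lemma dform_kform_zeroI:
  assumes t: "t \<in> torsion_space"
    and z: "\<And>m p q. (m, p, q) \<in> cyc3 \<Longrightarrow> dform (kform xs) 3 t [2*p, 2*p+1, 2*q, 2*q+1] = 0"
      "\<And>m p q a b. (m, p, q) \<in> cyc3 \<Longrightarrow> a < 2 \<Longrightarrow> b < 2 \<Longrightarrow> dform (kform xs) 3 t [2*m, 2*m+1, 2*p+a, 2*q+b] = 0"
  shows "dform (kform xs) 3 t = (\<lambda>_. 0)"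
proof
  fix L
  define c where "c p q r s = (\<Sum>v<6. t p q v * kform xs [v, r, s])" for p q r s
  define f where "f w x y z = - c w x y z + c w y x z - c w z x y - c x y w z + c x z w y - c y z w x" for w x y z
  have c1: "c q p r s = - c p q r s" for p q r s
    unfolding c_def using torsion_swap[OF t, of q p] by (simp add: sum_negf)
  have c2: "c p q s r = - c p q r s" for p q r s
    unfolding c_def using kform_swap[of xs _ s r] by (simp add: sum_negf)
  have eq: "dform (kform xs) 3 t [w, x, y, z] = f w x y z" if "w < 6" "x < 6" "y < 6" "z < 6" for w x y z
    using dform_3[OF that, of "kform xs"] by (simp add: f_def c_def)
  have z0: "f w x y z = 0" if "w < 6" "x < 6" "y < 6" "z < 6" for w x y z
  proof (rule alternating4_zero[OF _ _ _ _ _ that])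
    fix w x y z
    show "f x w y z = - f w x y z"
      unfolding f_def using c1[of x w y z] c2[of y z x w] by linarith
    show "f w y x z = - f w x y z"
      unfolding f_def using c1[of y x w z] c2[of w z y x] by linarith
    show "f w x z y = - f w x y z"
      unfolding f_def using c1[of z y w x] c2[of w x z y] by linarith
  next
    fix m p q assume c: "(m, p, q) \<in> cyc3"
    then show "f (2*p) (2*p+1) (2*q) (2*q+1) = 0"
      using z(1)[OF c] eq[of "2*p" "2*p+1" "2*q" "2*q+1"] by (auto simp: cyc3_def)
    fix a b :: nat assume "a < 2" "b < 2"
    then show "f (2*m) (2*m+1) (2*p+a) (2*q+b) = 0"
      using z(2)[OF c, of a b] c eq[of "2*m" "2*m+1" "2*p+a" "2*q+b"] by (auto simp: cyc3_def)
  qed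
  show "dform (kform xs) 3 t L = 0"
  proof (cases "length L = 4 \<and> set L \<subseteq> {..<6}")
    case True
    then obtain w x' y z where "L = [w, x', y, z]" "w < 6" "x' < 6" "y < 6" "z < 6"
      by (auto simp: length_Suc_conv numeral_eq_Suc)
    then show ?thesis using z0 eq by simp
  next
    case False
    then show ?thesis by (auto simp: dform_def)
  qed
qed

text \<open>This reflects \<Lambda>^4(V \<otimes> R^2) = S^2V \<oplus> V \<otimes> S^2R^2, of
  dimension 6 + 9. The symmetric part of \<open>Nx\<close> is the first component and
  \<open>Mx\<close> the second; the antisymmetric part of \<open>Nten\<close> enters through
  \<open>Mx\<close>.\<close>

lemma dform_kform_eq_0_iff:
  assumes t: "t \<in> torsion_space"
  shows "dform (kform x) 3 t = (\<lambda>_. 0) \<longleftrightarrow>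
    (\<forall>p<3. \<forall>q<3. Nx x t p q + Nx x t q p = 0) \<and> (\<forall>n<3. \<forall>m<3. Mx x t n m = 0)" (is "?L = ?R")
proof
  assume ?L
  then have 0: "dform (kform x) 3 t L = 0" for L by simp
  have *: "Nx x t m m = 0" "Mx x t 0 m = 0" "Mx x t 1 m = 0" "Mx x t 2 m = 0" "Nx x t p q + Nx x t q p = 0"
    if "(m, p, q) \<in> cyc3" for m p q
  proof -
    note e = dform_kform_A[OF t that, of x] dform_kform_B[OF t that, of x]
    show "Nx x t m m = 0" "Mx x t 0 m = 0" "Mx x t 2 m = 0" using e unfolding 0 by simp_all
    show "Mx x t 1 m = 0" "Nx x t p q + Nx x t q p = 0"
      using e(4,5) unfolding 0 by (simp_all add: field_simps)
  qed
  have "(0, 1, 2) \<in> cyc3" "(1, 2, 0) \<in> cyc3" "(2, 0, 1) \<in> cyc3" by (simp_all add: cyc3_def)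
  from this[THEN *(1)] this[THEN *(2)] this[THEN *(3)] this[THEN *(4)] this[THEN *(5)]
  show ?R by (simp add: all_lt_3 add.commute)
next
  assume R: ?R
  then have R1: "\<And>p q. p < 3 \<Longrightarrow> q < 3 \<Longrightarrow> Nx x t p q + Nx x t q p = 0"
    and R2: "\<And>n m. n < 3 \<Longrightarrow> m < 3 \<Longrightarrow> Mx x t n m = 0" by blast+
  show ?L
  proof (rule dform_kform_zeroI[OF t])
    fix m p q assume c: "(m, p, q) \<in> cyc3"
    then have lt: "m < 3" "p < 3" "q < 3" by (auto simp: cyc3_def)
    show "dform (kform x) 3 t [2*p, 2*p+1, 2*q, 2*q+1] = 0"
      using dform_kform_A[OF t c, of x] R1[of m m] lt by simp
    fix a b :: nat assume ab: "a < 2" "b < 2"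
    have "\<forall>a<2. \<forall>b<2. dform (kform x) 3 t [2*m, 2*m+1, 2*p+a, 2*q+b] = 0"
      using dform_kform_B[OF t c, of x] R1[of p q] R2[of _ m] lt by (simp add: all_lt_2)
    with ab show "dform (kform x) 3 t [2*m, 2*m+1, 2*p+a, 2*q+b] = 0" by blast
  qed
qed

section \<open>The invariant 3-forms as binary cubic forms\<close>

lemma ucov_div: "i < 3 \<Longrightarrow> ucov \<theta> i x = (if x div 2 = i then (if x mod 2 = 0 then cos \<theta> else sin \<theta>) else 0)"
  unfolding ucov_def by (auto simp: mod_2_eq_odd)

text \<open>All three factors use the same vector v = (cos, sin), so a coefficient depends only on
  how many second basis vectors occur: the cubic form is v^3.\<close>

lemma eta_theta_kform: "eta_theta \<theta> = kform (\<lambda>n. cos \<theta> ^ (3 - n) * sin \<theta> ^ n)"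
proof
  fix L
  define u where "u a = (if a mod 2 = 0 then cos \<theta> else sin \<theta>)" for a :: nat
  have u: "u a * u b * u c = cos \<theta> ^ (3 - (a mod 2 + b mod 2 + c mod 2)) * sin \<theta> ^ (a mod 2 + b mod 2 + c mod 2)"
    for a b c
    by (auto simp: u_def power2_eq_square power3_eq_cube mod_2_eq_odd)
  have uc: "ucov \<theta> i x = (if x div 2 = i then u x else 0)" if "i < 3" for i x
    using ucov_div[OF that] by (simp add: u_def)
  have eps: "det3 (\<lambda>i j. if [p, q, r] ! j = i then [a, b, c] ! j else 0) = eps3 p q r * (a * b * c)"
    for p q r :: nat and a b c :: real
  proof (cases "p < 3 \<and> q < 3 \<and> r < 3")
    case True
    have "\<forall>p<3. \<forall>q<3. \<forall>r<3. det3 (\<lambda>i j. if [p, q, r] ! j = i then [a, b, c] ! j else 0) = eps3 p q r * (a * b * c)"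
      by (simp add: all_lt_3 det3_def eps3_values[simplified])
    then show ?thesis using True by blast
  next
    case False
    then have "(p \<noteq> 0 \<and> p \<noteq> 1 \<and> p \<noteq> 2) \<or> (q \<noteq> 0 \<and> q \<noteq> 1 \<and> q \<noteq> 2) \<or> (r \<noteq> 0 \<and> r \<noteq> 1 \<and> r \<noteq> 2)"
      by auto
    then have "det3 (\<lambda>i j. if [p, q, r] ! j = i then [a, b, c] ! j else 0) = 0"
      unfolding det3_def by (elim disjE) simp_all
    then show ?thesis using False by (auto simp: eps3_def)
  qed
  show "eta_theta \<theta> L = kform (\<lambda>n. cos \<theta> ^ (3 - n) * sin \<theta> ^ n) L"
  proof (cases "\<exists>a b c. L = [a, b, c]")
    case True
    then obtain a b c where L: "L = [a, b, c]" by blast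
    have "eta_theta \<theta> L = det3 (\<lambda>i j. if [a div 2, b div 2, c div 2] ! j = i then [u a, u b, u c] ! j else 0)"
      unfolding eta_theta_def L by (simp add: det3_def uc)
    also have "\<dots> = eps3 (a div 2) (b div 2) (c div 2) * (u a * u b * u c)" by (rule eps)
    finally show ?thesis by (simp add: u kform_def L)
  next
    case False
    then show ?thesis by (auto simp: eta_theta_def kform_def split: list.split)
  qed
qed

text \<open>\<open>hatc n\<close> is the imaginary part of i^n: \<open>gamma_hat\<close> is the
  imaginary part of the product of the three complex covectors.\<close>

definition hatc :: "nat \<Rightarrow> real" where
  "hatc n = (if n = 1 then 1 else if n = 3 then -1 else 0)"

lemma gamma_hat_kform: "gamma_hat = kform hatc"
proof
  fix L
  have c5: "cos (5*pi/6) = - (sqrt 3 / 2)" "sin (5*pi/6) = 1/2"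
    using cos_pi_minus[of "pi/6"] sin_pi_minus[of "pi/6"] by (simp_all add: field_simps cos_30 sin_30)
  have *: "4/3 * (cos (pi/6) ^ (3 - n) * sin (pi/6) ^ n + cos (5*pi/6) ^ (3 - n) * sin (5*pi/6) ^ n
     + cos (-pi/2) ^ (3 - n) * sin (-pi/2) ^ n) = hatc n" if "n < 4" for n
  proof -
    have "n = 0 \<or> n = 1 \<or> n = 2 \<or> n = 3" using that by linarith
    then show ?thesis
      by (elim disjE) (simp_all add: c5 cos_30 sin_30 hatc_def power2_eq_square power3_eq_cube)
  qed
  show "gamma_hat L = kform hatc L"
  proof (cases "\<exists>a b c. L = [a, b, c]")
    case True
    then obtain a b c where L: "L = [a, b, c]" by blast
    have "a mod 2 + b mod 2 + c mod 2 < 4" by linarith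
    note * = *[OF this]
    have "4/3 * (E * A + E * B + E * C) = E * (4/3 * (A + B + C))" for A B C E :: real
      by (simp add: algebra_simps)
    then show ?thesis
      unfolding gamma_hat_def eta_theta_kform L kform_def list.case by (simp only: *)
  next
    case False
    then show ?thesis by (auto simp: gamma_hat_def eta_theta_kform kform_def split: list.split)
  qed
qed

subsection \<open>The module determined by all invariant 3-forms\<close>

text \<open>Twice the symmetric traceless part; the missing factor 1/2 is why the trace is removed
  with 2/3 rather than 1/3.\<close>

definition stf :: "tensor \<Rightarrow> tensor" where
  "stf F = F + rotI F - smul (2/3) (dltI (trI F))"

lemmas intertw_ops = intertw_comp[OF _ nat_op_trI] intertw_comp[OF _ nat_op_crI] intertw_comp[OF _ nat_op_dltI]
  intertw_comp[OF _ nat_op_epJ] intertw_comp[OF _ nat_op_rotI] intertw_comp[OF _ nat_op_rotJ]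
  intertw_add intertw_diff intertw_smul

lemma intertw_crlow: "intertw G_SO3_SL2 crlow"
  unfolding crlow_def by (intro intertw_ops intertw_low)

lemma intertw_Nten: "intertw G_SO3_SL2 Nten"
  unfolding Nten_def by (intro intertw_ops intertw_crlow)

lemma intertw_Qten: "intertw G_SO3_SL2 Qten"
  unfolding Qten_def Rten_def by (intro intertw_ops intertw_low)

lemma intertw_stf: "intertw G_SO3_SL2 \<Phi> \<Longrightarrow> intertw G_SO3_SL2 (\<lambda>t. stf (\<Phi> t))"
  unfolding stf_def by (intro intertw_ops)

lemma supp_crlow: "supp 2 3 (crlow t)"
  using supp_crI[of 1 3 "low t"] supp_low by (simp add: crlow_def eval_nat_numeral)

lemma supp_Nten: "supp 2 3 (Nten t)"
  unfolding Nten_def by (intro supp_add supp_rotJ supp_crlow)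

lemma supp_Rten: "supp 1 3 (Rten t)"
  unfolding Rten_def One_nat_def
  by (intro supp_trI supp_rotI) (use supp_low in \<open>simp add: eval_nat_numeral\<close>)

lemma supp_Qten: "supp 1 1 (Qten t)"
  unfolding Qten_def One_nat_def
  by (intro supp_diff supp_epJ supp_rotJ; use supp_Rten in \<open>simp add: eval_nat_numeral\<close>)

lemma supp_tr2: "supp 2 q F \<Longrightarrow> supp 0 q (trI F)"
  using supp_trI[of 0] by (simp add: eval_nat_numeral)

lemma supp_cr2: "supp 2 q F \<Longrightarrow> supp 1 q (crI F)"
  using supp_crI[of 0] by (simp add: eval_nat_numeral)

lemma supp_stf: "supp 2 q F \<Longrightarrow> supp 2 q (stf F)"
  using supp_dltI[of 0 q "trI F"] supp_tr2[of q F] unfolding stf_def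
  by (intro supp_add supp_diff supp_smul supp_rotI) (simp_all add: eval_nat_numeral)

lemma crlow_sym:
  assumes t: "t \<in> torsion_space"
  shows "crlow t I [b, a, c] = crlow t I [a, b, c]"
proof (cases "I \<in> idx_lists 3 2")
  case True
  then obtain k m where I: "I = [k, m]" by (auto simp: idx_lists_def length_Suc_conv numeral_2_eq_2)
  have low: "low t [j, i, m] [b, a, c] = - low t [i, j, m] [a, b, c]" for i j
    using torsion_swap[OF t, of "2*j+b" "2*i+a"] by (simp add: low_def)
  have "crlow t I [b, a, c] = (\<Sum>i<3. \<Sum>j<3. eps3 k j i * low t [j, i, m] [b, a, c])"
    unfolding crlow_def crI_def I list.case by (rule sum.swap)
  also have "\<dots> = crlow t I [a, b, c]"
    unfolding crlow_def crI_def I list.case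
  proof (intro sum.cong refl)
    fix i j
    show "eps3 k j i * low t [j, i, m] [b, a, c] = eps3 k i j * low t [i, j, m] [a, b, c]"
      using low[of j i] eps3_swap[of k j i] by simp
  qed
  finally show ?thesis .
next
  case False
  then show ?thesis using supp_crlow[of t] by (simp add: supp_def)
qed

lemma symlist_3I:
  assumes "\<And>a b c. a < n \<Longrightarrow> b < n \<Longrightarrow> c < n \<Longrightarrow> f [a, b, c] = f [b, a, c]"
    "\<And>a b c. a < n \<Longrightarrow> b < n \<Longrightarrow> c < n \<Longrightarrow> f [a, b, c] = f [b, c, a]"
  shows "symlist n 3 f"
  unfolding symlist_def by (rule conjI, simp, intro impI allI conjI) (blast intro: assms)+

lemma Nten_sym:
  assumes "t \<in> torsion_space"
  shows "symlist 2 3 (Nten t I)"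
proof -
  have "Nten t I [a, b, c] = Nten t I [b, a, c]" "Nten t I [a, b, c] = Nten t I [b, c, a]" for a b c
    using crlow_sym[OF assms, of I a b c] crlow_sym[OF assms, of I b c a] crlow_sym[OF assms, of I c a b]
    by (simp_all add: Nten_def rotJ_def)
  then show ?thesis by (rule symlist_3I)
qed

lemma symlist_J3:
  assumes "symlist 2 3 f"
  shows "f [0, 1, 0] = f [0, 0, 1]" "f [1, 0, 0] = f [0, 0, 1]" "f [1, 0, 1] = f [0, 1, 1]" "f [1, 1, 0] = f [0, 1, 1]"
proof -
  have mem: "J \<in> idx_lists 2 3" if "length J = 3" "set J \<subseteq> {..<2}" for J
    using that by (simp add: idx_lists_def)
  show "f [0, 1, 0] = f [0, 0, 1]" "f [1, 0, 0] = f [0, 0, 1]" "f [1, 0, 1] = f [0, 1, 1]" "f [1, 1, 0] = f [0, 1, 1]"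
    by (rule symlist_mset[OF assms]; simp add: mem)+
qed

lemma irr_symJ: "irr (k, 3) F \<Longrightarrow> symlist 2 3 (F I)"
proof -
  assume "irr (k, 3) F"
  then have "mset J = mset J' \<Longrightarrow> F I J = F I J'" for J J'
    unfolding irr_def by blast
  then have "F I [a, b, c] = F I [b, a, c]" "F I [a, b, c] = F I [b, c, a]" for a b c
    by (simp_all add: add_mset_commute)
  then show ?thesis by (rule symlist_3I)
qed

lemma irr_symI: "irr (2, q) F \<Longrightarrow> F [j, i] J = F [i, j] J"
proof -
  assume "irr (2, q) F"
  then have "mset I = mset I' \<Longrightarrow> F I J = F I' J" for I I'
    unfolding irr_def by blast
  then show ?thesis by (simp add: add_mset_commute)
qed

lemma irr_supp: "irr (k, q) F \<Longrightarrow> supp k q F"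
  by (simp add: irr_def)

lemma irr_trace: "irr (k, q) F \<Longrightarrow> trI F I J = 0"
  unfolding irr_def by blast

lemma symlist_lt2: "k < 2 \<Longrightarrow> symlist n k f"
  by (simp add: symlist_def)

lemma irr_0: "supp 0 q F \<Longrightarrow> q < 2 \<or> (q = 3 \<and> symlist 2 3 (F [])) \<Longrightarrow> irr (0, q) F"
  by (rule irrI) (auto simp: symlist_lt2 idx_lists_0)

lemma irr_1: "supp 1 q F \<Longrightarrow> q < 2 \<or> (q = 3 \<and> (\<forall>i<3. symlist 2 3 (F [i]))) \<Longrightarrow> irr (1, q) F"
  by (rule irrI) (auto simp: symlist_lt2 idx_lists_def length_Suc_conv)

lemma rotI_pair: "rotI F [i, j] J = F [j, i] J"
  by (simp add: rotI_def)

lemma irr_stf: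
  assumes F: "supp 2 q F" and "q < 2 \<or> (q = 3 \<and> (\<forall>I. symlist 2 3 (F I)))"
  shows "irr (2, q) (stf F)"
proof (rule irrI)
  show "supp 2 q (stf F)" by (rule supp_stf[OF F])
  show "symlist 3 2 (\<lambda>I. stf F I J)" for J
    by (auto simp: symlist_def stf_def rotI_pair dltI_def)
  show "symlist 2 q (stf F I)" if I: "I \<in> idx_lists 3 2" for I
  proof -
    obtain i j where I: "I = [i, j]" using I by (auto simp: idx_lists_def length_Suc_conv numeral_2_eq_2)
    have "stf F I [a, b, c] = stf F I [b, a, c] \<and> stf F I [a, b, c] = stf F I [b, c, a]"
      if "\<And>I. symlist 2 3 (F I)" "a < 2" "b < 2" "c < 2" for a b c
    proof -
      have "F K [b, a, c] = F K [a, b, c]" "F K [b, c, a] = F K [a, b, c]" for K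
        using that(1)[of K] that(2-4) unfolding symlist_def by metis+
      then show ?thesis unfolding I by (simp add: stf_def rotI_pair dltI_def trI_def)
    qed
    then show ?thesis using assms(2) by (auto simp: symlist_lt2) (auto simp: symlist_def)
  qed
  show "trI (stf F) [] J = 0" for J
    by (simp add: trI_def stf_def rotI_pair dltI_def sum_lt_3 field_simps)
qed (use assms(2) in auto)

section \<open>Torsion tensors with prescribed components\<close>

definition unlow :: "tensor \<Rightarrow> torsion" where
  "unlow F = (\<lambda>x y z. if x < 6 \<and> y < 6 \<and> z < 6
     then (if z mod 2 = 1 then F [x div 2, y div 2, z div 2] [x mod 2, y mod 2, 0]
           else - F [x div 2, y div 2, z div 2] [x mod 2, y mod 2, 1]) else 0)"

lemma low_unlow:
  assumes "supp 3 3 F"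
  shows "low (unlow F) = F"
proof (rule supp_eqI[OF supp_low assms])
  fix I J assume "I \<in> idx_lists 3 3" "J \<in> idx_lists 2 3"
  then obtain i j k a b c where IJ: "I = [i, j, k]" "J = [a, b, c]"
    and lt: "i < 3" "j < 3" "k < 3" "a < 2" "b < 2" "c < 2"
    by (auto simp: idx_lists_def numeral_3_eq_3 length_Suc_conv)
  have "c = 0 \<or> c = 1" using lt by auto
  then show "low (unlow F) I J = F I J" using lt by (auto simp: IJ low_def unlow_def)
qed

lemma unlow_torsion_space:
  assumes "\<And>i j k a b c. F [j, i, k] [b, a, c] = - F [i, j, k] [a, b, c]"
  shows "unlow F \<in> torsion_space"
proof -
  have "unlow F x y z = - unlow F y x z" for x y z
    using assms[of "x div 2" "y div 2" "z div 2" "x mod 2" "y mod 2"] by (simp add: unlow_def)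
  moreover have "unlow F x y z = 0" if "\<not> (x < 6 \<and> y < 6 \<and> z < 6)" for x y z
    using that by (auto simp: unlow_def)
  ultimately show ?thesis unfolding torsion_space_def by blast
qed

definition eps2 :: "nat \<Rightarrow> nat \<Rightarrow> real" where
  "eps2 a b = (if a = 0 \<and> b = 1 then 1 else if a = 1 \<and> b = 0 then -1 else 0)"

text \<open>Torsion tensors are \<open>\<Lambda>\<^sup>2(V \<otimes> R\<^sup>2) = \<Lambda>\<^sup>2V \<otimes> S\<^sup>2R\<^sup>2 \<oplus> S\<^sup>2V \<otimes> \<Lambda>\<^sup>2R\<^sup>2\<close> tensored with
  \<open>V \<otimes> R\<^sup>2\<close>; \<open>sect A S\<close> is the element with components \<open>A\<close> and \<open>S\<close>, up to a factor.\<close>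

definition sectT :: "tensor \<Rightarrow> tensor \<Rightarrow> tensor" where
  "sectT A S = (\<lambda>I J. case (I, J) of ([i, j, k], [a, b, c]) \<Rightarrow>
      if i < 3 \<and> j < 3 \<and> k < 3 \<and> a < 2 \<and> b < 2 \<and> c < 2
      then (\<Sum>l<3. eps3 l i j * A [l, k] [a, b, c]) / 6 + eps2 a b * S [i, j, k] [c]
      else 0 | _ \<Rightarrow> 0)"

definition sect :: "tensor \<Rightarrow> tensor \<Rightarrow> torsion" where
  "sect A S = unlow (sectT A S)"

text \<open>With \<open>A\<close> symmetric in R^2 and \<open>S\<close> symmetric in its first two
  V-indices, both terms of \<open>sectT\<close> change sign when the two arguments are exchanged, by
  \<open>eps3\<close> and by \<open>eps2\<close> respectively.\<close>

locale sect_data =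
  fixes A S :: tensor
  assumes suppA: "supp 2 3 A" and symA: "\<And>I. symlist 2 3 (A I)"
    and suppS: "supp 3 1 S" and symS: "\<And>i j k J. S [j, i, k] J = S [i, j, k] J"
begin

lemma sect_space: "sect A S \<in> torsion_space"
  unfolding sect_def
proof (rule unlow_torsion_space)
  fix i j k a b c
  have A: "A [l, k] [b, a, c] = A [l, k] [a, b, c]" if "a < 2" "b < 2" "c < 2" for l
    using symA[of "[l, k]"] that unfolding symlist_def by metis
  have e: "eps3 l j i = - eps3 l i j" for l by (rule eps3_swap)
  have e2: "eps2 b a = - eps2 a b" by (simp add: eps2_def)
  have "(\<Sum>l<3. eps3 l j i * A [l, k] [b, a, c]) = - (\<Sum>l<3. eps3 l i j * A [l, k] [a, b, c])"
    if "a < 2" "b < 2" "c < 2"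
    using A[OF that] by (simp add: e sum_negf)
  then show "sectT A S [j, i, k] [b, a, c] = - sectT A S [i, j, k] [a, b, c]"
    using symS[of j i k "[c]"] by (auto simp: sectT_def e2)
qed

lemma low_sect: "low (sect A S) = sectT A S"
  unfolding sect_def
  by (rule low_unlow) (auto simp: supp_def sectT_def idx_lists_def split: list.split)

text \<open>\<open>S\<close> drops out by symmetry in its first two indices, and contracting
  \<open>eps3\<close> with itself doubles \<open>A / 6\<close>.\<close>

lemma crlow_sect: "crlow (sect A S) [l, k] J = A [l, k] J / 3" if lt: "l < 3" "k < 3" and J: "J \<in> idx_lists 2 3"
proof -
  have "\<forall>l<3. \<forall>k<3. \<forall>a<2. \<forall>b<2. \<forall>c<2. crlow (sect A S) [l, k] [a, b, c] = A [l, k] [a, b, c] / 3"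
    using symS[of 0 1] symS[of 0 2] symS[of 1 2] unfolding crlow_def low_sect
    by (simp add: all_lt_3 all_lt_2 crI_def sum_lt_3 eps3_values[simplified] sectT_def eps2_def)
  moreover obtain a b c where "J = [a, b, c]" "a < 2" "b < 2" "c < 2"
    using J by (auto simp: idx_lists_def numeral_3_eq_3 length_Suc_conv)
  ultimately show ?thesis using lt by blast
qed

lemma Nten_sect: "Nten (sect A S) = A"
proof (rule supp_eqI[OF supp_Nten suppA])
  fix I J assume "I \<in> idx_lists 3 2" and J: "J \<in> idx_lists 2 3"
  then obtain l k where I: "I = [l, k]" and lt: "l < 3" "k < 3"
    by (auto simp: idx_lists_def length_Suc_conv numeral_2_eq_2)
  obtain a b c where Jabc: "J = [a, b, c]" "a < 2" "b < 2" "c < 2"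
    using J by (auto simp: idx_lists_def numeral_3_eq_3 length_Suc_conv)
  have "A I [b, c, a] = A I [a, b, c]" "A I [c, a, b] = A I [a, b, c]"
    using symA[of I] Jabc unfolding symlist_def by metis+
  then show "Nten (sect A S) I J = A I J"
    using lt Jabc by (simp add: Nten_def rotJ_def I crlow_sect idx_lists_def)
qed

text \<open>\<open>A\<close> is totally symmetric in R^2, so contraction with the area form kills
  it. \<open>S\<close> contributes -1 from the trace over the vector index and -2 from the second
  term of \<open>Qten\<close>.\<close>

lemma Qten_sect: "k < 3 \<Longrightarrow> c < 2 \<Longrightarrow> Qten (sect A S) [k] [c] = - 3 * (\<Sum>m<3. S [k, m, m] [c])"
proof -
  have s: "A I [0, Suc 0, 0] = A I [0, 0, Suc 0]" "A I [Suc 0, 0, 0] = A I [0, 0, Suc 0]"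
    "A I [Suc 0, 0, Suc 0] = A I [0, Suc 0, Suc 0]" "A I [Suc 0, Suc 0, 0] = A I [0, Suc 0, Suc 0]" for I
    using symlist_J3[OF symA[of I]] by simp_all
  have "\<forall>k<3. \<forall>c<2. Qten (sect A S) [k] [c] = - 3 * (\<Sum>m<3. S [k, m, m] [c])"
    unfolding Qten_def Rten_def low_sect
    by (simp add: all_lt_3 all_lt_2 epJ_def trI_def rotI_def rotJ_def sum_lt_3 eps3_values[simplified] sectT_def eps2_def s)
  then show "k < 3 \<Longrightarrow> c < 2 \<Longrightarrow> ?thesis" by blast
qed

end

lemma exists_torsion_NQ:
  assumes "supp 2 3 A" "\<And>I. symlist 2 3 (A I)" "supp 1 1 B"
  shows "\<exists>t\<in>torsion_space. Nten t = A \<and> Qten t = B"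
proof -
  \<comment> \<open>The identity matrix times \<open>B\<close>: tracing the last two indices returns
    \<open>- B / 3\<close>, and the factor -3 of \<open>Qten_sect\<close> restores
    \<open>B\<close>.\<close>
  define S :: tensor where "S = smul (-1/3) (dltI B)"
  interpret sect_data A S
  proof
    show "supp 3 1 S" unfolding S_def using supp_smul[OF supp_dltI[OF assms(3)]] by (simp add: eval_nat_numeral)
  qed (use assms in \<open>auto simp: S_def dltI_def\<close>)
  have "Qten (sect A S) = B"
  proof (rule supp_eqI[OF supp_Qten assms(3)])
    fix I J assume "I \<in> idx_lists 3 1" "J \<in> idx_lists 2 1"
    then obtain k c where IJ: "I = [k]" "J = [c]" and lt: "k < 3" "c < 2"
      by (auto simp: idx_lists_def length_Suc_conv)
    have "\<forall>k<3. (\<Sum>m<3. S [k, m, m] [c]) = - B [k] [c] / 3"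
      by (simp add: all_lt_3 sum_lt_3 S_def dltI_def)
    then show "Qten (sect A S) I J = B I J" using lt by (simp add: IJ Qten_sect)
  qed
  then show ?thesis using sect_space Nten_sect by blast
qed

section \<open>The common kernel of the derivatives of the 3-forms\<close>

lemma dform_lin:
  "dform (\<lambda>L. a * \<alpha> L + b * \<beta> L) k t L = a * dform \<alpha> k t L + b * dform \<beta> k t L"
  by (simp add: dform_def sum.distrib sum_distrib_left algebra_simps)

lemma kform_cong: "(\<And>n. n < 4 \<Longrightarrow> x n = y n) \<Longrightarrow> kform x = kform y"
proof
  fix L assume xy: "\<And>n. n < 4 \<Longrightarrow> x n = y n"
  have "x (a mod 2 + b mod 2 + c mod 2) = y (a mod 2 + b mod 2 + c mod 2)" for a b c :: nat
    by (rule xy) linarith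
  then show "kform x L = kform y L" by (auto simp: kform_def split: list.split)
qed

lemma kform_lin: "kform (\<lambda>n. a * x n + b * y n) = (\<lambda>L. a * kform x L + b * kform y L)"
  by (auto simp: kform_def fun_eq_iff algebra_simps split: list.split)

definition powc :: "real \<Rightarrow> real \<Rightarrow> nat \<Rightarrow> real" where
  "powc c s n = c ^ (3 - n) * s ^ n"

lemma eta_kform:
  "eta 0 = kform (powc 1 0)" "eta 1 = kform (powc (-1/2) (sqrt 3 / 2))" "eta 2 = kform (powc (-1/2) (- sqrt 3 / 2))"
proof -
  have m: "cos (-2*pi/3) = -1/2" "sin (-2*pi/3) = - sqrt 3 / 2"
    using cos_minus[of "2*pi/3"] sin_minus[of "2*pi/3"] by (simp_all add: cos_120 sin_120)
  show "eta 0 = kform (powc 1 0)" "eta 1 = kform (powc (-1/2) (sqrt 3 / 2))" "eta 2 = kform (powc (-1/2) (- sqrt 3 / 2))"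
    unfolding eta_def eta_theta_kform powc_def[abs_def] by (simp_all add: m[simplified] cos_120 sin_120)
qed

definition kerk :: "(nat \<Rightarrow> real) \<Rightarrow> torsion \<Rightarrow> bool" where
  "kerk x t \<longleftrightarrow> dform (kform x) 3 t = (\<lambda>_. 0)"

lemma kerk_lin: "kerk x t \<Longrightarrow> kerk y t \<Longrightarrow> kerk (\<lambda>n. a * x n + b * y n) t"
  unfolding kerk_def kform_lin by (simp add: fun_eq_iff dform_lin)

lemma kerk_cong: "(\<And>n. n < 4 \<Longrightarrow> x n = y n) \<Longrightarrow> kerk x t = kerk y t"
  unfolding kerk_def using kform_cong[of x y] by simp

text \<open>The forms \<open>eta 0\<close>, \<open>eta 1\<close>, \<open>eta 2\<close> and \<open>gamma_hat\<close> span the space of invariant 3-forms.\<close>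

lemma kerk_all:
  assumes "kerk (powc 1 0) t" "kerk (powc (-1/2) (sqrt 3 / 2)) t" "kerk (powc (-1/2) (- sqrt 3 / 2)) t" "kerk hatc t"
  shows "kerk x t"
proof -
  define r where "r = 1 / sqrt 3"
  have r: "sqrt 3 * r = 1" by (simp add: r_def)
  have s: "sqrt 3 * sqrt 3 = 3" by simp
  let ?e1 = "powc (-1/2) (sqrt 3 / 2)" and ?e2 = "powc (-1/2) (- sqrt 3 / 2)"
  \<comment> \<open>Under s -> -s the system splits: \<open>powc 1 0\<close> and the sum of the
    other two cubes give entries 0 and 2, while \<open>hatc\<close> and their difference give
    entries 1 and 3. Each half is a 2 by 2 system.\<close>
  define y where "y n = 1 * ((x 0 - x 2 / 3) * powc 1 0 n + (x 1 - (x 1 + x 3) / 4) * hatc n)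
    + 1 * ((r * (x 1 + x 3) - 4/3 * x 2) * ?e1 n + (- r * (x 1 + x 3) - 4/3 * x 2) * ?e2 n)" for n
  have "kerk y t"
    unfolding y_def[abs_def] by (intro kerk_lin assms)
  moreover have "y n = x n" if "n < 4" for n
  proof -
    have "n = 0 \<or> n = 1 \<or> n = 2 \<or> n = 3" using that by linarith
    then show ?thesis
    proof (elim disjE)
      assume "n = 0" then show ?thesis by (simp add: y_def powc_def hatc_def power3_eq_cube field_simps)
    next
      assume n: "n = 1"
      have "y n = x 1 - (x 1 + x 3) / 4 + (sqrt 3 * r) * (x 1 + x 3) / 4"
        by (simp add: n y_def powc_def hatc_def power2_eq_square field_simps)
      then show ?thesis by (simp add: n r)
    next
      assume n: "n = 2"
      then show ?thesis by (simp add: y_def powc_def hatc_def power2_eq_square field_simps)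
    next
      assume n: "n = 3"
      have "y n = - (x 1 - (x 1 + x 3) / 4) + 3 * (sqrt 3 * r) * (x 1 + x 3) / 4"
        using s by (simp add: n y_def powc_def hatc_def power3_eq_cube) (simp add: field_simps)
      then show ?thesis unfolding r by (simp add: n field_simps)
    qed
  qed
  ultimately show ?thesis using kerk_cong[of y x t] by simp
qed

lemma kerd_kerk: "t \<in> kerd (kform x) 3 \<longleftrightarrow> t \<in> torsion_space \<and> kerk x t"
  by (simp add: kerd_def kerk_def)

lemma kerk_iff:
  assumes t: "t \<in> torsion_space"
  shows "kerk x t \<longleftrightarrow>
    (\<forall>p<3. \<forall>q<3. Nx x t p q + Nx x t q p = 0) \<and> (\<forall>n<3. \<forall>m<3. Mx x t n m = 0)"
  unfolding kerk_def by (rule dform_kform_eq_0_iff[OF t])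

lemma tensor_J3_zero:
  assumes "supp k 3 F" "\<And>I. symlist 2 3 (F I)"
    "\<And>I. I \<in> idx_lists 3 k \<Longrightarrow> F I [0,0,0] = 0 \<and> F I [0,0,1] = 0 \<and> F I [0,1,1] = 0 \<and> F I [1,1,1] = 0"
  shows "F I J = 0"
proof (cases "I \<in> idx_lists 3 k \<and> J \<in> idx_lists 2 3")
  case True
  then obtain a b c where J: "J = [a, b, c]" "a < 2" "b < 2" "c < 2"
    by (auto simp: idx_lists_def numeral_3_eq_3 length_Suc_conv)
  have "\<forall>a<2. \<forall>b<2. \<forall>c<2. F I [a, b, c] = 0"
    using assms(3)[of I] True symlist_J3[OF assms(2)[of I]] by (simp add: all_lt_2)
  then show ?thesis using J by blast
next
  case False
  then show ?thesis using assms(1) unfolding supp_def by blast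
qed

lemma crI_pair: "(m, p, q) \<in> cyc3 \<Longrightarrow> crI F [m] J = F [p, q] J - F [q, p] J"
  by (auto simp: cyc3_def crI_def sum_lt_3 eps3_values[simplified])

lemma pair_from_sym_cr:
  assumes "\<And>p q. p < 3 \<Longrightarrow> q < 3 \<Longrightarrow> F [p, q] J + F [q, p] J = 0" "\<And>m. m < 3 \<Longrightarrow> crI F [m] J = 0" "p < 3" "q < 3"
  shows "F [p, q] J = 0"
proof -
  have "\<forall>p<3. \<forall>q<3. F [p, q] J = F [q, p] J"
    using assms(2)[of 0] assms(2)[of 1] assms(2)[of 2] crI_pair[of 0 1 2 F J] crI_pair[of 1 2 0 F J] crI_pair[of 2 0 1 F J]
    by (simp add: all_lt_3 cyc3_def)
  then have "F [p, q] J = F [q, p] J" using assms(3,4) by blast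
  with assms(1)[OF assms(3,4)] show ?thesis by simp
qed

lemma kerk_all_iff:
  assumes t: "t \<in> torsion_space"
  shows "(\<forall>x. kerk x t) \<longleftrightarrow> (\<forall>I J. Nten t I J = 0) \<and> (\<forall>I J. Qten t I J = 0)" (is "?L = ?R")
proof
  assume R: ?R
  then have "Nten t I J = 0" "Qten t I J = 0" "crI (Nten t) I J = 0" for I J
    by (simp_all add: crI_def split: list.split)
  then show ?L unfolding kerk_iff[OF t] by (simp add: Nx_def Mx_def Let_def)
next
  assume L: ?L
  \<comment> \<open>Unit cubics, one for each coefficient of a general invariant 3-form.\<close>
  define e where "e k n = (if n = k then 1 else 0 :: real)" for k n :: nat
  have N: "Nx (e k) t p q + Nx (e k) t q p = 0" if "p < 3" "q < 3" for k p q
    using L that unfolding kerk_iff[OF t] by blast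
  have M: "Mx (e k) t n m = 0" if "n < 3" "m < 3" for k n m
    using L that unfolding kerk_iff[OF t] by blast
  have Nsym: "Nten t [p, q] J + Nten t [q, p] J = 0" if "p < 3" "q < 3" "J \<in> {[0,0,0], [0,0,1], [0,1,1], [1,1,1]}" for p q J
    using N[OF that(1,2), of 0] N[OF that(1,2), of 1] N[OF that(1,2), of 2] N[OF that(1,2), of 3] that(3)
    by (auto simp: Nx_def e_def)
  \<comment> \<open>Entries 000 and 111 occur alone. Otherwise two cubics give contradictory
    proportions: C011 = 2 Q1 against C011 = -4 Q1, and C001 = Q0 against C001 = -2 Q0, writing C for
    \<open>crI (Nten t)\<close> and Q for \<open>Qten t\<close>.\<close>
  have CQ: "crI (Nten t) [m] [0,0,0] = 0" "crI (Nten t) [m] [0,0,1] = 0" "crI (Nten t) [m] [0,1,1] = 0"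
    "crI (Nten t) [m] [1,1,1] = 0" "Qten t [m] [0] = 0" "Qten t [m] [1] = 0" if "m < 3" for m
    using M[of 0 m 0] M[of 1 m 0] M[of 0 m 1] M[of 1 m 1] M[of 1 m 3] M[of 2 m 3] that
    by (simp_all add: Mx_def e_def)
  have "Nten t I J = 0" for I J
  proof (rule tensor_J3_zero[OF supp_Nten Nten_sym[OF t]])
    fix I assume "I \<in> idx_lists 3 2"
    then obtain p q where I: "I = [p, q]" "p < 3" "q < 3"
      by (auto simp: idx_lists_def length_Suc_conv numeral_2_eq_2)
    show "Nten t I [0,0,0] = 0 \<and> Nten t I [0,0,1] = 0 \<and> Nten t I [0,1,1] = 0 \<and> Nten t I [1,1,1] = 0"
      unfolding I(1)
      by (intro conjI; rule pair_from_sym_cr[where F = "Nten t", OF _ _ I(2,3)], rule Nsym) (simp_all add: CQ CQ[unfolded One_nat_def])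
  qed
  moreover have "Qten t I J = 0" for I J
  proof (cases "I \<in> idx_lists 3 1 \<and> J \<in> idx_lists 2 1")
    case True
    then obtain k c where "I = [k]" "J = [c]" "k < 3" "c < 2"
      by (auto simp: idx_lists_def length_Suc_conv)
    moreover have "\<forall>c<2. Qten t [k] [c] = 0" if "k < 3" for k
      using CQ(5,6)[OF that] by (simp add: all_lt_2)
    ultimately show ?thesis by blast
  next
    case False
    then show ?thesis using supp_Qten[of t] unfolding supp_def by blast
  qed
  ultimately show ?R by blast
qed

lemma joint_kernel:
  "t \<in> kerd (eta 0) 3 \<inter> kerd (eta 1) 3 \<inter> kerd (eta 2) 3 \<inter> kerd gamma_hat 3 \<longleftrightarrow>
    t \<in> torsion_space \<and> (\<forall>I J. Nten t I J = 0) \<and> (\<forall>I J. Qten t I J = 0)"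
proof -
  have "t \<in> kerd (eta 0) 3 \<inter> kerd (eta 1) 3 \<inter> kerd (eta 2) 3 \<inter> kerd gamma_hat 3 \<longleftrightarrow>
    t \<in> torsion_space \<and> (\<forall>x. kerk x t)"
    unfolding eta_kform gamma_hat_kform Int_iff kerd_kerk using kerk_all by blast
  then show ?thesis using kerk_all_iff by blast
qed

text \<open>Rebuilds a 3 by 3 matrix from its trace, its axial vector and twice its symmetric
  traceless part, which explains the factors 1/3, 1/2, 1/2.\<close>

definition Nof :: "tensor \<Rightarrow> tensor \<Rightarrow> tensor \<Rightarrow> tensor" where
  "Nof F0 F1 F2 = (\<lambda>I J. case I of [i, j] \<Rightarrow> if i < 3 \<and> j < 3
     then (if i = j then F0 [] J / 3 else 0) + (\<Sum>k<3. eps3 k i j * F1 [k] J) / 2 + F2 [i, j] J / 2 else 0 | _ \<Rightarrow> 0)"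

lemma Nof_props:
  assumes "irr (0, q) F0" "irr (1, q) F1" "irr (2, q) F2"
  shows "supp 2 q (Nof F0 F1 F2)" "trI (Nof F0 F1 F2) = F0" "crI (Nof F0 F1 F2) = F1" "stf (Nof F0 F1 F2) = F2"
proof -
  note s = assms[THEN irr_supp]
  have z: "F0 I J = 0" "F1 I J = 0" "F2 I J = 0" if "J \<notin> idx_lists 2 q" for I J
    using s that unfolding supp_def by blast+
  show sN: "supp 2 q (Nof F0 F1 F2)"
    unfolding supp_def Nof_def using z by (auto simp: idx_lists_def split: list.split)
  have e: "F2 [1, 0] J = F2 [0, 1] J" "F2 [2, 0] J = F2 [0, 2] J" "F2 [2, 1] J = F2 [1, 2] J" for J
    using irr_symI[OF assms(3)] by blast+
  have tr: "F2 [0, 0] J + F2 [1, 1] J + F2 [2, 2] J = 0" for J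
    using irr_trace[OF assms(3), of "[]" J] by (simp add: trI_def sum_lt_3)
  have tr0: "trI (Nof F0 F1 F2) [] J = F0 [] J" for J
    using tr[of J] by (simp add: trI_def Nof_def sum_lt_3 eps3_values[simplified])
  show "trI (Nof F0 F1 F2) = F0"
    by (rule supp_eqI[OF supp_tr2[OF sN] s(1)]) (simp add: idx_lists_0 tr0)
  show "crI (Nof F0 F1 F2) = F1"
  proof (rule supp_eqI[OF supp_cr2[OF sN] s(2)])
    fix I J assume "I \<in> idx_lists 3 1"
    then obtain k where I: "I = [k]" "k < 3" by (auto simp: idx_lists_def length_Suc_conv)
    have "\<forall>k<3. crI (Nof F0 F1 F2) [k] J = F1 [k] J"
      using e[of J] by (simp add: all_lt_3 crI_def sum_lt_3 eps3_values[simplified] Nof_def)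
    then show "crI (Nof F0 F1 F2) I J = F1 I J" using I by blast
  qed
  show "stf (Nof F0 F1 F2) = F2"
  proof (rule supp_eqI[OF supp_stf[OF sN] s(3)])
    fix I J assume "I \<in> idx_lists 3 2"
    then obtain i j where I: "I = [i, j]" "i < 3" "j < 3"
      by (auto simp: idx_lists_def length_Suc_conv numeral_2_eq_2)
    have "\<forall>i<3. \<forall>j<3. stf (Nof F0 F1 F2) [i, j] J = F2 [i, j] J"
      using e[of J] by (simp add: all_lt_3 stf_def rotI_pair dltI_def tr0)
        (simp add: sum_lt_3 eps3_values[simplified] Nof_def field_simps)
    then show "stf (Nof F0 F1 F2) I J = F2 I J" using I by blast
  qed
qed

lemma symlist_Nof:
  assumes "symlist 2 3 (F0 [])" "\<And>I. symlist 2 3 (F1 I)" "\<And>I. symlist 2 3 (F2 I)"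
  shows "symlist 2 3 (Nof F0 F1 F2 I)"
proof -
  have "Nof F0 F1 F2 I [b, a, c] = Nof F0 F1 F2 I [a, b, c] \<and> Nof F0 F1 F2 I [b, c, a] = Nof F0 F1 F2 I [a, b, c]"
    if "a < 2" "b < 2" "c < 2" for a b c
  proof -
    have "F0 [] [b, a, c] = F0 [] [a, b, c]" "F0 [] [b, c, a] = F0 [] [a, b, c]"
      "F1 K [b, a, c] = F1 K [a, b, c]" "F1 K [b, c, a] = F1 K [a, b, c]"
      "F2 K [b, a, c] = F2 K [a, b, c]" "F2 K [b, c, a] = F2 K [a, b, c]" for K
      using assms(1) assms(2,3)[of K] that unfolding symlist_def by metis+
    then show ?thesis by (auto simp: Nof_def split: list.split)
  qed
  then show ?thesis by (intro symlist_3I) metis+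
qed

lemma tensor_decomp_zero:
  assumes "supp 2 q F" "\<And>J. trI F [] J = 0" "\<And>I J. crI F I J = 0" "\<And>I J. stf F I J = 0"
  shows "F I J = 0"
proof (cases "I \<in> idx_lists 3 2")
  case True
  then obtain i j where I: "I = [i, j]" "i < 3" "j < 3"
    by (auto simp: idx_lists_def length_Suc_conv numeral_2_eq_2)
  have "F [p, q] J + F [q, p] J = 0" for p q
    using assms(4)[of "[p, q]" J] assms(2)[of J] by (simp add: stf_def rotI_pair dltI_def split: if_splits)
  then show ?thesis unfolding I(1) by (rule pair_from_sym_cr[where F = F, OF _ assms(3) I(2,3)])
next
  case False
  then show ?thesis using assms(1) unfolding supp_def by blast
qed

lemma symlist_tr:
  assumes "\<And>I. symlist 2 3 (F I)"
  shows "symlist 2 3 (trI F I)" "symlist 2 3 (crI F I)"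
proof -
  have e: "F K [a, b, c] = F K [b, a, c]" "F K [a, b, c] = F K [b, c, a]" if "a < 2" "b < 2" "c < 2" for K a b c
    using assms[of K] that unfolding symlist_def by metis+
  have "trI F I [a, b, c] = trI F I [b, a, c]" "trI F I [a, b, c] = trI F I [b, c, a]"
     "crI F I [a, b, c] = crI F I [b, a, c]" "crI F I [a, b, c] = crI F I [b, c, a]" if "a < 2" "b < 2" "c < 2" for a b c
    unfolding trI_def crI_def using e(1)[OF that] e(2)[OF that] by (simp_all split: list.split)
  then show "symlist 2 3 (trI F I)" "symlist 2 3 (crI F I)" by (blast intro: symlist_3I)+
qed

text \<open>The four components can be prescribed independently; all preimages needed for
  derivatives of 3-forms arise by choosing them suitably.\<close>

lemma exists_torsion_irr:
  assumes "irr (0, 3) G0" "irr (1, 1) B" "irr (1, 3) G1" "irr (2, 3) G2"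
  shows "\<exists>t\<in>torsion_space. trI (Nten t) = G0 \<and> Qten t = B \<and> crI (Nten t) = G1 \<and> stf (Nten t) = G2"
proof -
  note N = Nof_props[OF assms(1,3,4)]
  obtain t where "t \<in> torsion_space" "Nten t = Nof G0 G1 G2" "Qten t = B"
    using exists_torsion_NQ[OF N(1) symlist_Nof irr_supp[OF assms(2)]] irr_symJ assms by blast
  then show ?thesis using N by (intro bexI[of _ t]) simp_all
qed

lemma quotient_iso_invariant_3forms:
  "quotient_iso G_SO3_SL2 torsion_space
     (kerd (eta 0) 3 \<inter> kerd (eta 1) 3 \<inter> kerd (eta 2) 3 \<inter> kerd gamma_hat 3) [(0,3), (1,1), (1,3), (2,3)]"
proof (rule quotient_isoI[where \<Phi> = "[\<lambda>t. trI (Nten t), Qten, \<lambda>t. crI (Nten t), \<lambda>t. stf (Nten t)]"])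
  let ?\<Phi> = "[\<lambda>t. trI (Nten t), Qten, \<lambda>t. crI (Nten t), \<lambda>t. stf (Nten t)]"
  let ?S = "[(0,3), (1,1), (1,3), (2,3)] :: (nat \<times> nat) list"
  have all: "(\<forall>j<length ?S. P j) \<longleftrightarrow> P 0 \<and> P 1 \<and> P 2 \<and> P 3" for P
    by (simp add: All_less_Suc2 numeral_2_eq_2 numeral_3_eq_3)
  show "length ?\<Phi> = length ?S" by simp
  have "\<forall>j<length ?S. intertw G_SO3_SL2 (?\<Phi> ! j)"
    unfolding all by (simp add: intertw_ops intertw_stf intertw_Nten intertw_Qten)
  then show "j < length ?S \<Longrightarrow> intertw G_SO3_SL2 (?\<Phi> ! j)" for j by blast
  have "\<forall>j<length ?S. irr (?S ! j) ((?\<Phi> ! j) t)" if t: "t \<in> torsion_space" for t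
    unfolding all using supp_tr2[OF supp_Nten[of t]] supp_cr2[OF supp_Nten[of t]] Nten_sym[OF t] symlist_tr[OF Nten_sym[OF t]]
    by (simp add: irr_0 irr_1[unfolded One_nat_def] irr_stf supp_Nten supp_Qten[unfolded One_nat_def])
  then show "j < length ?S \<Longrightarrow> t \<in> torsion_space \<Longrightarrow> irr (?S ! j) ((?\<Phi> ! j) t)" for j t by blast
  show "\<exists>t\<in>torsion_space. \<forall>j<length ?S. (?\<Phi> ! j) t = F j" if "\<And>j. j < length ?S \<Longrightarrow> irr (?S ! j) (F j)" for F
  proof -
    have F: "irr (0, 3) (F 0)" "irr (1, 1) (F 1)" "irr (1, 3) (F 2)" "irr (2, 3) (F 3)"
      using that[of 0] that[of 1] that[of 2] that[of 3] by simp_all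
    show ?thesis unfolding all using exists_torsion_irr[OF F] by simp
  qed
  show "(\<forall>j<length ?S. \<forall>I J. (?\<Phi> ! j) t I J = 0) \<longleftrightarrow>
     t \<in> kerd (eta 0) 3 \<inter> kerd (eta 1) 3 \<inter> kerd (eta 2) 3 \<inter> kerd gamma_hat 3" if t: "t \<in> torsion_space" for t
    unfolding all joint_kernel
  proof (intro iffI)
    assume *: "(\<forall>I J. (?\<Phi> ! 0) t I J = 0) \<and> (\<forall>I J. (?\<Phi> ! 1) t I J = 0) \<and> (\<forall>I J. (?\<Phi> ! 2) t I J = 0) \<and> (\<forall>I J. (?\<Phi> ! 3) t I J = 0)"
    then show "t \<in> torsion_space \<and> (\<forall>I J. Nten t I J = 0) \<and> (\<forall>I J. Qten t I J = 0)"
      using t tensor_decomp_zero[OF supp_Nten[of t]] by simp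
  next
    assume "t \<in> torsion_space \<and> (\<forall>I J. Nten t I J = 0) \<and> (\<forall>I J. Qten t I J = 0)"
    then show "(\<forall>I J. (?\<Phi> ! 0) t I J = 0) \<and> (\<forall>I J. (?\<Phi> ! 1) t I J = 0) \<and> (\<forall>I J. (?\<Phi> ! 2) t I J = 0) \<and> (\<forall>I J. (?\<Phi> ! 3) t I J = 0)"
      by (simp add: stf_def trI_def crI_def rotI_def dltI_def split: list.split)
  qed
qed

subsection \<open>The modules determined by a single invariant 3-form\<close>

lemma irr_slice:
  assumes F: "irr (k, q) F"
  shows "irr (k, 0) (slice n C F)"
proof -
  have "slice n C F I J = slice n C F I' J" if "mset I = mset I'" for I I' J
  proof -
    have "F I K = F I' K" for K using F that unfolding irr_def by blast
    then show ?thesis by (simp add: slice_def)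
  qed
  moreover have "slice n C F I J = slice n C F I J'" if "mset J = mset J'" for I J J'
    using that by (auto simp: slice_def)
  moreover have "trI (slice n C F) I J = 0" for I J
  proof (cases "J = []")
    case True
    have "trI (slice n C F) I J = (\<Sum>K\<in>idx_lists 2 n. \<Sum>a<3. C K * F (a # a # I) K)"
      unfolding trI_def slice_def True by (simp add: sum.swap[of _ "{..<3}"])
    also have "\<dots> = (\<Sum>K\<in>idx_lists 2 n. C K * trI F I K)"
      by (simp add: trI_def sum_distrib_left)
    finally show ?thesis using irr_trace[OF F] by simp
  qed (simp add: trI_def slice_def)
  ultimately show ?thesis
    using supp_slice[OF irr_supp[OF F]] unfolding irr_def fst_conv snd_conv by blast
qed

lemma irr_add:
  assumes F: "irr s F" and G: "irr s G"
  shows "irr s (F + G)"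
proof -
  have "(F + G) I J = (F + G) I' J" if "mset I = mset I'" for I I' J
  proof -
    have "F I J = F I' J" "G I J = G I' J" using F G that unfolding irr_def by blast+
    then show ?thesis by simp
  qed
  moreover have "(F + G) I J = (F + G) I J'" if "mset J = mset J'" for I J J'
  proof -
    have "F I J = F I J'" "G I J = G I J'" using F G that unfolding irr_def by blast+
    then show ?thesis by simp
  qed
  moreover have "trI (F + G) I J = 0" for I J
  proof -
    have "trI F I J = 0" "trI G I J = 0" using F G unfolding irr_def by blast+
    then show ?thesis by (simp add: trI_def sum.distrib)
  qed
  moreover have "supp (fst s) (snd s) (F + G)" using F G unfolding irr_def by (blast intro: supp_add)
  ultimately show ?thesis unfolding irr_def by blast
qed

text \<open>F tensored with a symmetric element of B^n; the weight depends only on the number of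
  ones in \<open>J\<close>, so \<open>y\<close> lists the coordinates of that element.\<close>

definition prodT :: "nat \<Rightarrow> tensor \<Rightarrow> (nat \<Rightarrow> real) \<Rightarrow> tensor" where
  "prodT n F y = (\<lambda>I J. if J \<in> idx_lists 2 n then F I [] * y (sum_list J) else 0)"

lemma irr_prodT:
  assumes F: "irr (k, 0) F"
  shows "irr (k, n) (prodT n F y)"
proof -
  have mem: "J' \<in> idx_lists 2 n \<longleftrightarrow> J \<in> idx_lists 2 n" if "mset J = mset J'" for J J'
    using mset_eq_length[OF that] mset_eq_setD[OF that] by (simp add: idx_lists_def)
  have "prodT n F y I J = prodT n F y I' J" if "mset I = mset I'" for I I' J
  proof -
    have "F I [] = F I' []" using F that unfolding irr_def by blast
    then show ?thesis by (simp add: prodT_def)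
  qed
  moreover have "prodT n F y I J = prodT n F y I J'" if "mset J = mset J'" for I J J'
  proof -
    have "sum_list J = sum_list J'" using that by (metis sum_mset_sum_list)
    then show ?thesis by (simp add: prodT_def mem[OF that])
  qed
  moreover have "trI (prodT n F y) I J = 0" for I J
    using irr_trace[OF F, of I "[]"] by (cases "J \<in> idx_lists 2 n") (simp_all add: trI_def prodT_def sum_distrib_right[symmetric])
  moreover have "supp k n (prodT n F y)"
    using irr_supp[OF F] by (auto simp: supp_def prodT_def idx_lists_def)
  ultimately show ?thesis unfolding irr_def fst_conv snd_conv by blast
qed

text \<open>A slice of a product is a number times \<open>F\<close>, so prescribing several slices
  reduces to finding dual vectors in B^n.\<close>

lemma slice_prodT:
  assumes "irr (k, 0) F"
  shows "slice n C (prodT n F y) = smul (\<Sum>K\<in>idx_lists 2 n. C K * y (sum_list K)) F"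
proof (intro ext)
  fix I J
  have "F I J = 0" if "J \<noteq> []"
    using irr_supp[OF assms] that by (auto simp: supp_def idx_lists_0)
  then show "slice n C (prodT n F y) I J = smul (\<Sum>K\<in>idx_lists 2 n. C K * y (sum_list K)) F I J"
    by (auto simp: slice_def prodT_def sum_distrib_left sum_distrib_right mult_ac intro!: sum.cong)
qed

lemma slice_add: "slice n C (F + G) = slice n C F + slice n C G"
  using nat_op_slice unfolding nat_op_def by blast

lemma sum_idx_lists_2_1: "(\<Sum>K\<in>idx_lists 2 1. f K) = f [0] + f [1]" for f :: "nat list \<Rightarrow> real"
  unfolding One_nat_def sum_idx_lists_Suc by (simp add: idx_lists_0 sum_lt_2)

lemma sum_idx_lists_2_3:
  "(\<Sum>K\<in>idx_lists 2 3. f K) = f [0,0,0] + f [0,0,1] + f [0,1,0] + f [0,1,1] + f [1,0,0] + f [1,0,1] + f [1,1,0] + f [1,1,1]"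
  for f :: "nat list \<Rightarrow> real"
  unfolding numeral_3_eq_3 sum_idx_lists_Suc by (simp add: idx_lists_0 sum_lt_2)

definition cN :: "(nat \<Rightarrow> real) \<Rightarrow> nat list \<Rightarrow> real" where
  "cN x J = (-1) ^ sum_list J * x (3 - sum_list J) / 6"

text \<open>The tensor sliced is symmetric in R^2, so the weights may sit on the nondecreasing words
  alone; together with \<open>cQ\<close> they spell out the combination \<open>p\<close> of the
  components of \<open>Mx\<close>.\<close>

definition cC :: "(nat \<Rightarrow> real) \<Rightarrow> (nat \<Rightarrow> real) \<Rightarrow> nat list \<Rightarrow> real" where
  "cC p x J = (if J = [0,0,0] then p 0 * x 2 / 6 + p 1 * x 3 / 12
     else if J = [0,0,1] then - p 0 * x 1 / 3 - p 1 * x 2 / 12 + p 2 * x 3 / 6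
     else if J = [0,1,1] then p 0 * x 0 / 6 - p 1 * x 1 / 12 - p 2 * x 2 / 3
     else if J = [1,1,1] then p 1 * x 0 / 12 + p 2 * x 1 / 6 else 0)"

definition cQ :: "(nat \<Rightarrow> real) \<Rightarrow> (nat \<Rightarrow> real) \<Rightarrow> nat list \<Rightarrow> real" where
  "cQ p x J = (if J = [0] then (p 0 * x 1 + p 1 * x 2 + p 2 * x 3) / 3 else - (p 0 * x 0 + p 1 * x 1 + p 2 * x 2) / 3)"

definition VT :: "(nat \<Rightarrow> real) \<Rightarrow> (nat \<Rightarrow> real) \<Rightarrow> torsion \<Rightarrow> tensor" where
  "VT p x t = slice 3 (cC p x) (crI (Nten t)) + slice 1 (cQ p x) (Qten t)"

lemma VT_Mx: "VT p x t [m] [] = p 0 * Mx x t 0 m + p 1 * Mx x t 1 m + p 2 * Mx x t 2 m"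
  unfolding VT_def
  by (simp add: slice_def sum_idx_lists_2_1[unfolded One_nat_def] sum_idx_lists_2_3 cC_def cQ_def Mx_def Let_def field_simps)

lemma slice_cN:
  assumes "symlist 2 3 (F I)"
  shows "slice 3 (cN x) F I [] = (x 3 * F I [0,0,0] - 3 * x 2 * F I [0,0,1] + 3 * x 1 * F I [0,1,1] - x 0 * F I [1,1,1]) / 6"
  using symlist_J3[OF assms] unfolding slice_def sum_idx_lists_2_3
  by (simp add: cN_def numeral_2_eq_2[symmetric] power3_eq_cube field_simps)

lemma slice_stf_N:
  assumes t: "t \<in> torsion_space" and "p < 3" "q < 3"
  shows "slice 3 (cN x) (trI (Nten t)) [] [] = (\<Sum>i<3. Nx x t i i)"
    "slice 3 (cN x) (stf (Nten t)) [p, q] [] = Nx x t p q + Nx x t q p - (if p = q then 2/3 * (\<Sum>i<3. Nx x t i i) else 0)"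
proof -
  have s: "symlist 2 3 (trI (Nten t) [])" by (rule symlist_tr(1)[OF Nten_sym[OF t]])
  have s2: "symlist 2 3 (stf (Nten t) [p, q])"
    using irr_stf[OF supp_Nten, of t] Nten_sym[OF t] irr_symJ by blast
  show 1: "slice 3 (cN x) (trI (Nten t)) [] [] = (\<Sum>i<3. Nx x t i i)"
    unfolding slice_cN[of "trI (Nten t)" "[]", OF s] by (simp add: trI_def Nx_def sum_lt_3 field_simps)
  show "slice 3 (cN x) (stf (Nten t)) [p, q] [] = Nx x t p q + Nx x t q p - (if p = q then 2/3 * (\<Sum>i<3. Nx x t i i) else 0)"
    unfolding slice_cN[of "stf (Nten t)" "[p, q]", OF s2] 1[symmetric] slice_cN[of "trI (Nten t)" "[]", OF s]
    using assms(2,3) by (simp add: stf_def rotI_pair dltI_def Nx_def field_simps)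
qed

lemma irr_00_zero: "irr (0, 0) F \<Longrightarrow> F [] [] = 0 \<Longrightarrow> F I J = 0"
  using irr_supp[of 0 0 F] by (cases "I = [] \<and> J = []") (auto simp: supp_def idx_lists_0)

lemma supp_10_zero:
  assumes "supp 1 0 F" "\<And>i. i < 3 \<Longrightarrow> F [i] [] = 0"
  shows "F I J = 0"
proof (cases "I \<in> idx_lists 3 1 \<and> J \<in> idx_lists 2 0")
  case True
  then show ?thesis using assms(2) by (auto simp: idx_lists_def length_Suc_conv)
next
  case False
  then show ?thesis using assms(1) unfolding supp_def by blast
qed

lemma supp_20_zero:
  assumes "supp 2 0 F" "\<And>i j. i < 3 \<Longrightarrow> j < 3 \<Longrightarrow> F [i, j] [] = 0"
  shows "F I J = 0"
proof (cases "I \<in> idx_lists 3 2 \<and> J \<in> idx_lists 2 0")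
  case True
  then show ?thesis using assms(2) by (auto simp: idx_lists_def length_Suc_conv numeral_2_eq_2)
next
  case False
  then show ?thesis using assms(1) unfolding supp_def by blast
qed

lemma supp_VT: "supp 1 0 (VT p x t)"
  unfolding VT_def by (intro supp_add supp_slice[OF supp_cr2[OF supp_Nten]] supp_slice[OF supp_Qten])

lemma irr_VT: "irr (1, 0) (VT p x t)"
  using supp_VT by (intro irr_1) auto

lemma irr_slice_N:
  assumes t: "t \<in> torsion_space"
  shows "irr (0, 0) (slice n C (trI (Nten t)))" "irr (2, 0) (slice n C (stf (Nten t)))"
proof -
  have "irr (0, 3) (trI (Nten t))"
    by (rule irr_0[OF supp_tr2[OF supp_Nten]]) (simp add: symlist_tr(1)[OF Nten_sym[OF t]])
  then show "irr (0, 0) (slice n C (trI (Nten t)))" by (rule irr_slice)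
  have "irr (2, 3) (stf (Nten t))"
    by (rule irr_stf[OF supp_Nten]) (simp add: Nten_sym[OF t])
  then show "irr (2, 0) (slice n C (stf (Nten t)))" by (rule irr_slice)
qed

lemma intertw_SO3: "intertw G_SO3_SL2 \<Phi> \<Longrightarrow> intertw G_SO3 (\<lambda>t. slice n C (\<Phi> t))"
  using intertw_comp[OF intertw_mono[OF _ G_SO3_subset] nat_op_slice] by blast

lemma intertw_VT: "intertw G_SO3 (VT p x)"
  unfolding VT_def by (intro intertw_add intertw_SO3 intertw_ops intertw_Nten intertw_Qten)

lemma sym_N_zero_iff:
  assumes t: "t \<in> torsion_space"
  shows "(\<forall>p<3. \<forall>q<3. Nx x t p q + Nx x t q p = 0) \<longleftrightarrow>
    (\<forall>I J. slice 3 (cN x) (trI (Nten t)) I J = 0) \<and> (\<forall>I J. slice 3 (cN x) (stf (Nten t)) I J = 0)" (is "?L = ?R")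
proof
  assume L: ?L
  have d: "Nx x t p p = 0" if "p < 3" for p using L that by fastforce
  then have tr: "(\<Sum>i<3. Nx x t i i) = 0" by simp
  have "slice 3 (cN x) (trI (Nten t)) I J = 0" for I J
    by (rule irr_00_zero[OF irr_slice_N(1)[OF t]]) (use slice_stf_N(1)[OF t, of 0 0 x] tr in simp)
  moreover have "slice 3 (cN x) (stf (Nten t)) I J = 0" for I J
    by (rule supp_20_zero[OF supp_slice[OF supp_stf[OF supp_Nten]]])
      (use slice_stf_N(2)[OF t] tr L in simp)
  ultimately show ?R by blast
next
  assume R: ?R
  show ?L
  proof (intro allI impI)
    fix p q :: nat assume pq: "p < 3" "q < 3"
    show "Nx x t p q + Nx x t q p = 0"
      using slice_stf_N[OF t pq, of x] R by (simp split: if_splits)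
  qed
qed

text \<open>For \<open>c\<^sup>2 + s\<^sup>2 = 1\<close> put \<open>v = (c, s)\<close> and \<open>n = (s, -c)\<close>. The \<open>S\<^sup>2R\<^sup>2\<close>-valued part of
  \<open>d eta\<close> vanishes on \<open>(n, n)\<close>, so only its values on \<open>(v, n)\<close> and \<open>(v, v)\<close> remain.\<close>

definition pvn :: "real \<Rightarrow> real \<Rightarrow> nat \<Rightarrow> real" where
  "pvn c s n = (if n = 0 then - c * s else if n = 1 then c\<^sup>2 - s\<^sup>2 else c * s)"

definition pvv :: "real \<Rightarrow> real \<Rightarrow> nat \<Rightarrow> real" where
  "pvv c s n = (if n = 0 then c\<^sup>2 else if n = 1 then 2 * c * s else s\<^sup>2)"

text \<open>\<open>powc c s\<close> is the cube of v = (c, s). Its contractions with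
  \<open>crI (Nten t)\<close> and \<open>Qten t\<close> keep a factor v, and n is orthogonal to v.
  Hence an eta form determines only two copies of V.\<close>

lemma Mx_powc_nn: "s\<^sup>2 * Mx (powc c s) t 0 m - 2 * c * s * Mx (powc c s) t 1 m + c\<^sup>2 * Mx (powc c s) t 2 m = 0"
  by (simp add: Mx_def Let_def powc_def power2_eq_square power3_eq_cube field_simps)

lemma Mx_powc_zero:
  assumes "c\<^sup>2 + s\<^sup>2 = 1" "\<And>m. m < 3 \<Longrightarrow> VT (pvn c s) (powc c s) t [m] [] = 0"
    "\<And>m. m < 3 \<Longrightarrow> VT (pvv c s) (powc c s) t [m] [] = 0" "m < 3" "n < 3"
  shows "Mx (powc c s) t n m = 0"
proof -
  let ?M = "\<lambda>n. Mx (powc c s) t n m"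
  have 1: "- c * s * ?M 0 + (c\<^sup>2 - s\<^sup>2) * ?M 1 + c * s * ?M 2 = 0" "c\<^sup>2 * ?M 0 + 2 * c * s * ?M 1 + s\<^sup>2 * ?M 2 = 0"
    "s\<^sup>2 * ?M 0 - 2 * c * s * ?M 1 + c\<^sup>2 * ?M 2 = 0"
    using assms(2,3)[OF assms(4)] Mx_powc_nn by (simp_all add: VT_Mx pvn_def pvv_def)
  \<comment> \<open>The components are recovered from the values on (v, v), (v, n), (n, n) by the
    inverse change of basis, v and n being orthogonal of squared length
    \<open>c\<^sup>2 + s\<^sup>2\<close>.\<close>
  have "(c\<^sup>2 + s\<^sup>2)\<^sup>2 * ?M 0 = c\<^sup>2 * (c\<^sup>2 * ?M 0 + 2 * c * s * ?M 1 + s\<^sup>2 * ?M 2)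
      + s\<^sup>2 * (s\<^sup>2 * ?M 0 - 2 * c * s * ?M 1 + c\<^sup>2 * ?M 2)
      - 2 * c * s * (- c * s * ?M 0 + (c\<^sup>2 - s\<^sup>2) * ?M 1 + c * s * ?M 2)"
    "(c\<^sup>2 + s\<^sup>2)\<^sup>2 * ?M 1 = c * s * (c\<^sup>2 * ?M 0 + 2 * c * s * ?M 1 + s\<^sup>2 * ?M 2)
      - c * s * (s\<^sup>2 * ?M 0 - 2 * c * s * ?M 1 + c\<^sup>2 * ?M 2)
      + (c\<^sup>2 - s\<^sup>2) * (- c * s * ?M 0 + (c\<^sup>2 - s\<^sup>2) * ?M 1 + c * s * ?M 2)"
    "(c\<^sup>2 + s\<^sup>2)\<^sup>2 * ?M 2 = s\<^sup>2 * (c\<^sup>2 * ?M 0 + 2 * c * s * ?M 1 + s\<^sup>2 * ?M 2)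
      + c\<^sup>2 * (s\<^sup>2 * ?M 0 - 2 * c * s * ?M 1 + c\<^sup>2 * ?M 2)
      + 2 * c * s * (- c * s * ?M 0 + (c\<^sup>2 - s\<^sup>2) * ?M 1 + c * s * ?M 2)"
    by (simp_all add: power2_eq_square algebra_simps)
  then have "?M 0 = 0" "?M 1 = 0" "?M 2 = 0" unfolding 1 assms(1) by simp_all
  then have "\<forall>n<3. ?M n = 0" by (simp add: all_lt_3)
  then show ?thesis using assms(5) by blast
qed

definition yn :: "real \<Rightarrow> real \<Rightarrow> real \<Rightarrow> nat \<Rightarrow> real" where
  "yn a c s k = a * s ^ (3 - k) * (- c) ^ k"

text \<open>\<open>yn\<close> is a multiple of the cube of n = (s, -c), which pairs with v^3 to a
  power of the area of (v, n). Its double contraction with v^3 is a multiple of v n, seen on (v, n)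
  but not on (v, v); contracting v^3 with 3 n gives a multiple of v^2, for which it is the other way
  round. The constants 6, -12 and 3 normalise.\<close>

lemma pairing_powc:
  assumes "c\<^sup>2 + s\<^sup>2 = 1"
  shows "(\<Sum>K\<in>idx_lists 2 3. cN (powc c s) K * yn 6 c s (sum_list K)) = 1"
    "(\<Sum>K\<in>idx_lists 2 3. cC (pvn c s) (powc c s) K * yn (-12) c s (sum_list K)) = 1"
    "(\<Sum>K\<in>idx_lists 2 3. cC (pvv c s) (powc c s) K * yn (-12) c s (sum_list K)) = 0"
    "(\<Sum>K\<in>idx_lists 2 1. cQ (pvn c s) (powc c s) K * (if sum_list K = 0 then 3 * s else - 3 * c)) = 0"
    "(\<Sum>K\<in>idx_lists 2 1. cQ (pvv c s) (powc c s) K * (if sum_list K = 0 then 3 * s else - 3 * c)) = 1"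
proof -
  have S: "Suc (Suc 0) = 2" "Suc 2 = 3" by simp_all
  show "(\<Sum>K\<in>idx_lists 2 3. cN (powc c s) K * yn 6 c s (sum_list K)) = 1"
    unfolding sum_idx_lists_2_3 by (simp add: cN_def powc_def yn_def S) (use assms in algebra)
  show "(\<Sum>K\<in>idx_lists 2 3. cC (pvn c s) (powc c s) K * yn (-12) c s (sum_list K)) = 1"
    unfolding sum_idx_lists_2_3 by (simp add: cC_def pvn_def powc_def yn_def S) (use assms in algebra)
  show "(\<Sum>K\<in>idx_lists 2 3. cC (pvv c s) (powc c s) K * yn (-12) c s (sum_list K)) = 0"
    unfolding sum_idx_lists_2_3
    by (simp add: cC_def pvv_def powc_def yn_def S) (simp add: power2_eq_square power3_eq_cube numeral_eq_Suc field_simps)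
  show "(\<Sum>K\<in>idx_lists 2 1. cQ (pvn c s) (powc c s) K * (if sum_list K = 0 then 3 * s else - 3 * c)) = 0"
    unfolding sum_idx_lists_2_1
    by (simp add: cQ_def pvn_def powc_def S) (simp add: power2_eq_square power3_eq_cube numeral_eq_Suc field_simps)
  show "(\<Sum>K\<in>idx_lists 2 1. cQ (pvv c s) (powc c s) K * (if sum_list K = 0 then 3 * s else - 3 * c)) = 1"
    unfolding sum_idx_lists_2_1 by (simp add: cQ_def pvv_def powc_def S) (use assms in algebra)
qed

lemma exists_torsion_powc:
  assumes "c\<^sup>2 + s\<^sup>2 = 1" and F: "irr (0, 0) F0" "irr (1, 0) F1" "irr (1, 0) F2" "irr (2, 0) F3"
  shows "\<exists>t\<in>torsion_space. slice 3 (cN (powc c s)) (trI (Nten t)) = F0 \<and> VT (pvn c s) (powc c s) t = F1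
     \<and> VT (pvv c s) (powc c s) t = F2 \<and> slice 3 (cN (powc c s)) (stf (Nten t)) = F3"
proof -
  obtain t where t: "t \<in> torsion_space" "trI (Nten t) = prodT 3 F0 (yn 6 c s)"
    "Qten t = prodT 1 F2 (\<lambda>k. if k = 0 then 3 * s else - 3 * c)" "crI (Nten t) = prodT 3 F1 (yn (-12) c s)"
    "stf (Nten t) = prodT 3 F3 (yn 6 c s)"
    using exists_torsion_irr[OF irr_prodT[OF F(1)] irr_prodT[OF F(3)] irr_prodT[OF F(2)] irr_prodT[OF F(4)]] by blast
  have one: "smul 1 F = F" "smul 0 F = 0" "F + 0 = F" "0 + F = F" for F
    by (simp_all add: fun_eq_iff)
  show ?thesis
    by (rule bexI[OF _ t(1)])
      (simp only: t(2-5) VT_def slice_prodT[OF F(1)] slice_prodT[OF F(2)] slice_prodT[OF F(3)] slice_prodT[OF F(4)]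
        pairing_powc[OF assms(1)] one)
qed

lemma quotient_iso_powc:
  assumes cs: "c\<^sup>2 + s\<^sup>2 = 1"
  shows "quotient_iso G_SO3 torsion_space (kerd (kform (powc c s)) 3) [(0,0), (1,0), (1,0), (2,0)]"
proof -
  let ?x = "powc c s"
  let ?\<Phi> = "[\<lambda>t. slice 3 (cN ?x) (trI (Nten t)), VT (pvn c s) ?x, VT (pvv c s) ?x, \<lambda>t. slice 3 (cN ?x) (stf (Nten t))]"
  let ?S = "[(0,0), (1,0), (1,0), (2,0)] :: (nat \<times> nat) list"
  have all: "(\<forall>j<length ?S. P j) \<longleftrightarrow> P 0 \<and> P 1 \<and> P 2 \<and> P 3" for P
    by (simp add: All_less_Suc2 numeral_2_eq_2 numeral_3_eq_3)
  have tw: "\<forall>j<length ?S. intertw G_SO3 (?\<Phi> ! j)"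
    unfolding all by simp (intro conjI intertw_VT intertw_SO3 intertw_stf intertw_ops intertw_Nten)
  have irr: "\<forall>j<length ?S. irr (?S ! j) ((?\<Phi> ! j) t)" if t: "t \<in> torsion_space" for t
    unfolding all by (simp add: irr_slice_N[OF t] irr_VT[unfolded One_nat_def])
  have M: "(\<forall>n<3. \<forall>m<3. Mx ?x t n m = 0) \<longleftrightarrow>
      (\<forall>I J. VT (pvn c s) ?x t I J = 0) \<and> (\<forall>I J. VT (pvv c s) ?x t I J = 0)" (is "?L = ?R") for t
  proof
    assume L: ?L
    have "VT p ?x t I J = 0" for p I J
      by (rule supp_10_zero[OF supp_VT]) (simp add: VT_Mx L)
    then show ?R by blast
  next
    assume ?R
    then show ?L using Mx_powc_zero[OF cs] by blast
  qed
  show ?thesis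
  proof (rule quotient_isoI[where \<Phi> = ?\<Phi>], goal_cases)
    case 1 show ?case by simp
  next
    case (2 j) then show ?case using tw by blast
  next
    case (3 j t) then show ?case using irr by blast
  next
    case (4 F)
    have F: "irr (0, 0) (F 0)" "irr (1, 0) (F 1)" "irr (1, 0) (F 2)" "irr (2, 0) (F 3)"
      using 4[of 0] 4[of 1] 4[of 2] 4[of 3] by simp_all
    show ?case unfolding all using exists_torsion_powc[OF cs F] by simp
  next
    case (5 t)
    have "t \<in> kerd (kform ?x) 3 \<longleftrightarrow> (\<forall>I J. slice 3 (cN ?x) (trI (Nten t)) I J = 0) \<and> (\<forall>I J. VT (pvn c s) ?x t I J = 0)
      \<and> (\<forall>I J. VT (pvv c s) ?x t I J = 0) \<and> (\<forall>I J. slice 3 (cN ?x) (stf (Nten t)) I J = 0)"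
      unfolding kerd_kerk kerk_iff[OF 5] sym_N_zero_iff[OF 5] M using 5 by blast
    then show ?case unfolding all by simp
  qed
qed

text \<open>Here the cubic is not a cube, and the three components of \<open>Mx\<close> are
  independent; the unit vectors \<open>e k\<close> read them off as three copies of V.\<close>

lemma quotient_iso_gamma_hat:
  "quotient_iso G_SO3 torsion_space (kerd gamma_hat 3) [(0,0), (1,0), (1,0), (1,0), (2,0)]"
proof -
  define e where "e k n = (if n = k then 1 else 0 :: real)" for k n :: nat
  let ?\<Phi> = "[\<lambda>t. slice 3 (cN hatc) (trI (Nten t)), VT (e 0) hatc, VT (e 1) hatc, VT (e 2) hatc,
     \<lambda>t. slice 3 (cN hatc) (stf (Nten t))]"
  let ?S = "[(0,0), (1,0), (1,0), (1,0), (2,0)] :: (nat \<times> nat) list"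
  have all: "(\<forall>j<length ?S. P j) \<longleftrightarrow> P 0 \<and> P 1 \<and> P 2 \<and> P 3 \<and> P 4" for P
    by (simp add: All_less_Suc2 eval_nat_numeral)
  have tw: "\<forall>j<length ?S. intertw G_SO3 (?\<Phi> ! j)"
    unfolding all by simp (intro conjI intertw_VT intertw_SO3 intertw_stf intertw_ops intertw_Nten)
  have irr: "\<forall>j<length ?S. irr (?S ! j) ((?\<Phi> ! j) t)" if t: "t \<in> torsion_space" for t
    unfolding all by (simp add: irr_slice_N[OF t] irr_VT[unfolded One_nat_def])
  have M: "(\<forall>n<3. \<forall>m<3. Mx hatc t n m = 0) \<longleftrightarrow>
      (\<forall>I J. VT (e 0) hatc t I J = 0) \<and> (\<forall>I J. VT (e 1) hatc t I J = 0) \<and> (\<forall>I J. VT (e 2) hatc t I J = 0)" (is "?L = ?R") for t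
  proof
    assume L: ?L
    have "VT p hatc t I J = 0" for p I J
      by (rule supp_10_zero[OF supp_VT]) (simp add: VT_Mx L)
    then show ?R by blast
  next
    assume R: ?R
    have "Mx hatc t 0 m = VT (e 0) hatc t [m] []" "Mx hatc t 1 m = VT (e 1) hatc t [m] []"
      "Mx hatc t 2 m = VT (e 2) hatc t [m] []" for m
      by (simp_all add: VT_Mx e_def)
    with R have "\<forall>m<3. Mx hatc t 0 m = 0" "\<forall>m<3. Mx hatc t 1 m = 0" "\<forall>m<3. Mx hatc t 2 m = 0" by metis+
    then show ?L unfolding all_lt_3[of "\<lambda>n. \<forall>m<3. Mx hatc t n m = 0"] by blast
  qed
  show ?thesis
  proof (rule quotient_isoI[where \<Phi> = ?\<Phi>], goal_cases)
    case 1 show ?case by simp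
  next
    case (2 j) then show ?case using tw by blast
  next
    case (3 j t) then show ?case using irr by blast
  next
    case (4 F)
    have F: "irr (0, 0) (F 0)" "irr (1, 0) (F 1)" "irr (1, 0) (F 2)" "irr (1, 0) (F 3)" "irr (2, 0) (F 4)"
      using 4[of 0] 4[of 1] 4[of 2] 4[of 3] 4[of 4] by simp_all
    \<comment> \<open>Dual vectors for \<open>hatc\<close>. The entry C001 feeds components 0 and 2
      of \<open>Mx\<close>, so \<open>?y1\<close> adds an entry at 111 that cancels it in component
      2. \<open>?y2\<close> reaches component 1 through \<open>Qten\<close>, \<open>?y3\<close>
      component 2 through C111.\<close>
    let ?y = "\<lambda>k. if k = 0 then - 6 else 0" and ?y1 = "\<lambda>k. if k = 1 \<or> k = 3 then - 3 else 0"
      and ?y3 = "\<lambda>k. if k = 3 then 6 else 0" and ?y2 = "\<lambda>k. if k = 1 then - 3 else 0"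
    obtain t where t: "t \<in> torsion_space" "trI (Nten t) = prodT 3 (F 0) ?y"
      "Qten t = prodT 1 (F 2) ?y2" "crI (Nten t) = prodT 3 (F 1) ?y1 + prodT 3 (F 3) ?y3"
      "stf (Nten t) = prodT 3 (F 4) ?y"
      using exists_torsion_irr[OF irr_prodT[OF F(1)] irr_prodT[OF F(3)] irr_add[OF irr_prodT[OF F(2)] irr_prodT[OF F(4)]]
        irr_prodT[OF F(5)]] by blast
    have one: "smul 1 F = F" "smul 0 F = 0" "F + 0 = F" "0 + F = F" for F
      by (simp_all add: fun_eq_iff)
    have n: "(\<Sum>K\<in>idx_lists 2 3. cN hatc K * ?y (sum_list K)) = 1"
      "(\<Sum>K\<in>idx_lists 2 3. cC (e 0) hatc K * ?y1 (sum_list K)) = 1"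
      "(\<Sum>K\<in>idx_lists 2 3. cC (e 1) hatc K * ?y1 (sum_list K)) = 0"
      "(\<Sum>K\<in>idx_lists 2 3. cC (e 2) hatc K * ?y1 (sum_list K)) = 0"
      "(\<Sum>K\<in>idx_lists 2 3. cC (e 0) hatc K * ?y3 (sum_list K)) = 0"
      "(\<Sum>K\<in>idx_lists 2 3. cC (e 1) hatc K * ?y3 (sum_list K)) = 0"
      "(\<Sum>K\<in>idx_lists 2 3. cC (e 2) hatc K * ?y3 (sum_list K)) = 1"
      "(\<Sum>K\<in>idx_lists 2 1. cQ (e 0) hatc K * ?y2 (sum_list K)) = 0"
      "(\<Sum>K\<in>idx_lists 2 1. cQ (e 1) hatc K * ?y2 (sum_list K)) = 1"
      "(\<Sum>K\<in>idx_lists 2 1. cQ (e 2) hatc K * ?y2 (sum_list K)) = 0"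
      unfolding sum_idx_lists_2_3 sum_idx_lists_2_1 by (simp_all add: cN_def cC_def cQ_def e_def hatc_def)
    have "slice 3 (cN hatc) (trI (Nten t)) = F 0" "VT (e 0) hatc t = F 1" "VT (e 1) hatc t = F 2"
      "VT (e 2) hatc t = F 3" "slice 3 (cN hatc) (stf (Nten t)) = F 4"
      by (simp_all only: t(2-5) VT_def slice_add slice_prodT[OF F(1)] slice_prodT[OF F(2)] slice_prodT[OF F(3)]
        slice_prodT[OF F(4)] slice_prodT[OF F(5)] n one)
    then show ?case unfolding all by (intro bexI[OF _ t(1)]) simp
  next
    case (5 t)
    have "t \<in> kerd gamma_hat 3 \<longleftrightarrow> (\<forall>I J. slice 3 (cN hatc) (trI (Nten t)) I J = 0) \<and> (\<forall>I J. VT (e 0) hatc t I J = 0)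
      \<and> (\<forall>I J. VT (e 1) hatc t I J = 0) \<and> (\<forall>I J. VT (e 2) hatc t I J = 0) \<and> (\<forall>I J. slice 3 (cN hatc) (stf (Nten t)) I J = 0)"
      unfolding gamma_hat_kform kerd_kerk kerk_iff[OF 5] sym_N_zero_iff[OF 5] M using 5 by blast
    then show ?case unfolding all by simp
  qed
qed

subsection \<open>Ranks\<close>

abbreviation (input) fscale :: "real \<Rightarrow> ('a \<Rightarrow> real) \<Rightarrow> 'a \<Rightarrow> real" where
  "fscale \<equiv> \<lambda>c v x. c * v x"

lemma vector_space_fscale: "vector_space (fscale :: real \<Rightarrow> ('a \<Rightarrow> real) \<Rightarrow> 'a \<Rightarrow> real)"
  by unfold_locales (auto simp: fun_eq_iff algebra_simps)

text \<open>Bases of the spans are chosen inside the \<open>V i\<close> and embedded in separate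
  blocks. That 0 lies in each \<open>V i\<close> puts the embedded vectors into the product set, and
  the finite set \<open>X\<close> of coordinates makes every basis finite, so that cardinalities
  add.\<close>

lemma dim_direct_sum:
  fixes V :: "nat \<Rightarrow> ('a \<Rightarrow> real) set"
  assumes zero: "\<And>i. i < n \<Longrightarrow> (\<lambda>_. 0) \<in> V i"
    and X: "finite X" "\<And>i v x. i < n \<Longrightarrow> v \<in> V i \<Longrightarrow> x \<notin> X \<Longrightarrow> v x = 0"
  shows "vector_space.dim fscale {\<lambda>(i, x). if i < n then f i x else 0 | f. \<forall>i<n. f i \<in> V i}
    = (\<Sum>i<n. vector_space.dim fscale (V i))" (is "vector_space.dim _ ?W = _")
proof -
  interpret A: vector_space "fscale :: real \<Rightarrow> ('a \<Rightarrow> real) \<Rightarrow> 'a \<Rightarrow> real" by (rule vector_space_fscale)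
  interpret B: vector_space "fscale :: real \<Rightarrow> (nat \<times> 'a \<Rightarrow> real) \<Rightarrow> nat \<times> 'a \<Rightarrow> real" by (rule vector_space_fscale)
  define emb :: "nat \<Rightarrow> ('a \<Rightarrow> real) \<Rightarrow> nat \<times> 'a \<Rightarrow> real" where "emb i v = (\<lambda>(k, x). if k = i then v x else 0)" for i v
  have "\<exists>B. B \<subseteq> V i \<and> A.independent B \<and> V i \<subseteq> A.span B \<and> card B = A.dim (V i)" for i
    using A.basis_exists[of "V i"] by metis
  then obtain Bs where "\<And>i. Bs i \<subseteq> V i \<and> A.independent (Bs i) \<and> V i \<subseteq> A.span (Bs i) \<and> card (Bs i) = A.dim (V i)"
    by metis
  then have Bs: "\<And>i. i < n \<Longrightarrow> Bs i \<subseteq> V i" "\<And>i. i < n \<Longrightarrow> A.independent (Bs i)"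
    "\<And>i. i < n \<Longrightarrow> V i \<subseteq> A.span (Bs i)" "\<And>i. i < n \<Longrightarrow> card (Bs i) = A.dim (V i)"
    by blast+
  have fin: "finite (Bs i)" if i: "i < n" for i
  proof -
    define d where "d x = (\<lambda>y. if y = x then 1 else 0 :: real)" for x :: 'a
    have "v \<in> A.span (d ` X)" if "v \<in> Bs i" for v
    proof -
      have "v = (\<Sum>x\<in>X. fscale (v x) (d x))"
      proof
        fix y
        have "(\<Sum>x\<in>X. fscale (v x) (d x)) y = (\<Sum>x\<in>X. v x * d x y)"
          by (induction X rule: infinite_finite_induct) auto
        also have "\<dots> = (\<Sum>x\<in>X. if x = y then v y else 0)"
          by (intro sum.cong) (auto simp: d_def)
        also have "\<dots> = v y" using X(1) X(2)[OF i, of v y] Bs(1)[OF i] that by auto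
        finally show "v y = (\<Sum>x\<in>X. fscale (v x) (d x)) y" by simp
      qed
      also have "\<dots> \<in> A.span (d ` X)" by (intro A.span_sum A.span_scale A.span_base) auto
      finally show ?thesis .
    qed
    then show ?thesis using A.independent_span_bound[of "d ` X" "Bs i"] X(1) Bs(2)[OF i] by blast
  qed
  define P where "P = (SIGMA i:{..<n}. Bs i)"
  define E where "E = (\<lambda>(i, b). emb i b)"
  have finP: "finite P" unfolding P_def using fin by auto
  have nz: "b \<noteq> 0" if "i < n" "b \<in> Bs i" for i b
    using A.dependent_zero[of "Bs i"] Bs(2) that by blast
  have inj: "inj_on E P"
  proof (rule inj_onI)
    fix p q assume p: "p \<in> P" and q: "q \<in> P" and eq: "E p = E q"
    obtain i b j c where pq: "p = (i, b)" "q = (j, c)" by (cases p, cases q)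
    have e: "emb i b (k, x) = emb j c (k, x)" for k x using eq by (simp add: E_def pq)
    obtain x where "b x \<noteq> 0" using nz[of i b] p by (auto simp: P_def pq fun_eq_iff)
    then have "i = j" using e[of i x] by (auto simp: emb_def split: if_splits)
    moreover have "b = c" using e[of i] \<open>i = j\<close> by (auto simp: emb_def)
    ultimately show "p = q" by (simp add: pq)
  qed
  have indep: "B.independent (E ` P)"
    unfolding B.independent_explicit_module
  proof (intro allI impI)
    fix T u w assume T: "finite T" "T \<subseteq> E ` P" and s: "(\<Sum>v\<in>T. fscale (u v) v) = 0" and w: "w \<in> T"
    obtain Q where Q: "Q \<subseteq> P" "T = E ` Q" using T by (meson subset_image_iff)
    have finQ: "finite Q" using Q finP finite_subset by blast
    obtain i b where ib: "(i, b) \<in> Q" "w = emb i b" using w Q by (auto simp: E_def)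
    then have i: "i < n" using Q by (auto simp: P_def)
    define R where "R = {c. (i, c) \<in> Q}"
    have "R \<subseteq> snd ` Q" by (force simp: R_def)
    then have R: "finite R" "R \<subseteq> Bs i"
      using finQ Q by (auto simp: R_def P_def intro: finite_subset)
    \<comment> \<open>Reading only the coordinates of block i discards the other blocks of the
      relation.\<close>
    have "(\<Sum>c\<in>R. u (emb i c) * c x) = 0" for x
    proof -
      have "0 = (\<Sum>v\<in>T. fscale (u v) v) (i, x)" by (simp add: s)
      also have "\<dots> = (\<Sum>v\<in>T. u v * v (i, x))" using T(1) by (induction T) auto
      also have "\<dots> = (\<Sum>p\<in>Q. u (E p) * E p (i, x))"
        unfolding Q(2) using inj_on_subset[OF inj Q(1)] by (simp add: sum.reindex)
      also have "\<dots> = (\<Sum>p\<in>Pair i ` R. u (E p) * E p (i, x))"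
        using finQ by (intro sum.mono_neutral_right) (auto simp: R_def E_def emb_def image_iff split: if_splits)
      also have "\<dots> = (\<Sum>c\<in>R. u (emb i c) * c x)"
        by (subst sum.reindex) (auto simp: inj_on_def E_def emb_def)
      finally show ?thesis by simp
    qed
    moreover have "(\<Sum>c\<in>R. fscale (u (emb i c)) c) x = (\<Sum>c\<in>R. u (emb i c) * c x)" for x
      using R(1) by (induction R) auto
    ultimately have "(\<Sum>c\<in>R. fscale (u (emb i c)) c) = 0" by (simp add: fun_eq_iff)
    then show "u w = 0"
      using A.independentD[OF Bs(2)[OF i] R, of "\<lambda>c. u (emb i c)" b] ib by (simp add: R_def)
  qed
  have EW: "E ` P \<subseteq> ?W"
  proof
    fix w assume "w \<in> E ` P"
    then obtain i b where ib: "i < n" "b \<in> Bs i" "w = emb i b" by (auto simp: E_def P_def)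
    have "w = (\<lambda>(k, x). if k < n then (if k = i then b else (\<lambda>_. 0)) x else 0)"
      using ib(1) by (auto simp: ib(3) emb_def fun_eq_iff)
    moreover have "\<forall>k<n. (if k = i then b else (\<lambda>_. 0)) \<in> V k"
      using ib Bs(1) zero by auto
    ultimately show "w \<in> ?W"
      unfolding mem_Collect_eq by (intro exI[of _ "\<lambda>k. if k = i then b else (\<lambda>_. 0)"] conjI)
  qed
  have emb_span: "emb i v \<in> B.span (E ` P)" if i: "i < n" and v: "v \<in> A.span (Bs i)" for i v
  proof (rule A.span_induct[OF v])
    show "emb i b \<in> B.span (E ` P)" if "b \<in> Bs i" for b
      using that i by (intro B.span_base) (auto simp: E_def P_def image_iff intro!: bexI[of _ "(i, b)"])
    have add: "emb i (v + w) = emb i v + emb i w" "emb i (fscale c v) = fscale c (emb i v)" "emb i 0 = 0" for v w c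
      by (auto simp: emb_def fun_eq_iff)
    show "A.subspace {v. emb i v \<in> B.span (E ` P)}"
      by (auto simp: A.subspace_def add B.span_zero intro: B.span_add B.span_scale)
  qed
  have WE: "?W \<subseteq> B.span (E ` P)"
  proof
    fix w assume "w \<in> ?W"
    then obtain f where f: "\<forall>i<n. f i \<in> V i" "w = (\<lambda>(i, x). if i < n then f i x else 0)" by blast
    have "(\<Sum>i<m. emb i (f i)) (k, x) = (if k < m then f k x else 0)" for m k x
      by (induction m) (auto simp: emb_def less_Suc_eq)
    then have "w = (\<Sum>i<n. emb i (f i))" by (auto simp: f(2) fun_eq_iff)
    also have "\<dots> \<in> B.span (E ` P)"
      using f(1) Bs(3) by (intro B.span_sum emb_span) auto
    finally show "w \<in> B.span (E ` P)" .
  qed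
  have "B.dim ?W = card (E ` P)" using B.dim_unique[OF EW WE indep refl] by simp
  also have "\<dots> = card P" by (rule card_image[OF inj])
  also have "\<dots> = (\<Sum>i<n. A.dim (V i))" unfolding P_def using fin Bs(4) by simp
  finally show ?thesis .
qed

lemma dform_tadd: "dform \<alpha> k (tadd t s) L = dform \<alpha> k t L + dform \<alpha> k s L"
  by (simp add: dform_def tadd_def sum.distrib algebra_simps)

lemma dform_tscale: "dform \<alpha> k (tscale c t) L = c * dform \<alpha> k t L"
  by (simp add: dform_def tscale_def sum_distrib_left algebra_simps)

lemma torsion_space_tadd: "t \<in> torsion_space \<Longrightarrow> s \<in> torsion_space \<Longrightarrow> tadd t s \<in> torsion_space"
proof -
  assume t: "t \<in> torsion_space" and s: "s \<in> torsion_space"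
  have "tadd t s x y z = - tadd t s y x z" for x y z
    using torsion_swap[OF t, of x y z] torsion_swap[OF s, of x y z] by (simp add: tadd_def)
  moreover have "tadd t s x y z = 0" if "\<not> (x < 6 \<and> y < 6 \<and> z < 6)" for x y z
  proof -
    have "t x y z = 0" "s x y z = 0" using t s that unfolding torsion_space_def by blast+
    then show ?thesis by (simp add: tadd_def)
  qed
  ultimately show ?thesis unfolding torsion_space_def by blast
qed

lemma torsion_space_tscale: "t \<in> torsion_space \<Longrightarrow> tscale c t \<in> torsion_space"
proof -
  assume t: "t \<in> torsion_space"
  have "tscale c t x y z = - tscale c t y x z" for x y z
    using torsion_swap[OF t, of x y z] by (simp add: tscale_def)
  moreover have "tscale c t x y z = 0" if "\<not> (x < 6 \<and> y < 6 \<and> z < 6)" for x y z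
  proof -
    have "t x y z = 0" using t that unfolding torsion_space_def by blast
    then show ?thesis by (simp add: tscale_def)
  qed
  ultimately show ?thesis unfolding torsion_space_def by blast
qed

section \<open>Independence of the three eta derivatives\<close>

definition ec :: "nat \<Rightarrow> real" where
  "ec i = (if i = 0 then 1 else - 1 / 2)"

definition es :: "nat \<Rightarrow> real" where
  "es i = (if i = 0 then 0 else if i = 1 then sqrt 3 / 2 else - sqrt 3 / 2)"

lemma ec_es: "(ec i)\<^sup>2 + (es i)\<^sup>2 = 1"
  by (simp add: ec_def es_def power2_eq_square)

lemma eta_ec_es: "i < 3 \<Longrightarrow> eta i = kform (powc (ec i) (es i))"
proof -
  have "\<forall>i<3. eta i = kform (powc (ec i) (es i))"
    unfolding all_lt_3 eta_kform by (simp add: ec_def es_def)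
  then show "i < 3 \<Longrightarrow> eta i = kform (powc (ec i) (es i))" by blast
qed

text \<open>\<open>dY j\<close>, \<open>(dAn j, dBn j)\<close>, \<open>(dAv j, dBv j)\<close> are dual to the functionals through which the
  three \<open>d eta\<close> factor; entry \<open>k\<close> is the component with \<open>k\<close> indices equal to 1.\<close>

definition dY :: "nat \<Rightarrow> nat \<Rightarrow> real" where
  "dY j k = (if j = 0 then [0, 2/3, 0, -6] ! k else if j = 1 then [2 * sqrt 3, 8/3, 2 * sqrt 3 / 3, 0] ! k
     else [- 2 * sqrt 3, 8/3, - 2 * sqrt 3 / 3, 0] ! k)"

definition dAn :: "nat \<Rightarrow> nat \<Rightarrow> real" where
  "dAn j k = (if j = 0 then [0, -4/3, 0, 12] ! k else if j = 1 then [- 4 * sqrt 3, -16/3, - 4 * sqrt 3 / 3, 0] ! k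
     else [4 * sqrt 3, -16/3, 4 * sqrt 3 / 3, 0] ! k)"

definition dBn :: "nat \<Rightarrow> nat \<Rightarrow> real" where
  "dBn j k = (if j = 0 then [-4/3, 0] ! k else if j = 1 then [2/3, - 2 * sqrt 3 / 3] ! k
     else [2/3, 2 * sqrt 3 / 3] ! k)"

definition dAv :: "nat \<Rightarrow> real" where
  "dAv k = [-2, 0, 2, 0] ! k"

definition dBv :: "nat \<Rightarrow> nat \<Rightarrow> real" where
  "dBv j k = (if j = 0 then [0, -2] ! k else if j = 1 then [sqrt 3, 1] ! k else [- sqrt 3, 1] ! k)"

lemma pairing_sums:
  "(\<Sum>K\<in>idx_lists 2 3. cN x K * y (sum_list K)) = (x 3 * y 0 - 3 * x 2 * y 1 + 3 * x 1 * y 2 - x 0 * y 3) / 6"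
  "(\<Sum>K\<in>idx_lists 2 3. cC p x K * y (sum_list K)) = (p 0 * x 2 / 6 + p 1 * x 3 / 12) * y 0
     + (- p 0 * x 1 / 3 - p 1 * x 2 / 12 + p 2 * x 3 / 6) * y 1
     + (p 0 * x 0 / 6 - p 1 * x 1 / 12 - p 2 * x 2 / 3) * y 2 + (p 1 * x 0 / 12 + p 2 * x 1 / 6) * y 3"
  "(\<Sum>K\<in>idx_lists 2 1. cQ p x K * y (sum_list K)) =
     (p 0 * x 1 + p 1 * x 2 + p 2 * x 3) / 3 * y 0 - (p 0 * x 0 + p 1 * x 1 + p 2 * x 2) / 3 * y 1"
proof -
  have S: "Suc (Suc 0) = 2" "Suc 2 = 3" by simp_all
  show "(\<Sum>K\<in>idx_lists 2 3. cN x K * y (sum_list K)) = (x 3 * y 0 - 3 * x 2 * y 1 + 3 * x 1 * y 2 - x 0 * y 3) / 6"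
    unfolding sum_idx_lists_2_3 by (simp add: cN_def S power3_eq_cube field_simps)
  show "(\<Sum>K\<in>idx_lists 2 3. cC p x K * y (sum_list K)) = (p 0 * x 2 / 6 + p 1 * x 3 / 12) * y 0
     + (- p 0 * x 1 / 3 - p 1 * x 2 / 12 + p 2 * x 3 / 6) * y 1
     + (p 0 * x 0 / 6 - p 1 * x 1 / 12 - p 2 * x 2 / 3) * y 2 + (p 1 * x 0 / 12 + p 2 * x 1 / 6) * y 3"
    unfolding sum_idx_lists_2_3 by (simp add: cC_def S)
  show "(\<Sum>K\<in>idx_lists 2 1. cQ p x K * y (sum_list K)) =
     (p 0 * x 1 + p 1 * x 2 + p 2 * x 3) / 3 * y 0 - (p 0 * x 0 + p 1 * x 1 + p 2 * x 2) / 3 * y 1"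
    unfolding sum_idx_lists_2_1 by (simp add: cQ_def field_simps)
qed

text \<open>On V-parts six functionals act on the 6-dimensional space of pairs of a cubic and a
  linear form, so the dual vectors are forced; the three eta derivatives already determine both A^2
  \<otimes> B^1 and A^2 \<otimes> B^3. The three functionals \<open>cN\<close> on the 4-dimensional
  B^3 leave some freedom, and \<open>dY j\<close> is taken to be -1/2 times
  \<open>dAn j\<close>.\<close>

lemma dual_pairing:
  assumes "i < 3" "j < 3"
  shows "(\<Sum>K\<in>idx_lists 2 3. cN (powc (ec i) (es i)) K * dY j (sum_list K)) = of_bool (i = j)"
    "(\<Sum>K\<in>idx_lists 2 3. cC (pvn (ec i) (es i)) (powc (ec i) (es i)) K * dAn j (sum_list K))
      + (\<Sum>K\<in>idx_lists 2 1. cQ (pvn (ec i) (es i)) (powc (ec i) (es i)) K * dBn j (sum_list K)) = of_bool (i = j)"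
    "(\<Sum>K\<in>idx_lists 2 3. cC (pvn (ec i) (es i)) (powc (ec i) (es i)) K * dAv (sum_list K))
      + (\<Sum>K\<in>idx_lists 2 1. cQ (pvn (ec i) (es i)) (powc (ec i) (es i)) K * dBv j (sum_list K)) = 0"
    "(\<Sum>K\<in>idx_lists 2 3. cC (pvv (ec i) (es i)) (powc (ec i) (es i)) K * dAn j (sum_list K))
      + (\<Sum>K\<in>idx_lists 2 1. cQ (pvv (ec i) (es i)) (powc (ec i) (es i)) K * dBn j (sum_list K)) = 0"
    "(\<Sum>K\<in>idx_lists 2 3. cC (pvv (ec i) (es i)) (powc (ec i) (es i)) K * dAv (sum_list K))
      + (\<Sum>K\<in>idx_lists 2 1. cQ (pvv (ec i) (es i)) (powc (ec i) (es i)) K * dBv j (sum_list K)) = of_bool (i = j)"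
proof -
  have S: "sqrt 3 * sqrt 3 = 3" "sqrt 3 * (sqrt 3 * y) = 3 * y" for y
    by simp_all
  have lt: "i \<in> {0, 1, 2}" "j \<in> {0, 1, 2}" using assms by auto
  show "(\<Sum>K\<in>idx_lists 2 3. cN (powc (ec i) (es i)) K * dY j (sum_list K)) = of_bool (i = j)"
    using lt unfolding pairing_sums
    by (elim insertE emptyE; simp add: powc_def ec_def es_def dY_def S power2_eq_square power3_eq_cube)
  show "(\<Sum>K\<in>idx_lists 2 3. cC (pvn (ec i) (es i)) (powc (ec i) (es i)) K * dAn j (sum_list K))
      + (\<Sum>K\<in>idx_lists 2 1. cQ (pvn (ec i) (es i)) (powc (ec i) (es i)) K * dBn j (sum_list K)) = of_bool (i = j)"
    "(\<Sum>K\<in>idx_lists 2 3. cC (pvn (ec i) (es i)) (powc (ec i) (es i)) K * dAv (sum_list K))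
      + (\<Sum>K\<in>idx_lists 2 1. cQ (pvn (ec i) (es i)) (powc (ec i) (es i)) K * dBv j (sum_list K)) = 0"
    "(\<Sum>K\<in>idx_lists 2 3. cC (pvv (ec i) (es i)) (powc (ec i) (es i)) K * dAn j (sum_list K))
      + (\<Sum>K\<in>idx_lists 2 1. cQ (pvv (ec i) (es i)) (powc (ec i) (es i)) K * dBn j (sum_list K)) = 0"
    "(\<Sum>K\<in>idx_lists 2 3. cC (pvv (ec i) (es i)) (powc (ec i) (es i)) K * dAv (sum_list K))
      + (\<Sum>K\<in>idx_lists 2 1. cQ (pvv (ec i) (es i)) (powc (ec i) (es i)) K * dBv j (sum_list K)) = of_bool (i = j)"
    using lt unfolding pairing_sums
    by (elim insertE emptyE; simp add: powc_def pvn_def pvv_def ec_def es_def dAn_def dBn_def dAv_def dBv_def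
        S power2_eq_square power3_eq_cube)+
qed

lemma smul_add: "smul a F + smul b F = smul (a + b) F"
  by (simp add: fun_eq_iff algebra_simps)

lemma dform_kform_powc_eqI:
  assumes cs: "c\<^sup>2 + s\<^sup>2 = 1" and t: "t \<in> torsion_space" "t' \<in> torsion_space"
    and eq: "slice 3 (cN (powc c s)) (trI (Nten t)) = slice 3 (cN (powc c s)) (trI (Nten t'))"
      "VT (pvn c s) (powc c s) t = VT (pvn c s) (powc c s) t'"
      "VT (pvv c s) (powc c s) t = VT (pvv c s) (powc c s) t'"
      "slice 3 (cN (powc c s)) (stf (Nten t)) = slice 3 (cN (powc c s)) (stf (Nten t'))"
  shows "dform (kform (powc c s)) 3 t = dform (kform (powc c s)) 3 t'"
proof -
  let ?x = "powc c s"
  define u where "u = tadd t (tscale (-1) t')"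
  have u: "u \<in> torsion_space" unfolding u_def by (intro torsion_space_tadd torsion_space_tscale t)
  have sub: "\<Phi> u I J = \<Phi> t I J - \<Phi> t' I J" if "intertw G_SO3 \<Phi>" for \<Phi> I J
    using that unfolding u_def intertw_def by simp
  have "\<Phi> u I J = 0" if "intertw G_SO3 \<Phi>" "\<Phi> t = \<Phi> t'" for \<Phi> I J
    using sub[OF that(1)] that(2) by simp
  note z = this
  have 0: "slice 3 (cN ?x) (trI (Nten u)) I J = 0" "VT (pvn c s) ?x u I J = 0" "VT (pvv c s) ?x u I J = 0"
    "slice 3 (cN ?x) (stf (Nten u)) I J = 0" for I J
    by (rule z[of "\<lambda>t. slice 3 (cN ?x) (trI (Nten t))", OF intertw_SO3[OF intertw_ops(1)[OF intertw_Nten]] eq(1)]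
        z[OF intertw_VT eq(2)] z[OF intertw_VT eq(3)]
        z[of "\<lambda>t. slice 3 (cN ?x) (stf (Nten t))", OF intertw_SO3[OF intertw_stf[OF intertw_Nten]] eq(4)])+
  have "Mx ?x u n m = 0" if "n < 3" "m < 3" for n m
    using Mx_powc_zero[OF cs, of u m n] 0 that by simp
  then have "kerk ?x u" unfolding kerk_iff[OF u] sym_N_zero_iff[OF u] using 0 by blast
  then have "dform (kform ?x) 3 u L = 0" for L by (simp add: kerk_def)
  then show ?thesis by (simp add: u_def dform_tadd dform_tscale fun_eq_iff)
qed

text \<open>Each eta derivative can be varied while the other two stay zero, so the joint image is
  the product of the three images. The dual vectors turn the components seen by \<open>eta j\<close>
  into a torsion the others do not see.\<close>

lemma exists_dual_torsion:
  assumes j: "j < 3" and t: "t \<in> torsion_space"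
  shows "\<exists>u\<in>torsion_space. \<forall>i<3. dform (eta i) 3 u = (if i = j then dform (eta j) 3 t else (\<lambda>_. 0))"
proof -
  define x where "x i = powc (ec i) (es i)" for i
  define F0 F1 F2 F3 where "F0 = slice 3 (cN (x j)) (trI (Nten t))" and "F1 = VT (pvn (ec j) (es j)) (x j) t"
    and "F2 = VT (pvv (ec j) (es j)) (x j) t" and "F3 = slice 3 (cN (x j)) (stf (Nten t))"
  have F: "irr (0, 0) F0" "irr (1, 0) F1" "irr (1, 0) F2" "irr (2, 0) F3"
    unfolding F0_def F1_def F2_def F3_def by (simp_all only: irr_slice_N[OF t] irr_VT)
  obtain u where u: "u \<in> torsion_space" "trI (Nten u) = prodT 3 F0 (dY j)"
    "Qten u = prodT 1 F1 (dBn j) + prodT 1 F2 (dBv j)" "crI (Nten u) = prodT 3 F1 (dAn j) + prodT 3 F2 dAv"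
    "stf (Nten u) = prodT 3 F3 (dY j)"
    using exists_torsion_irr[OF irr_prodT[OF F(1)] irr_add[OF irr_prodT[OF F(2)] irr_prodT[OF F(3)]]
      irr_add[OF irr_prodT[OF F(2)] irr_prodT[OF F(3)]] irr_prodT[OF F(4)]] by blast
  have swp: "(A + B) + (C + D) = (A + C) + (B + D)" for A B C D :: tensor
    by (simp add: fun_eq_iff)
  have val: "slice 3 (cN (x i)) (trI (Nten u)) = smul (of_bool (i = j)) F0"
    "VT (pvn (ec i) (es i)) (x i) u = smul (of_bool (i = j)) F1 + smul 0 F2"
    "VT (pvv (ec i) (es i)) (x i) u = smul 0 F1 + smul (of_bool (i = j)) F2"
    "slice 3 (cN (x i)) (stf (Nten u)) = smul (of_bool (i = j)) F3" if i: "i < 3" for i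
  proof -
    note r = u(2-5) VT_def slice_add slice_prodT[OF F(1)] slice_prodT[OF F(2)] slice_prodT[OF F(3)] slice_prodT[OF F(4)] x_def
    show "slice 3 (cN (x i)) (trI (Nten u)) = smul (of_bool (i = j)) F0"
      "slice 3 (cN (x i)) (stf (Nten u)) = smul (of_bool (i = j)) F3"
      unfolding r dual_pairing[OF i j] by (rule refl)+
    show "VT (pvn (ec i) (es i)) (x i) u = smul (of_bool (i = j)) F1 + smul 0 F2"
      "VT (pvv (ec i) (es i)) (x i) u = smul 0 F1 + smul (of_bool (i = j)) F2"
      unfolding r by (subst swp, simp only: smul_add dual_pairing[OF i j])+
  qed
  have z: "smul 0 F + G = G" "G + smul 0 F = G" "smul 1 F = F" for F G
    by (simp_all add: fun_eq_iff)
  have zero: "\<Phi> (tscale 0 t) = smul 0 (\<Phi> t)" if "intertw G_SO3 \<Phi>" for \<Phi>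
    using that unfolding intertw_def by blast
  have "dform (eta i) 3 u = (if i = j then dform (eta j) 3 t else (\<lambda>_. 0))" if i: "i < 3" for i
  proof (cases "i = j")
    case True
    have "dform (kform (x j)) 3 u = dform (kform (x j)) 3 t"
      unfolding x_def
      by (rule dform_kform_powc_eqI[OF ec_es u(1) t])
        (use val[OF j] in \<open>simp_all add: z x_def F0_def F1_def F2_def F3_def\<close>)
    then show ?thesis using True j by (simp add: eta_ec_es x_def)
  next
    case False
    have s0: "smul 0 F = smul 0 G" for F G by (simp add: fun_eq_iff)
    \<comment> \<open>\<open>tscale 0 t\<close> serves as the zero torsion, so that the comparison
      lemma also covers the forms with i different from j.\<close>
    have "dform (kform (x i)) 3 u = dform (kform (x i)) 3 (tscale 0 t)"
      unfolding x_def
    proof (rule dform_kform_powc_eqI[OF ec_es u(1) torsion_space_tscale[OF t]])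
      show "slice 3 (cN (powc (ec i) (es i))) (trI (Nten u)) = slice 3 (cN (powc (ec i) (es i))) (trI (Nten (tscale 0 t)))"
        using val(1)[OF i] False zero[OF intertw_SO3[OF intertw_ops(1)[OF intertw_Nten]]] s0 by (simp add: x_def)
      show "slice 3 (cN (powc (ec i) (es i))) (stf (Nten u)) = slice 3 (cN (powc (ec i) (es i))) (stf (Nten (tscale 0 t)))"
        using val(4)[OF i] False zero[OF intertw_SO3[OF intertw_stf[OF intertw_Nten]]] s0 by (simp add: x_def)
      show "VT (pvn (ec i) (es i)) (powc (ec i) (es i)) u = VT (pvn (ec i) (es i)) (powc (ec i) (es i)) (tscale 0 t)"
        using val(2)[OF i] False zero[OF intertw_VT] s0 by (simp add: x_def z)
      show "VT (pvv (ec i) (es i)) (powc (ec i) (es i)) u = VT (pvv (ec i) (es i)) (powc (ec i) (es i)) (tscale 0 t)"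
        using val(3)[OF i] False zero[OF intertw_VT] s0 by (simp add: x_def z)
    qed
    then show ?thesis using False i by (simp add: eta_ec_es x_def fun_eq_iff dform_tscale)
  qed
  then show ?thesis using u(1) by blast
qed

lemma frank_eta:
  "frank (\<lambda>t (i, L). if i < 3 then dform (eta i) 3 t L else 0)
     = frank (dform (eta 0) 3) + frank (dform (eta 1) 3) + frank (dform (eta 2) 3)"
proof -
  let ?V = "\<lambda>i. dform (eta i) 3 ` torsion_space"
  let ?f = "\<lambda>t (i, L). if i < (3::nat) then dform (eta i) 3 t L else 0"
  have z0: "(\<lambda>_ _ _. 0) \<in> torsion_space" by (simp add: torsion_space_def)
  have "?f ` torsion_space = {\<lambda>(i, x). if i < 3 then f i x else 0 | f. \<forall>i<3. f i \<in> ?V i}" (is "_ = ?W")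
  proof
    show "?f ` torsion_space \<subseteq> ?W"
    proof
      fix w assume "w \<in> ?f ` torsion_space"
      then obtain t where "t \<in> torsion_space" "w = ?f t" by blast
      then show "w \<in> ?W"
        unfolding mem_Collect_eq by (intro exI[of _ "\<lambda>i. dform (eta i) 3 t"]) auto
    qed
    show "?W \<subseteq> ?f ` torsion_space"
    proof
      fix w assume "w \<in> ?W"
      then obtain f where f: "\<forall>i<3. f i \<in> ?V i" "w = (\<lambda>(i, x). if i < 3 then f i x else 0)" by blast
      have "\<exists>u\<in>torsion_space. \<forall>i<3. dform (eta i) 3 u = (if i = j then f j else (\<lambda>_. 0))" if j: "j < 3" for j
      proof -
        obtain t where t: "t \<in> torsion_space" and fj: "f j = dform (eta j) 3 t" using f(1) j by blast
        show ?thesis unfolding fj by (rule exists_dual_torsion[OF j t])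
      qed
      then have "\<exists>u. j < 3 \<longrightarrow> u \<in> torsion_space \<and> (\<forall>i<3. dform (eta i) 3 u = (if i = j then f j else (\<lambda>_. 0)))" for j
        by blast
      then obtain u where u: "\<And>j. j < 3 \<Longrightarrow> u j \<in> torsion_space"
        "\<And>i j. j < 3 \<Longrightarrow> i < 3 \<Longrightarrow> dform (eta i) 3 (u j) = (if i = j then f j else (\<lambda>_. 0))"
        by metis
      define t where "t = tadd (tadd (u 0) (u 1)) (u 2)"
      have t: "t \<in> torsion_space" unfolding t_def by (intro torsion_space_tadd u) simp_all
      have "dform (eta i) 3 t L = f i L" if "i < 3" for i L
      proof -
        have "i \<in> {0, 1, 2}" using that by auto
        then show ?thesis using u(2)[OF _ that, of 0] u(2)[OF _ that, of 1] u(2)[OF _ that, of 2]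
          unfolding t_def dform_tadd by auto
      qed
      then have "w = ?f t" by (auto simp: f(2) fun_eq_iff)
      then show "w \<in> ?f ` torsion_space" using t by blast
    qed
  qed
  then have "frank ?f = vector_space.dim fscale ?W" by (simp add: frank_def)
  also have "\<dots> = (\<Sum>i<3. vector_space.dim fscale (?V i))"
  proof (rule dim_direct_sum)
    show "(\<lambda>_. 0) \<in> ?V i" for i
      by (rule image_eqI[OF _ z0]) (simp add: dform_def fun_eq_iff)
    show "finite {L :: nat list. set L \<subseteq> {..<6} \<and> length L = 4}"
      by (rule finite_lists_length_eq) simp
    show "v L = 0" if "v \<in> ?V i" "L \<notin> {L. set L \<subseteq> {..<6} \<and> length L = 4}" for i v L
    proof -
      have "\<not> (length L = Suc 3 \<and> set L \<subseteq> {..<6})" using that(2) by auto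
      then have "dform (eta i) 3 t L = 0" for t unfolding dform_def by (rule if_not_P)
      then show ?thesis using that(1) by auto
    qed
  qed
  also have "\<dots> = frank (dform (eta 0) 3) + frank (dform (eta 1) 3) + frank (dform (eta 2) 3)"
    by (simp add: frank_def eval_nat_numeral)
  finally show ?thesis .
qed

subsection \<open>The module determined by sigma\<close>

definition Wten :: "torsion \<Rightarrow> tensor" where
  "Wten t = low t + rotI (rotJ (low t)) + rotI (rotI (rotJ (rotJ (low t))))"

text \<open>The B^1 part of d sigma has mixed symmetry in V, an 8-dimensional module isomorphic to
  traceless 3 by 3 matrices. \<open>Hten\<close> is this matrix; its symmetric part gives A^4 and
  the remaining V is read off by \<open>Vten\<close>.\<close>

definition Hten :: "torsion \<Rightarrow> tensor" where
  "Hten t = crI (rotI (epJ (Wten t)))"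

definition Vten :: "torsion \<Rightarrow> tensor" where
  "Vten t = trI (epJ (Wten t))"

lemma Wten_apply: "Wten t [i, j, k] [a, b, c] = low t [i, j, k] [a, b, c] + low t [j, k, i] [b, c, a] + low t [k, i, j] [c, a, b]"
  by (simp add: Wten_def rotI_def rotJ_def)

lemma supp_Wten: "supp 3 3 (Wten t)"
  unfolding Wten_def by (intro supp_add supp_rotI supp_rotJ supp_low)

lemma intertw_Wten: "intertw G_SO3_SL2 Wten"
  unfolding Wten_def by (intro intertw_ops intertw_low)

lemma low_swap:
  assumes "t \<in> torsion_space"
  shows "low t [j, i, k] [b, a, c] = - low t [i, j, k] [a, b, c]"
  using torsion_swap[OF assms, of "2*j+b" "2*i+a"] by (simp add: low_def)

lemma sigma_sum:
  assumes "k < 3" "c < 2"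
  shows "(\<Sum>v<6. f v * sigma [v, 2*k+c]) = (if c = 0 then - f (2*k+1) else f (2*k))"
proof -
  have "\<forall>k<3. \<forall>c<2. (\<Sum>v<6. f v * sigma [v, 2*k+c]) = (if c = 0 then - f (2*k+1) else f (2*k))"
    unfolding sum_lt_6_expand by (simp add: all_lt_3 all_lt_2 sigma_def sum_lt_3)
  then show ?thesis using assms by blast
qed

lemma dform_sigma:
  assumes t: "t \<in> torsion_space" and lt: "i < 3" "j < 3" "k < 3" "a < 2" "b < 2" "c < 2"
  shows "dform sigma 2 t [2*i+a, 2*j+b, 2*k+c] = Wten t [i, j, k] [a, b, c]"
proof -
  have 1: "(\<Sum>v<6. t (2*i+a) (2*j+b) v * sigma [v, 2*k+c]) = - low t [i, j, k] [a, b, c]"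
    if "i < 3" "j < 3" "k < 3" "a < 2" "b < 2" "c < 2" for i j k a b c
    using that by (auto simp: sigma_sum low_def)
  have "dform sigma 2 t [2*i+a, 2*j+b, 2*k+c]
    = low t [i, j, k] [a, b, c] - low t [i, k, j] [a, c, b] + low t [j, k, i] [b, c, a]"
    using lt by (simp add: dform_2 1 del: One_nat_def)
  then show ?thesis using low_swap[OF t, of k i j c a b] by (simp add: Wten_apply)
qed

lemma kerd_sigma: "t \<in> kerd sigma 2 \<longleftrightarrow> t \<in> torsion_space \<and> (\<forall>I J. Wten t I J = 0)"
proof -
  have "dform sigma 2 t = (\<lambda>_. 0) \<longleftrightarrow> (\<forall>I J. Wten t I J = 0)" if t: "t \<in> torsion_space"
  proof
    assume L: "dform sigma 2 t = (\<lambda>_. 0)"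
    have "Wten t I J = 0" for I J
    proof (cases "I \<in> idx_lists 3 3 \<and> J \<in> idx_lists 2 3")
      case True
      then obtain i j k a b c where IJ: "I = [i, j, k]" "J = [a, b, c]"
        and lt: "i < 3" "j < 3" "k < 3" "a < 2" "b < 2" "c < 2"
        by (auto simp: idx_lists_def numeral_3_eq_3 length_Suc_conv)
      show ?thesis using dform_sigma[OF t lt] L by (simp add: IJ)
    next
      case False
      then show ?thesis using supp_Wten[of t] unfolding supp_def by blast
    qed
    then show "\<forall>I J. Wten t I J = 0" by blast
  next
    assume R: "\<forall>I J. Wten t I J = 0"
    show "dform sigma 2 t = (\<lambda>_. 0)"
    proof
      fix L
      show "dform sigma 2 t L = 0"
      proof (cases "length L = Suc 2 \<and> set L \<subseteq> {..<6}")
        case True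
        then obtain x y z where L: "L = [x, y, z]" "x < 6" "y < 6" "z < 6"
          by (auto simp: length_Suc_conv numeral_eq_Suc)
        have "L = [2*(x div 2)+(x mod 2), 2*(y div 2)+(y mod 2), 2*(z div 2)+(z mod 2)]" by (simp add: L(1))
        moreover have "x div 2 < 3" "y div 2 < 3" "z div 2 < 3" using L by auto
        ultimately show ?thesis
          using dform_sigma[OF t, of "x div 2" "y div 2" "z div 2" "x mod 2" "y mod 2" "z mod 2"] R by simp
      next
        case False
        then show ?thesis unfolding dform_def by (rule if_not_P)
      qed
    qed
  qed
  then show ?thesis by (auto simp: kerd_def)
qed

text \<open>Of the 20 components of a 3-form on six indices, 12 contain a full plane and 8 take one
  index from each plane.\<close>

lemma alternating3_zero:
  fixes f :: "nat \<Rightarrow> nat \<Rightarrow> nat \<Rightarrow> real"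
  assumes s1: "\<And>x y z. f y x z = - f x y z" and s2: "\<And>x y z. f x z y = - f x y z"
    and z: "\<And>m p a. m < 3 \<Longrightarrow> p < 3 \<Longrightarrow> m \<noteq> p \<Longrightarrow> a < 2 \<Longrightarrow> f (2*m) (2*m+1) (2*p+a) = 0"
      "\<And>a b c. a < 2 \<Longrightarrow> b < 2 \<Longrightarrow> c < 2 \<Longrightarrow> f a (2+b) (4+c) = 0"
    and lt: "x < 6" "y < 6" "z < 6"
  shows "f x y z = 0"
proof -
  have d: "f x x z = 0" "f x y y = 0" for x y z
    using s1[of x x z] s2[of x y y] by linarith+
  have zz: "f 0 1 2 = 0" "f 0 1 3 = 0" "f 0 1 4 = 0" "f 0 1 5 = 0" "f 2 3 0 = 0" "f 2 3 1 = 0" "f 2 3 4 = 0" "f 2 3 5 = 0"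
    "f 4 5 0 = 0" "f 4 5 1 = 0" "f 4 5 2 = 0" "f 4 5 3 = 0"
    "f 0 2 4 = 0" "f 0 2 5 = 0" "f 0 3 4 = 0" "f 0 3 5 = 0" "f 1 2 4 = 0" "f 1 2 5 = 0" "f 1 3 4 = 0" "f 1 3 5 = 0"
    using z(1)[of 0 1 0] z(1)[of 0 1 1] z(1)[of 0 2 0] z(1)[of 0 2 1] z(1)[of 1 0 0] z(1)[of 1 0 1] z(1)[of 1 2 0] z(1)[of 1 2 1]
      z(1)[of 2 0 0] z(1)[of 2 0 1] z(1)[of 2 1 0] z(1)[of 2 1 1]
      z(2)[of 0 0 0] z(2)[of 0 0 1] z(2)[of 0 1 0] z(2)[of 0 1 1] z(2)[of 1 0 0] z(2)[of 1 0 1] z(2)[of 1 1 0] z(2)[of 1 1 1]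
    by simp_all
  have zz2: "f 0 2 3 = 0" "f 1 2 3 = 0" "f 0 4 5 = 0" "f 1 4 5 = 0" "f 2 4 5 = 0" "f 3 4 5 = 0"
    by (simp_all del: One_nat_def add: zz s1[of 0 2 3] s2[of 2 0 3] s1[of 1 2 3] s2[of 2 1 3] s1[of 0 4 5] s2[of 4 0 5]
      s1[of 1 4 5] s2[of 4 1 5] s1[of 2 4 5] s2[of 4 2 5] s1[of 3 4 5] s2[of 4 3 5])
  have "\<forall>z<6. \<forall>y<z. \<forall>x<y. f x y z = 0"
    using zz zz2 by (simp add: All_less_Suc eval_nat_numeral)
  then have sorted: "f x y z = 0" if "x < y" "y < z" "z < 6" for x y z using that by blast
  have 2: "f x y z = 0" if "x < y" "y < 6" "z < 6" for x y z
  proof (cases z x rule: linorder_cases)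
    case less
    then show ?thesis using sorted[of z x y] that s1[of z x y] s2[of x z y] by simp
  next
    case equal
    then show ?thesis using d(1)[of x y] s2[of x x y] by simp
  next
    case greater
    then show ?thesis using sorted[of x z y] sorted[of x y z] that d(2)[of x y] s2[of x z y]
      by (cases z y rule: linorder_cases) auto
  qed
  show ?thesis using 2[of x y z] 2[of y x z] d(1)[of x z] s1[of x y z] lt
    by (cases x y rule: linorder_cases) auto
qed

lemma Wten_swap:
  assumes t: "t \<in> torsion_space"
  shows "Wten t [j, i, k] [b, a, c] = - Wten t [i, j, k] [a, b, c]" "Wten t [j, k, i] [b, c, a] = Wten t [i, j, k] [a, b, c]"
  using low_swap[OF t, of j i k b a c] low_swap[OF t, of i k j a c b] low_swap[OF t, of k j i c b a]
  by (simp_all add: Wten_apply)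

lemma epW_sym: "t \<in> torsion_space \<Longrightarrow> epJ (Wten t) [j, i, k] J = epJ (Wten t) [i, j, k] J"
proof (cases "\<exists>c. J = [c]")
  case True
  assume t: "t \<in> torsion_space"
  obtain c where "J = [c]" using True by blast
  then show ?thesis
    using Wten_swap(1)[OF t, of j i k 0 1 c] Wten_swap(1)[OF t, of j i k 1 0 c] by (simp add: epJ_def)
next
  case False
  then have "Suc (Suc (length J)) \<noteq> 3" by (cases J) auto
  then have "Wten t I (a # b # J) = 0" for I a b
    using supp_Wten[of t] by (auto simp: supp_def idx_lists_def)
  then show ?thesis by (simp add: epJ_def)
qed

text \<open>This is the overlap of d sigma with the derivatives of the 3-forms: the \<Lambda>^3V
  \<otimes> S^3R^2 part of d sigma is the trace of \<open>Nten\<close>, the same B^3.\<close>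

lemma trN_W:
  assumes t: "t \<in> torsion_space" and "a < 2" "b < 2" "c < 2"
  shows "trI (Nten t) [] [a, b, c] = 2 * (Wten t [0,1,2] [a, b, c] + Wten t [0,1,2] [b, c, a] + Wten t [0,1,2] [c, a, b])"
proof -
  have *: "crlow t [m, m] [a, b, c] = low t [p, q, m] [a, b, c] + low t [p, q, m] [b, a, c]"
    if "(m, p, q) \<in> cyc3" for m p q a b c
    using that low_swap[OF t, of q p m a b c] unfolding cyc3_def
    by (elim insertE emptyE) (simp_all add: crlow_def crI_def sum_lt_3 eps3_values[simplified])
  have "\<forall>a<2. \<forall>b<2. \<forall>c<2. trI (Nten t) [] [a, b, c]
      = 2 * (Wten t [0,1,2] [a, b, c] + Wten t [0,1,2] [b, c, a] + Wten t [0,1,2] [c, a, b])"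
    by (simp add: all_lt_2 trI_def sum_lt_3 Nten_def rotJ_def *[of 0 1 2, simplified cyc3_def, simplified]
      *[of 1 2 0, simplified cyc3_def, simplified] *[of 2 0 1, simplified cyc3_def, simplified] Wten_apply)
  then show ?thesis using assms(2-4) by blast
qed

lemmas expand_W = Wten_def Vten_def Hten_def trI_def crI_def rotI_def rotJ_def epJ_def sum_lt_3 eps3_values[simplified] low_def

lemma W_table:
  assumes t: "t \<in> torsion_space" and mpq: "(m, p, q) \<in> cyc3" and "c < 2"
  shows "Wten t [m, m, p] [0, 1, c] = Vten t [p] [c] / 4 - (Hten t [m, q] [c] + Hten t [q, m] [c]) / 6"
    "Wten t [m, m, q] [0, 1, c] = Vten t [q] [c] / 4 + (Hten t [m, p] [c] + Hten t [p, m] [c]) / 6"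
proof -
  have c: "c \<in> {0, 1}" using assms(3) by auto
  show "Wten t [m, m, p] [0, 1, c] = Vten t [p] [c] / 4 - (Hten t [m, q] [c] + Hten t [q, m] [c]) / 6"
    "Wten t [m, m, q] [0, 1, c] = Vten t [q] [c] / 4 + (Hten t [m, p] [c] + Hten t [p, m] [c]) / 6"
    using mpq c unfolding cyc3_def
    by (elim insertE emptyE; simp add: expand_W torsion_antisym[OF t] torsion_diag[OF t] num_simps; simp add: field_simps)+
qed

text \<open>Permuting the R^2-indices and averaging leaves the B^3 part; the deviations are diagonal
  entries of \<open>Hten\<close>, which add up to zero.\<close>

lemma W_table_012:
  assumes t: "t \<in> torsion_space"
  shows "Wten t [0,1,2] [0,0,0] = trI (Nten t) [] [0,0,0] / 6"
    "Wten t [0,1,2] [0,0,1] = trI (Nten t) [] [0,0,1] / 6 + Hten t [2,2] [0] / 3"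
    "Wten t [0,1,2] [0,1,0] = trI (Nten t) [] [0,0,1] / 6 + Hten t [1,1] [0] / 3"
    "Wten t [0,1,2] [1,0,0] = trI (Nten t) [] [0,0,1] / 6 + Hten t [0,0] [0] / 3"
    "Wten t [0,1,2] [0,1,1] = trI (Nten t) [] [0,1,1] / 6 - Hten t [0,0] [1] / 3"
    "Wten t [0,1,2] [1,0,1] = trI (Nten t) [] [0,1,1] / 6 - Hten t [1,1] [1] / 3"
    "Wten t [0,1,2] [1,1,0] = trI (Nten t) [] [0,1,1] / 6 - Hten t [2,2] [1] / 3"
    "Wten t [0,1,2] [1,1,1] = trI (Nten t) [] [1,1,1] / 6"
proof -
  have l: "(0::nat) < 2" "(1::nat) < 2" by simp_all
  note T = trN_W[OF t l(1) l(1) l(1)] trN_W[OF t l(1) l(1) l(2)] trN_W[OF t l(1) l(2) l(2)] trN_W[OF t l(2) l(2) l(2)]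
  show "Wten t [0,1,2] [0,0,0] = trI (Nten t) [] [0,0,0] / 6"
    "Wten t [0,1,2] [0,0,1] = trI (Nten t) [] [0,0,1] / 6 + Hten t [2,2] [0] / 3"
    "Wten t [0,1,2] [0,1,0] = trI (Nten t) [] [0,0,1] / 6 + Hten t [1,1] [0] / 3"
    "Wten t [0,1,2] [1,0,0] = trI (Nten t) [] [0,0,1] / 6 + Hten t [0,0] [0] / 3"
    "Wten t [0,1,2] [0,1,1] = trI (Nten t) [] [0,1,1] / 6 - Hten t [0,0] [1] / 3"
    "Wten t [0,1,2] [1,0,1] = trI (Nten t) [] [0,1,1] / 6 - Hten t [1,1] [1] / 3"
    "Wten t [0,1,2] [1,1,0] = trI (Nten t) [] [0,1,1] / 6 - Hten t [2,2] [1] / 3"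
    "Wten t [0,1,2] [1,1,1] = trI (Nten t) [] [1,1,1] / 6"
    unfolding T
    by (simp add: expand_W torsion_antisym[OF t] torsion_diag[OF t] num_simps, (simp add: field_simps)?)+
qed

lemma W_zero:
  assumes t: "t \<in> torsion_space" and z: "\<And>I J. trI (Nten t) I J = 0" "\<And>I J. Vten t I J = 0"
    "\<And>I J. Hten t I J + rotI (Hten t) I J = 0"
  shows "Wten t I J = 0"
proof (cases "I \<in> idx_lists 3 3 \<and> J \<in> idx_lists 2 3")
  case True
  then obtain i j k a b c where IJ: "I = [i, j, k]" "J = [a, b, c]"
    and lt: "i < 3" "j < 3" "k < 3" "a < 2" "b < 2" "c < 2"
    by (auto simp: idx_lists_def numeral_3_eq_3 length_Suc_conv)
  define f where "f x y z = Wten t [x div 2, y div 2, z div 2] [x mod 2, y mod 2, z mod 2]" for x y z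
  have H: "Hten t [p, q] K + Hten t [q, p] K = 0" for p q K
    using z(3)[of "[p, q]" K] by (simp add: rotI_pair)
  have H2: "Hten t [p, p] K = 0" for p K using H[of p p K] by simp
  have W012: "\<forall>a<2. \<forall>b<2. \<forall>c<2. Wten t [0,1,2] [a, b, c] = 0"
    using W_table_012[OF t] by (simp add: all_lt_2 z H2)
  have Wmp: "\<forall>m<3. \<forall>p<3. m \<noteq> p \<longrightarrow> Wten t [m, m, p] [0, 1, a] = 0" if "a < 2" for a
    using W_table[OF t _ that, of 0 1 2] W_table[OF t _ that, of 1 2 0] W_table[OF t _ that, of 2 0 1]
    by (simp add: all_lt_3 cyc3_def z H)
  have "f (2*i+a) (2*j+b) (2*k+c) = 0"
  proof (rule alternating3_zero)
    fix x y z
    show "f y x z = - f x y z" unfolding f_def by (rule Wten_swap(1)[OF t])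
    show "f x z y = - f x y z"
      unfolding f_def
      using Wten_swap(2)[OF t, of "x div 2" "z div 2" "y div 2" "x mod 2" "z mod 2" "y mod 2"]
        Wten_swap(1)[OF t, of "y div 2" "x div 2" "z div 2" "y mod 2" "x mod 2" "z mod 2"] by simp
  next
    fix m p a :: nat assume "m < 3" "p < 3" "m \<noteq> p" "a < 2"
    then show "f (2*m) (2*m+1) (2*p+a) = 0" using Wmp by (simp add: f_def)
  next
    fix a b c :: nat assume lt: "a < 2" "b < 2" "c < 2"
    then have "c = 0 \<or> c = 1" by auto
    then have "(4 + c) div 2 = 2" "(4 + c) mod 2 = c" by auto
    then show "f a (2+b) (4+c) = 0" using W012 lt by (simp add: f_def)
  qed (use lt in auto)
  then show ?thesis using lt by (simp add: f_def IJ)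
next
  case False
  then show ?thesis using supp_Wten[of t] unfolding supp_def by blast
qed

context sect_data
begin

lemma epW_sect:
  assumes "i < 3" "j < 3" "k < 3" "c < 2"
  shows "epJ (Wten (sect A S)) [i, j, k] [c] = 2 * S [i, j, k] [c] - S [j, k, i] [c] - S [k, i, j] [c]"
proof -
  have s: "A I [0, Suc 0, 0] = A I [0, 0, Suc 0]" "A I [Suc 0, 0, 0] = A I [0, 0, Suc 0]"
    "A I [Suc 0, 0, Suc 0] = A I [0, Suc 0, Suc 0]" "A I [Suc 0, Suc 0, 0] = A I [0, Suc 0, Suc 0]" for I
    using symlist_J3[OF symA[of I]] by simp_all
  have "c = 0 \<or> c = 1" using assms by auto
  then show ?thesis
    using assms unfolding epJ_def Wten_apply low_sect
    by (elim disjE) (simp_all add: sectT_def eps2_def s)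
qed

end

lemma irr_zero: "irr s (\<lambda>I J. 0)"
  by (simp add: irr_def supp_def trI_def)

text \<open>A right inverse for \<open>Vten\<close> and the symmetric part of \<open>Hten\<close>.
  In 2 S - S - S over the cyclic shifts the identity matrix has trace 2 * 3 - 2 = 4. The second term
  has cyclic sum zero, so the combination triples it; contracting with \<open>eps3\<close> then
  yields \<open>Hten = F2 / 2\<close>, which fixes 18.\<close>

definition Ssig :: "tensor \<Rightarrow> tensor \<Rightarrow> tensor" where
  "Ssig F1 F2 = (\<lambda>I J. case I of [i, j, k] \<Rightarrow> if i < 3 \<and> j < 3 \<and> k < 3
     then (if i = j then F1 [k] J / 4 else 0) - (\<Sum>l<3. eps3 i k l * F2 [l, j] J + eps3 j k l * F2 [l, i] J) / 18
     else 0 | _ \<Rightarrow> 0)"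

lemma supp_epW: "supp 3 1 (epJ (Wten t))"
  using supp_epJ[of 3 1 "Wten t"] supp_Wten[of t] by (simp add: eval_nat_numeral)

lemma supp_Vten: "supp 1 1 (Vten t)"
  unfolding Vten_def using supp_trI[of 1 1 "epJ (Wten t)"] supp_epW[of t] by (simp add: eval_nat_numeral)

lemma supp_Hten: "supp 2 1 (Hten t)"
  unfolding Hten_def using supp_crI[of 1 1 "rotI (epJ (Wten t))"] supp_rotI[OF supp_epW[of t]] by (simp add: eval_nat_numeral)

lemma irr_Hten:
  assumes t: "t \<in> torsion_space"
  shows "irr (2, 1) (Hten t + rotI (Hten t))"
proof (rule irrI)
  show "supp 2 1 (Hten t + rotI (Hten t))" by (intro supp_add supp_rotI supp_Hten)
  show "symlist 3 2 (\<lambda>I. (Hten t + rotI (Hten t)) I J)" for J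
    by (simp add: symlist_def rotI_pair)
  show "symlist 2 1 ((Hten t + rotI (Hten t)) I)" for I by (simp add: symlist_lt2)
  \<comment> \<open>The trace contracts \<open>eps3\<close> with a pair of indices in which
    \<open>epJ (Wten t)\<close> is symmetric.\<close>
  show "trI (Hten t + rotI (Hten t)) [] J = 0" for J
    using epW_sym[OF t, of 1 0] epW_sym[OF t, of 2 0] epW_sym[OF t, of 2 1]
    by (simp add: trI_def sum_lt_3 rotI_pair Hten_def crI_def eps3_values[simplified] rotI_def)
qed simp_all

lemma exists_torsion_sigma:
  assumes F: "irr (0, 3) F0" "irr (1, 1) F1" "irr (2, 1) F2"
  shows "\<exists>t\<in>torsion_space. trI (Nten t) = F0 \<and> Vten t = F1 \<and> Hten t + rotI (Hten t) = F2"
proof -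
  let ?A = "Nof F0 (\<lambda>I J. 0) (\<lambda>I J. 0)"
  define S where "S = Ssig F1 F2"
  note N = Nof_props[OF F(1) irr_zero irr_zero]
  note supp = F[THEN irr_supp]
  have z: "F1 I J = 0" "F2 I J = 0" if "J \<notin> idx_lists 2 1" for I J
    using supp that unfolding supp_def by blast+
  interpret sect_data ?A S
  proof
    show "supp 2 3 ?A" by (rule N(1))
    show "symlist 2 3 (?A I)" for I
      by (rule symlist_Nof) (use irr_symJ[OF F(1)] in \<open>auto simp: symlist_def\<close>)
    show "supp 3 1 S"
      unfolding supp_def S_def Ssig_def using z by (auto simp: idx_lists_def split: list.split)
    show "S [j, i, k] J = S [i, j, k] J" for i j k J
      by (auto simp: S_def Ssig_def add.commute)
  qed
  let ?t = "sect ?A S"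
  have e: "F2 [Suc 0, 0] J = F2 [0, Suc 0] J" "F2 [2, 0] J = F2 [0, 2] J" "F2 [2, Suc 0] J = F2 [Suc 0, 2] J" for J
    using irr_symI[OF F(3)] by blast+
  have tr: "F2 [2, 2] J = - F2 [0, 0] J - F2 [Suc 0, Suc 0] J" for J
    using irr_trace[OF F(3), of "[]" J] by (simp add: trI_def sum_lt_3)
  have V: "\<forall>k<3. Vten ?t [k] [c] = F1 [k] [c]" if "c < 2" for c
    using that by (simp add: all_lt_3 Vten_def trI_def sum_lt_3 epW_sect)
      (simp add: S_def Ssig_def sum_lt_3 eps3_values[simplified] e tr field_simps)
  have H: "\<forall>i<3. \<forall>j<3. (Hten ?t + rotI (Hten ?t)) [i, j] [c] = F2 [i, j] [c]" if "c < 2" for c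
    using that by (simp add: all_lt_3 rotI_pair Hten_def crI_def sum_lt_3 eps3_values[simplified] rotI_def epW_sect)
      (simp add: S_def Ssig_def sum_lt_3 eps3_values[simplified] e tr field_simps)
  have "Vten ?t = F1"
  proof (rule supp_eqI[OF supp_Vten supp(2)])
    fix I J assume "I \<in> idx_lists 3 1" "J \<in> idx_lists 2 1"
    then obtain k c where "I = [k]" "J = [c]" "k < 3" "c < 2" by (auto simp: idx_lists_def length_Suc_conv)
    then show "Vten ?t I J = F1 I J" using V by blast
  qed
  moreover have "Hten ?t + rotI (Hten ?t) = F2"
  proof (rule supp_eqI[OF _ supp(3)])
    show "supp 2 1 (Hten ?t + rotI (Hten ?t))" by (intro supp_add supp_rotI supp_Hten)
    fix I J assume "I \<in> idx_lists 3 2" "J \<in> idx_lists 2 1"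
    then obtain i j c where "I = [i, j]" "J = [c]" "i < 3" "j < 3" "c < 2"
      by (auto simp: idx_lists_def length_Suc_conv numeral_2_eq_2)
    then show "(Hten ?t + rotI (Hten ?t)) I J = F2 I J" using H by blast
  qed
  ultimately show ?thesis using Nten_sect N(2) by (intro bexI[OF _ sect_space]) simp
qed

lemma intertw_sigma:
  "intertw G_SO3_SL2 (\<lambda>t. trI (Nten t))" "intertw G_SO3_SL2 Vten" "intertw G_SO3_SL2 (\<lambda>t. Hten t + rotI (Hten t))"
proof -
  show "intertw G_SO3_SL2 (\<lambda>t. trI (Nten t))" by (intro intertw_ops intertw_Nten)
  show "intertw G_SO3_SL2 Vten" unfolding Vten_def by (intro intertw_ops intertw_Wten)
  have "intertw G_SO3_SL2 Hten" unfolding Hten_def by (intro intertw_ops intertw_Wten)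
  then show "intertw G_SO3_SL2 (\<lambda>t. Hten t + rotI (Hten t))" by (intro intertw_ops)
qed

lemma irr_sigma:
  assumes t: "t \<in> torsion_space"
  shows "irr (0, 3) (trI (Nten t))" "irr (1, 1) (Vten t)" "irr (2, 1) (Hten t + rotI (Hten t))"
proof -
  show "irr (0, 3) (trI (Nten t))"
    by (rule irr_0[OF supp_tr2[OF supp_Nten]]) (simp add: symlist_tr(1)[OF Nten_sym[OF t]])
  show "irr (1, 1) (Vten t)" by (rule irr_1[OF supp_Vten]) simp
  show "irr (2, 1) (Hten t + rotI (Hten t))" by (rule irr_Hten[OF t])
qed

lemma kerd_sigma_iff:
  assumes t: "t \<in> torsion_space"
  shows "t \<in> kerd sigma 2 \<longleftrightarrow> (\<forall>I J. trI (Nten t) I J = 0) \<and> (\<forall>I J. Vten t I J = 0)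
    \<and> (\<forall>I J. (Hten t + rotI (Hten t)) I J = 0)" (is "_ = ?R")
proof
  assume "t \<in> kerd sigma 2"
  then have W: "Wten t I J = 0" for I J unfolding kerd_sigma by blast
  then have P: "epJ (Wten t) I J = 0" for I J by (simp add: epJ_def)
  have "trI (Nten t) I J = 0" for I J
  proof (cases "I = [] \<and> J \<in> idx_lists 2 3")
    case True
    then obtain a b c where "J = [a, b, c]" "a < 2" "b < 2" "c < 2"
      by (auto simp: idx_lists_def numeral_3_eq_3 length_Suc_conv)
    then show ?thesis using trN_W[OF t] W True by simp
  next
    case False
    then show ?thesis using supp_tr2[OF supp_Nten[of t]] by (auto simp: supp_def idx_lists_0)
  qed
  moreover have "Vten t I J = 0" for I J by (simp add: Vten_def trI_def P)
  moreover have "Hten t I J = 0" for I J by (simp add: Hten_def crI_def rotI_def P split: list.split)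
  ultimately show ?R by (simp add: rotI_def)
next
  assume R: ?R
  then have "Wten t I J = 0" for I J by (intro W_zero[OF t]) auto
  then show "t \<in> kerd sigma 2" using t unfolding kerd_sigma by blast
qed

lemma quotient_iso_sigma: "quotient_iso G_SO3_SL2 torsion_space (kerd sigma 2) [(0,3), (1,1), (2,1)]"
proof -
  let ?\<Phi> = "[\<lambda>t. trI (Nten t), Vten, \<lambda>t. Hten t + rotI (Hten t)]"
  let ?S = "[(0,3), (1,1), (2,1)] :: (nat \<times> nat) list"
  have all: "(\<forall>j<length ?S. P j) \<longleftrightarrow> P 0 \<and> P 1 \<and> P 2" for P
    by (simp add: All_less_Suc2 numeral_2_eq_2)
  have tw: "\<forall>j<length ?S. intertw G_SO3_SL2 (?\<Phi> ! j)"
    unfolding all using intertw_sigma by simp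
  have irr: "\<forall>j<length ?S. irr (?S ! j) ((?\<Phi> ! j) t)" if t: "t \<in> torsion_space" for t
    unfolding all using irr_sigma[OF t] by simp
  show ?thesis
  proof (rule quotient_isoI[where \<Phi> = ?\<Phi>], goal_cases)
    case 1 show ?case by simp
  next
    case (2 j) then show ?case using tw by blast
  next
    case (3 j t) then show ?case using irr by blast
  next
    case (4 F)
    have F: "irr (0, 3) (F 0)" "irr (1, 1) (F 1)" "irr (2, 1) (F 2)"
      using 4[of 0] 4[of 1] 4[of 2] by simp_all
    show ?case unfolding all using exists_torsion_sigma[OF F] by simp
  next
    case (5 t)
    show ?case unfolding all using kerd_sigma_iff[OF 5] by simp
  qed
qed

definition dl :: "nat list \<Rightarrow> nat list \<Rightarrow> real" where
  "dl K J = of_bool (J = K)"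

lemma slice_dl: "K \<in> idx_lists 2 n \<Longrightarrow> slice n (dl K) F I [] = F I K"
  by (simp add: slice_def dl_def finite_idx_lists)

lemma slice_dl_zero:
  assumes "supp k n F" "K \<in> idx_lists 2 n"
  shows "(\<forall>I J. slice n (dl K) F I J = 0) \<longleftrightarrow> (\<forall>I. F I K = 0)"
  using slice_dl[OF assms(2), of F] by (metis slice_def)

text \<open>Under SO(3) alone B^q becomes q + 1 trivial copies, so B^3 accounts for four summands R.
  Symmetric tensors are given by their values on nondecreasing words, and each \<open>dl K\<close>
  reads off one of them.\<close>

lemma quotient_iso_sigma_SO3:
  "quotient_iso G_SO3 torsion_space (kerd sigma 2)
     [(0,0), (0,0), (0,0), (0,0), (1,0), (1,0), (2,0), (2,0)]"
proof -
  let ?H = "\<lambda>t. Hten t + rotI (Hten t)"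
  let ?\<Phi> = "[\<lambda>t. slice 3 (dl [0,0,0]) (trI (Nten t)), \<lambda>t. slice 3 (dl [0,0,1]) (trI (Nten t)),
    \<lambda>t. slice 3 (dl [0,1,1]) (trI (Nten t)), \<lambda>t. slice 3 (dl [1,1,1]) (trI (Nten t)),
    \<lambda>t. slice 1 (dl [0]) (Vten t), \<lambda>t. slice 1 (dl [1]) (Vten t),
    \<lambda>t. slice 1 (dl [0]) (?H t), \<lambda>t. slice 1 (dl [1]) (?H t)]"
  let ?S = "[(0,0), (0,0), (0,0), (0,0), (1,0), (1,0), (2,0), (2,0)] :: (nat \<times> nat) list"
  have all: "(\<forall>j<length ?S. P j) \<longleftrightarrow> P 0 \<and> P 1 \<and> P 2 \<and> P 3 \<and> P 4 \<and> P 5 \<and> P 6 \<and> P 7" for P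
    by (simp add: All_less_Suc2 eval_nat_numeral)
  have tw: "\<forall>j<length ?S. intertw G_SO3 (?\<Phi> ! j)"
    unfolding all using intertw_sigma[THEN intertw_SO3] by simp
  have irr: "\<forall>j<length ?S. irr (?S ! j) ((?\<Phi> ! j) t)" if t: "t \<in> torsion_space" for t
    unfolding all using irr_sigma[OF t, THEN irr_slice] by simp
  show ?thesis
  proof (rule quotient_isoI[where \<Phi> = ?\<Phi>], goal_cases)
    case 1 show ?case by simp
  next
    case (2 j) then show ?case using tw by blast
  next
    case (3 j t) then show ?case using irr by blast
  next
    case (4 F)
    have F: "irr (0, 0) (F 0)" "irr (0, 0) (F 1)" "irr (0, 0) (F 2)" "irr (0, 0) (F 3)"
      "irr (1, 0) (F 4)" "irr (1, 0) (F 5)" "irr (2, 0) (F 6)" "irr (2, 0) (F 7)"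
      using 4[of 0] 4[of 1] 4[of 2] 4[of 3] 4[of 4] 4[of 5] 4[of 6] 4[of 7] by simp_all
    let ?d = "\<lambda>(i::nat) k. of_bool (k = i) :: real"
    obtain t where t: "t \<in> torsion_space"
      "trI (Nten t) = prodT 3 (F 0) (?d 0) + prodT 3 (F 1) (?d 1) + prodT 3 (F 2) (?d 2) + prodT 3 (F 3) (?d 3)"
      "Vten t = prodT 1 (F 4) (?d 0) + prodT 1 (F 5) (?d 1)" "?H t = prodT 1 (F 6) (?d 0) + prodT 1 (F 7) (?d 1)"
      using exists_torsion_sigma[OF irr_add[OF irr_add[OF irr_add[OF irr_prodT[OF F(1)] irr_prodT[OF F(2)]] irr_prodT[OF F(3)]] irr_prodT[OF F(4)]]
        irr_add[OF irr_prodT[OF F(5)] irr_prodT[OF F(6)]] irr_add[OF irr_prodT[OF F(7)] irr_prodT[OF F(8)]]] by blast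
    have pair: "(\<Sum>K'\<in>idx_lists 2 n. dl K K' * of_bool (sum_list K' = i)) = of_bool (sum_list K = i)" if "K \<in> idx_lists 2 n" for n K i
      using that by (simp add: dl_def finite_idx_lists)
    have mem: "[0,0,0] \<in> idx_lists 2 3" "[0,0,1] \<in> idx_lists 2 3" "[0,1,1] \<in> idx_lists 2 3" "[1,1,1] \<in> idx_lists 2 3"
      "[0] \<in> idx_lists 2 1" "[1] \<in> idx_lists 2 1" by (simp_all add: idx_lists_def)
    have one: "smul 1 F = F" "smul 0 F = 0" "F + 0 = F" "0 + F = F" for F
      by (simp_all add: fun_eq_iff)
    have d: "?d 0 (sum_list [0,0,0]) = 1" "?d 1 (sum_list [0,0,0]) = 0" "?d 2 (sum_list [0,0,0]) = 0" "?d 3 (sum_list [0,0,0]) = 0"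
      "?d 0 (sum_list [0,0,1]) = 0" "?d 1 (sum_list [0,0,1]) = 1" "?d 2 (sum_list [0,0,1]) = 0" "?d 3 (sum_list [0,0,1]) = 0"
      "?d 0 (sum_list [0,1,1]) = 0" "?d 1 (sum_list [0,1,1]) = 0" "?d 2 (sum_list [0,1,1]) = 1" "?d 3 (sum_list [0,1,1]) = 0"
      "?d 0 (sum_list [1,1,1]) = 0" "?d 1 (sum_list [1,1,1]) = 0" "?d 2 (sum_list [1,1,1]) = 0" "?d 3 (sum_list [1,1,1]) = 1"
      "?d 0 (sum_list [0]) = 1" "?d 1 (sum_list [0]) = 0" "?d 0 (sum_list [1]) = 0" "?d 1 (sum_list [1]) = 1"
      by simp_all
    have "slice 3 (dl [0,0,0]) (trI (Nten t)) = F 0" "slice 3 (dl [0,0,1]) (trI (Nten t)) = F 1"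
      "slice 3 (dl [0,1,1]) (trI (Nten t)) = F 2" "slice 3 (dl [1,1,1]) (trI (Nten t)) = F 3"
      "slice 1 (dl [0]) (Vten t) = F 4" "slice 1 (dl [1]) (Vten t) = F 5"
      "slice 1 (dl [0]) (?H t) = F 6" "slice 1 (dl [1]) (?H t) = F 7"
      unfolding t(2-4) slice_add F[THEN slice_prodT] pair[OF mem(1)] pair[OF mem(2)] pair[OF mem(3)] pair[OF mem(4)]
        pair[OF mem(5)] pair[OF mem(6)] d one by (rule refl)+
    then show ?case unfolding all by (intro bexI[OF _ t(1)]) simp
  next
    case (5 t)
    note irr = irr_sigma[OF 5]
    note supp = irr[THEN irr_supp]
    have mem: "[0,0,0] \<in> idx_lists 2 3" "[0,0,1] \<in> idx_lists 2 3" "[0,1,1] \<in> idx_lists 2 3" "[1,1,1] \<in> idx_lists 2 3"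
      "[0] \<in> idx_lists 2 1" "[1] \<in> idx_lists 2 1" by (simp_all add: idx_lists_def)
    have 3: "(\<forall>I J. trI (Nten t) I J = 0) \<longleftrightarrow> (\<forall>I. trI (Nten t) I [0,0,0] = 0) \<and> (\<forall>I. trI (Nten t) I [0,0,1] = 0)
      \<and> (\<forall>I. trI (Nten t) I [0,1,1] = 0) \<and> (\<forall>I. trI (Nten t) I [1,1,1] = 0)"
      using tensor_J3_zero[OF supp(1) irr_symJ[OF irr(1)]] by blast
    have 1: "(\<forall>I J. F I J = 0) \<longleftrightarrow> (\<forall>I. F I [0] = 0) \<and> (\<forall>I. F I [1] = 0)" if "supp k 1 F" for k F
    proof (intro iffI allI)
      fix I J assume z: "(\<forall>I. F I [0] = 0) \<and> (\<forall>I. F I [1] = 0)"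
      show "F I J = 0"
      proof (cases "J \<in> idx_lists 2 1")
        case True
        then have "J = [0] \<or> J = [1]" by (auto simp: idx_lists_def length_Suc_conv less_2_cases_iff)
        then show ?thesis using z by auto
      next
        case False
        then show ?thesis using that unfolding supp_def by blast
      qed
    qed auto
    have "t \<in> kerd sigma 2 \<longleftrightarrow> ((\<forall>I. trI (Nten t) I [0,0,0] = 0) \<and> (\<forall>I. trI (Nten t) I [0,0,1] = 0)
      \<and> (\<forall>I. trI (Nten t) I [0,1,1] = 0) \<and> (\<forall>I. trI (Nten t) I [1,1,1] = 0)) \<and>
      ((\<forall>I. Vten t I [0] = 0) \<and> (\<forall>I. Vten t I [1] = 0)) \<and> ((\<forall>I. ?H t I [0] = 0) \<and> (\<forall>I. ?H t I [1] = 0))"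
      unfolding kerd_sigma_iff[OF 5] 3 1[OF supp(2)] 1[OF supp(3)] by blast
    then have "t \<in> kerd sigma 2 \<longleftrightarrow> (\<forall>I J. slice 3 (dl [0,0,0]) (trI (Nten t)) I J = 0) \<and> (\<forall>I J. slice 3 (dl [0,0,1]) (trI (Nten t)) I J = 0)
      \<and> (\<forall>I J. slice 3 (dl [0,1,1]) (trI (Nten t)) I J = 0) \<and> (\<forall>I J. slice 3 (dl [1,1,1]) (trI (Nten t)) I J = 0)
      \<and> (\<forall>I J. slice 1 (dl [0]) (Vten t) I J = 0) \<and> (\<forall>I J. slice 1 (dl [1]) (Vten t) I J = 0)
      \<and> (\<forall>I J. slice 1 (dl [0]) (?H t) I J = 0) \<and> (\<forall>I J. slice 1 (dl [1]) (?H t) I J = 0)"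
      unfolding slice_dl_zero[OF supp(1) mem(1)] slice_dl_zero[OF supp(1) mem(2)] slice_dl_zero[OF supp(1) mem(3)]
        slice_dl_zero[OF supp(1) mem(4)] slice_dl_zero[OF supp(2) mem(5)] slice_dl_zero[OF supp(2) mem(6)]
        slice_dl_zero[OF supp(3) mem(5)] slice_dl_zero[OF supp(3) mem(6)] by blast
    then show ?case unfolding all by simp
  qed
qed

subsection \<open>The undetermined component\<close>

text \<open>The S^2V \<otimes> \<Lambda>^2R^2 part of the torsion, complementary to
  \<open>crlow\<close>.\<close>

definition Pten :: "torsion \<Rightarrow> tensor" where
  "Pten t = epJ (low t)"

definition Sten :: "torsion \<Rightarrow> tensor" where
  "Sten t = Pten t + rotI (Pten t) + rotI (rotI (Pten t))"

text \<open>S^2R^2 \<otimes> R^2 = B^3 \<oplus> B^1: \<open>Nten\<close> is the B^3 part of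
  \<open>crlow\<close> and this contraction the B^1 part. Its 18 components match the dimension of
  T^* \<otimes> so(3).\<close>

definition yv :: "torsion \<Rightarrow> nat \<Rightarrow> nat \<Rightarrow> nat \<Rightarrow> real" where
  "yv t k m b = crlow t [k, m] [0, b, 1] - crlow t [k, m] [1, b, 0]"

lemma Sten_apply: "Sten t [i, j, k] J = Pten t [i, j, k] J + Pten t [j, k, i] J + Pten t [k, i, j] J"
  by (simp add: Sten_def rotI_def)

lemma supp_Pten: "supp 3 1 (Pten t)"
  using supp_epJ[of 3 1 "low t"] supp_low[of t] by (simp add: Pten_def eval_nat_numeral)

lemma supp_Sten: "supp 3 1 (Sten t)"
  unfolding Sten_def by (intro supp_add supp_rotI supp_Pten)

lemma intertw_Sten: "intertw G_SO3_SL2 Sten"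
  unfolding Sten_def Pten_def by (intro intertw_ops intertw_low)

lemma Pten_sym: "t \<in> torsion_space \<Longrightarrow> Pten t [j, i, k] [c] = Pten t [i, j, k] [c]"
  using low_swap[of t j i k 0 1 c] low_swap[of t j i k 1 0 c] by (simp add: Pten_def epJ_def)

lemma epW_low:
  assumes t: "t \<in> torsion_space"
  shows "epJ (Wten t) [i, j, k] [c] = Pten t [i, j, k] [c] - (low t [j, k, i] [0, c, 1] - low t [j, k, i] [1, c, 0])
      - (low t [i, k, j] [0, c, 1] - low t [i, k, j] [1, c, 0])"
  using low_swap[OF t, of k i j c 0 1] low_swap[OF t, of k i j c 1 0] by (simp add: epJ_def Wten_apply Pten_def)

text \<open>Both terms on the right are seen by derivatives of invariant forms, so on the common
  kernel \<open>Sten\<close> is traceless and lands in A^6 \<otimes> B^1.\<close>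

lemma trI_Sten:
  assumes t: "t \<in> torsion_space"
  shows "trI (Sten t) [k] [c] = Vten t [k] [c] - 2 * Qten t [k] [c]"
proof -
  define D where "D m = low t [m, k, m] [0, c, 1] - low t [m, k, m] [1, c, 0]" for m
  have "trI (Sten t) [k] [c] = (\<Sum>m<3. Pten t [m, m, k] [c] + 2 * Pten t [k, m, m] [c])"
    unfolding trI_def by (intro sum.cong refl) (simp add: Sten_apply Pten_sym[OF t, of _ k])
  moreover have "Vten t [k] [c] = (\<Sum>m<3. Pten t [m, m, k] [c] - 2 * D m)"
    unfolding Vten_def trI_def D_def by (intro sum.cong refl) (simp add: epW_low[OF t])
  moreover have "Qten t [k] [c] = (\<Sum>m<3. - D m - Pten t [k, m, m] [c])"
  proof -
    have "low t [k, m, m] [c, a, b] = - low t [m, k, m] [a, c, b]" for m a b by (rule low_swap[OF t])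
    then show ?thesis
      by (simp add: Qten_def Rten_def epJ_def rotJ_def rotI_def trI_def D_def Pten_def sum_lt_3)
  qed
  ultimately show ?thesis by (simp add: sum_lt_3)
qed

lemma eps3_yv:
  assumes t: "t \<in> torsion_space" and lt: "i < 3" "k < 3" "c < 2"
  shows "(\<Sum>l<3. eps3 i k l * yv t l j c) = 2 * (low t [i, k, j] [0, c, 1] - low t [i, k, j] [1, c, 0]) - Pten t [i, k, j] [c]"
proof -
  have "\<forall>i<3. \<forall>k<3. (\<Sum>l<3. eps3 i k l * crlow t [l, j] J) = low t [i, k, j] J - low t [k, i, j] J" for J
    by (simp add: all_lt_3 crlow_def crI_def sum_lt_3 eps3_values[simplified])
  then have "(\<Sum>l<3. eps3 i k l * crlow t [l, j] [a, b, c]) = low t [i, k, j] [a, b, c] + low t [i, k, j] [b, a, c]" for a b c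
    using lt low_swap[OF t, of k i j a b c] by simp
  then have "(\<Sum>l<3. eps3 i k l * yv t l j c) = low t [i, k, j] [0, c, 1] + low t [i, k, j] [c, 0, 1]
      - low t [i, k, j] [1, c, 0] - low t [i, k, j] [c, 1, 0]"
    by (simp add: yv_def right_diff_distrib sum_subtractf)
  moreover have "c = 0 \<or> c = 1" using lt by auto
  ultimately show ?thesis by (auto simp: Pten_def epJ_def)
qed

text \<open>Three times \<open>Pten\<close> minus its cyclic sum is the mixed-symmetry part of S^2V
  \<otimes> V; d sigma ties that part to \<open>yv\<close>.\<close>

lemma Pten_decomp:
  assumes t: "t \<in> torsion_space" and lt: "i < 3" "j < 3" "k < 3" "c < 2"
  shows "3 * Pten t [i, j, k] [c] = Sten t [i, j, k] [c] + 2 * epJ (Wten t) [i, j, k] [c]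
    + (\<Sum>l<3. eps3 i k l * yv t l j c + eps3 j k l * yv t l i c)"
proof -
  show ?thesis
    unfolding epW_low[OF t]
    using eps3_yv[OF t lt(1,3,4), of j] eps3_yv[OF t lt(2,3,4), of i] Pten_sym[OF t, of k i j c]
    by (simp add: sum.distrib Sten_apply)
qed

text \<open>Without its B^3 part, an element of S^2R^2 \<otimes> R^2 has only two free coordinates,
  and \<open>yv\<close> supplies them.\<close>

lemma crlow_from_yv:
  assumes t: "t \<in> torsion_space" and N: "\<And>I J. Nten t I J = 0"
  shows "crlow t [k, m] [0,0,0] = 0" "crlow t [k, m] [0,0,1] = 2/3 * yv t k m 0" "crlow t [k, m] [0,1,0] = - yv t k m 0 / 3"
    "crlow t [k, m] [1,0,0] = - yv t k m 0 / 3" "crlow t [k, m] [0,1,1] = yv t k m 1 / 3" "crlow t [k, m] [1,0,1] = yv t k m 1 / 3"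
    "crlow t [k, m] [1,1,0] = - 2/3 * yv t k m 1" "crlow t [k, m] [1,1,1] = 0"
proof -
  have s: "crlow t [k, m] [1,0,0] = crlow t [k, m] [0,1,0]" "crlow t [k, m] [1,0,1] = crlow t [k, m] [0,1,1]"
    by (rule crlow_sym[OF t])+
  have n: "crlow t [k, m] [a,b,c] + crlow t [k, m] [b,c,a] + crlow t [k, m] [c,a,b] = 0" for a b c
    using N[of "[k, m]" "[a, b, c]"] by (simp add: Nten_def rotJ_def)
  have ab: "crlow t [k, m] [0,0,1] = - 2 * crlow t [k, m] [0,1,0]" "crlow t [k, m] [1,1,0] = - 2 * crlow t [k, m] [0,1,1]"
    using n[of 0 0 1] n[of 0 1 1] s by simp_all
  show "crlow t [k, m] [0,0,0] = 0" "crlow t [k, m] [0,0,1] = 2/3 * yv t k m 0" "crlow t [k, m] [0,1,0] = - yv t k m 0 / 3"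
    "crlow t [k, m] [1,0,0] = - yv t k m 0 / 3" "crlow t [k, m] [0,1,1] = yv t k m 1 / 3" "crlow t [k, m] [1,0,1] = yv t k m 1 / 3"
    "crlow t [k, m] [1,1,0] = - 2/3 * yv t k m 1" "crlow t [k, m] [1,1,1] = 0"
    unfolding yv_def s ab using n[of 0 0 0] n[of 1 1 1] by simp_all
qed

section \<open>The image of T^* \<otimes> so(3)\<close>

definition altt :: "(nat \<Rightarrow> nat \<Rightarrow> real) \<Rightarrow> torsion" where
  "altt f = (\<lambda>x y z. if x < 6 \<and> y < 6 \<and> z < 6 then
     (\<Sum>c<3. f x c * so3_on_T c z y - f y c * so3_on_T c z x) else 0)"

lemma altt_swap: "altt f y x z = - altt f x y z"
  by (simp add: altt_def sum_subtractf)

lemma altt_torsion_space: "altt f \<in> torsion_space"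
proof -
  have "altt f x y z = - altt f y x z" for x y z by (rule altt_swap)
  moreover have "altt f x y z = 0" if "\<not> (x < 6 \<and> y < 6 \<and> z < 6)" for x y z
    using that by (auto simp: altt_def)
  ultimately show ?thesis unfolding torsion_space_def by blast
qed

lemma unlow_low: "t \<in> torsion_space \<Longrightarrow> unlow (low t) = t"
proof (intro ext)
  fix x y z assume t: "t \<in> torsion_space"
  show "unlow (low t) x y z = t x y z"
  proof (cases "x < 6 \<and> y < 6 \<and> z < 6")
    case True
    then have "x div 2 < 3" "y div 2 < 3" "z div 2 < 3" by auto
    moreover have "z mod 2 = 1 \<Longrightarrow> 2 * (z div 2) + 1 = z" "z mod 2 \<noteq> 1 \<Longrightarrow> 2 * (z div 2) = z" by presburger+
    ultimately show ?thesis using True by (simp add: unlow_def low_def)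
  next
    case False
    then have "t x y z = 0" using t unfolding torsion_space_def by blast
    then show ?thesis using False by (auto simp: unlow_def)
  qed
qed

text \<open>\<open>crlow\<close> and \<open>Pten\<close> together exhaust \<Lambda>^2(V \<otimes>
  R^2): a component of \<open>low\<close> is half the sum of an entry of each, and for equal
  V-indices only \<open>Pten\<close> contributes.\<close>

lemma low_eqI:
  assumes t: "t \<in> torsion_space" and u: "u \<in> torsion_space"
    and cr: "\<And>l k J. l < 3 \<Longrightarrow> k < 3 \<Longrightarrow> J \<in> idx_lists 2 3 \<Longrightarrow> crlow t [l, k] J = crlow u [l, k] J"
    and P: "\<And>i j k c. i < 3 \<Longrightarrow> j < 3 \<Longrightarrow> k < 3 \<Longrightarrow> c < 2 \<Longrightarrow> Pten t [i, j, k] [c] = Pten u [i, j, k] [c]"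
  shows "t = u"
proof -
  have cyc: "low v [i, j, k] [a, b, c] = (crlow v [l, k] [a, b, c] + eps2 a b * Pten v [i, j, k] [c]) / 2"
    if v: "v \<in> torsion_space" and l: "(l, i, j) \<in> cyc3" and ab: "a < 2" "b < 2" for v i j k l a b c
  proof -
    have 1: "crlow v [l, k] [a, b, c] = low v [i, j, k] [a, b, c] + low v [i, j, k] [b, a, c]"
      using l low_swap[OF v, of j i k a b c] unfolding cyc3_def
      by (elim insertE emptyE) (simp_all add: crlow_def crI_def sum_lt_3 eps3_values[simplified])
    have "\<forall>a<2. \<forall>b<2. eps2 a b * Pten v [i, j, k] [c] = low v [i, j, k] [a, b, c] - low v [i, j, k] [b, a, c]"
      by (simp add: all_lt_2 eps2_def Pten_def epJ_def)
    then have "eps2 a b * Pten v [i, j, k] [c] = low v [i, j, k] [a, b, c] - low v [i, j, k] [b, a, c]"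
      using ab by blast
    with 1 show ?thesis by simp
  qed
  have diag: "low v [i, i, k] [a, b, c] = eps2 a b * Pten v [i, i, k] [c] / 2"
    if v: "v \<in> torsion_space" and ab: "a < 2" "b < 2" for v i k a b c
  proof -
    have "\<forall>a<2. \<forall>b<2. low v [i, i, k] [a, b, c] = eps2 a b * Pten v [i, i, k] [c] / 2"
      using low_swap[OF v, of i i k 0 0 c] low_swap[OF v, of i i k 1 1 c] low_swap[OF v, of i i k 0 1 c]
      by (simp add: all_lt_2 eps2_def Pten_def epJ_def)
    then show ?thesis using ab by blast
  qed
  have "low t [i, j, k] [a, b, c] = low u [i, j, k] [a, b, c]"
    if lt: "i < 3" "j < 3" "k < 3" "a < 2" "b < 2" "c < 2" for i j k a b c
  proof -
    have J: "[a, b, c] \<in> idx_lists 2 3" "[b, a, c] \<in> idx_lists 2 3" using lt by (simp_all add: idx_lists_def)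
    have "i = j \<or> (\<exists>l<3. (l, i, j) \<in> cyc3) \<or> (\<exists>l<3. (l, j, i) \<in> cyc3)"
    proof -
      have "\<forall>i<3. \<forall>j<3. i = j \<or> (\<exists>l<3. (l, i, j) \<in> cyc3) \<or> (\<exists>l<3. (l, j, i) \<in> cyc3)"
        unfolding all_lt_3 cyc3_def by auto
      then show ?thesis using lt by blast
    qed
    then show ?thesis
    proof (elim disjE exE conjE)
      assume "i = j"
      then show ?thesis using diag[OF t lt(4,5), of i k c] diag[OF u lt(4,5), of i k c] P[of i i k c] lt by simp
    next
      fix l assume l: "l < 3" "(l, i, j) \<in> cyc3"
      show ?thesis using cyc[OF t l(2) lt(4,5), of k c] cyc[OF u l(2) lt(4,5), of k c] P[OF lt(1,2,3,6)] cr[OF l(1) lt(3) J(1)] by simp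
    next
      fix l assume l: "l < 3" "(l, j, i) \<in> cyc3"
      then have "low t [j, i, k] [b, a, c] = low u [j, i, k] [b, a, c]"
        using cyc[OF t l(2) lt(5,4), of k c] cyc[OF u l(2) lt(5,4), of k c] P[OF lt(2,1,3,6)] cr[OF l(1) lt(3) J(2)] by simp
      then show ?thesis using low_swap[OF t, of j i k b a c] low_swap[OF u, of j i k b a c] by simp
    qed
  qed
  then have "low t = low u"
    by (intro supp_eqI[OF supp_low supp_low]) (auto simp: idx_lists_def numeral_3_eq_3 length_Suc_conv)
  then show ?thesis using unlow_low[OF t] unlow_low[OF u] by metis
qed

definition galt :: "(nat \<Rightarrow> nat \<Rightarrow> real) \<Rightarrow> nat \<Rightarrow> nat \<Rightarrow> nat \<Rightarrow> nat \<Rightarrow> real" where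
  "galt f i a k j = (\<Sum>d<3. f (2*i+a) d * so3_basis d k j)"

lemma galt_swap: "galt f i a k j = - galt f i a j k"
proof -
  have "so3_basis d k j = - so3_basis d j k" for d by (auto simp: so3_basis_def)
  then show ?thesis unfolding galt_def sum_negf[symmetric] by (intro sum.cong refl) simp
qed

lemma low_altt:
  assumes "i < 3" "j < 3" "k < 3" "a < 2" "b < 2" "c < 2"
  shows "low (altt f) [i, j, k] [a, b, c] = eps2 c b * galt f i a k j - eps2 c a * galt f j b k i"
proof -
  have on_T: "so3_on_T d (2*k+c) (2*j+b) = (if b = c then so3_basis d k j else 0)" if "k < 3" "j < 3" "b < 2" "c < 2" for d k j b c
    using that by (auto simp: so3_on_T_def)
  have alt: "altt f (2*i+a) (2*j+b) (2*k+c) = (if b = c then galt f i a k j else 0) - (if a = c then galt f j b k i else 0)"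
    if "c < 2" for c
    using that assms by (simp add: altt_def on_T sum_subtractf galt_def)
  have "a = 0 \<or> a = 1" "b = 0 \<or> b = 1" "c = 0 \<or> c = 1" using assms by auto
  then show ?thesis using alt[of 0] alt[of 1] assms(1-3) by (elim disjE) (simp_all add: low_def eps2_def)
qed

lemma Pten_altt:
  assumes "i < 3" "j < 3" "k < 3" "c < 2"
  shows "Pten (altt f) [i, j, k] [c] = galt f i c k j + galt f j c k i"
proof -
  have "c = 0 \<or> c = 1" using assms by auto
  then show ?thesis
    using assms by (elim disjE) (simp_all add: Pten_def epJ_def low_altt eps2_def)
qed

text \<open>The values of the so(3)-valued one-form are skew matrices, so the six terms of the
  cyclic sum cancel in pairs.\<close>

lemma Sten_altt: "Sten (altt f) I J = 0"
proof (cases "I \<in> idx_lists 3 3 \<and> J \<in> idx_lists 2 1")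
  case True
  then obtain i j k c where IJ: "I = [i, j, k]" "J = [c]" and lt: "i < 3" "j < 3" "k < 3" "c < 2"
    by (auto simp: idx_lists_def numeral_3_eq_3 length_Suc_conv)
  show ?thesis
    unfolding IJ Sten_apply
    using Pten_altt[OF lt, of f] Pten_altt[OF lt(2,3,1,4), of f] Pten_altt[OF lt(3,1,2,4), of f]
      galt_swap[of f i c k j] galt_swap[of f j c k i] galt_swap[of f k c i j]
    by linarith
next
  case False
  then show ?thesis using supp_Sten[of "altt f"] unfolding supp_def by blast
qed

text \<open>The inverse of f -> \<open>yv (altt f)\<close>. For a fixed R^2-index, regard f as a 3
  by 3 matrix; then Y(l,k) = 3 (f(k,l) - \<delta>(k,l) tr f), hence tr Y = -6 tr f, and solving for
  f gives the two coefficients 1/3 and -1/6.\<close>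

definition falt :: "torsion \<Rightarrow> nat \<Rightarrow> nat \<Rightarrow> real" where
  "falt t x c = yv t c (x div 2) (x mod 2) / 3 - of_bool (c = x div 2) * (\<Sum>m<3. yv t m m (x mod 2)) / 6"

lemma galt_falt:
  assumes "i < 3" "k < 3" "j < 3" "a < 2"
  shows "galt (falt t) i a k j = eps3 i k j * (\<Sum>m<3. yv t m m a) / 6 - (\<Sum>d<3. eps3 d k j * yv t d i a) / 3"
proof -
  have f: "falt t (2*i+a) d = yv t d i a / 3 - of_bool (d = i) * (\<Sum>m<3. yv t m m a) / 6" for d
    using assms by (simp add: falt_def)
  have "\<forall>i<3. \<forall>k<3. \<forall>j<3. (\<Sum>d<3. (Y d / 3 - of_bool (d = i) * T / 6) * so3_basis d k j)
     = eps3 i k j * T / 6 - (\<Sum>d<3. eps3 d k j * Y d) / 3" for Y :: "nat \<Rightarrow> real" and T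
    by (simp add: all_lt_3 sum_lt_3 so3_basis_def eps3_values[simplified])
  from this[of "\<lambda>d. yv t d i a" "\<Sum>m<3. yv t m m a"] show ?thesis
    unfolding galt_def f using assms(1-3) by blast
qed

lemma torsion_eq_altt:
  assumes t: "t \<in> torsion_space" and z: "\<And>I J. Nten t I J = 0" "\<And>I J. Wten t I J = 0" "\<And>I J. Sten t I J = 0"
  shows "t = altt (falt t)"
proof (rule low_eqI[OF t altt_torsion_space])
  note cr = crlow_from_yv[OF t z(1)]
  fix l k :: nat and J assume lt: "l < 3" "k < 3" "J \<in> idx_lists 2 3"
  have "\<forall>l<3. \<forall>k<3. \<forall>a<2. \<forall>b<2. \<forall>c<2. crlow t [l, k] [a, b, c] = crlow (altt (falt t)) [l, k] [a, b, c]"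
    unfolding all_lt_3 all_lt_2 cr unfolding crlow_def crI_def list.case
    by (intro conjI; simp add: sum_lt_3 eps3_values[simplified] low_altt eps2_def galt_falt; (simp add: field_simps)?)
  moreover obtain a b c where "J = [a, b, c]" "a < 2" "b < 2" "c < 2"
    using lt(3) by (auto simp: idx_lists_def numeral_3_eq_3 length_Suc_conv)
  ultimately show "crlow t [l, k] J = crlow (altt (falt t)) [l, k] J" using lt by blast
next
  fix i j k c :: nat assume lt: "i < 3" "j < 3" "k < 3" "c < 2"
  have "epJ (Wten t) I J = 0" for I J by (simp add: epJ_def z)
  then have "3 * Pten t [i, j, k] [c] = (\<Sum>l<3. eps3 i k l * yv t l j c) + (\<Sum>l<3. eps3 j k l * yv t l i c)"
    using Pten_decomp[OF t lt] z(3) by (simp add: sum.distrib)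
  moreover have e: "eps3 l k j = - eps3 j k l" for l j
    by (auto simp: eps3_def field_simps)
  have y: "(\<Sum>d<3. eps3 d k j * yv t d i c) = - (\<Sum>l<3. eps3 j k l * yv t l i c)" for i j
    unfolding sum_negf[symmetric]
  proof (rule sum.cong[OF refl])
    fix d show "eps3 d k j * yv t d i c = - (eps3 j k d * yv t d i c)" using e[of d j] by simp
  qed
  have "Pten (altt (falt t)) [i, j, k] [c] = ((\<Sum>l<3. eps3 i k l * yv t l j c) + (\<Sum>l<3. eps3 j k l * yv t l i c)) / 3"
    unfolding Pten_altt[OF lt] galt_falt[OF lt(1,3,2,4)] galt_falt[OF lt(2,3,1,4)] y using e[of i j] by (simp add: field_simps)
  ultimately show "Pten t [i, j, k] [c] = Pten (altt (falt t)) [i, j, k] [c]" by simp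
qed

context sect_data
begin

lemma Pten_sect: "i < 3 \<Longrightarrow> j < 3 \<Longrightarrow> k < 3 \<Longrightarrow> c < 2 \<Longrightarrow> Pten (sect A S) [i, j, k] [c] = 2 * S [i, j, k] [c]"
proof -
  assume lt: "i < 3" "j < 3" "k < 3" "c < 2"
  have "A I [1, 0, c] = A I [0, 1, c]" for I
    using symA[of I] lt unfolding symlist_def by (metis One_nat_def lessI numeral_2_eq_2 zero_less_numeral)
  then show ?thesis using lt by (simp add: Pten_def low_sect epJ_def sectT_def eps2_def)
qed

end

lemma irr_sym3:
  assumes "irr (3, q) F"
  shows "F [j, i, k] J = F [i, j, k] J" "F [j, k, i] J = F [i, j, k] J"
proof -
  have "mset I = mset I' \<Longrightarrow> F I J = F I' J" for I I'
    using assms unfolding irr_def by blast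
  then show "F [j, i, k] J = F [i, j, k] J" "F [j, k, i] J = F [i, j, k] J" by (simp_all add: add_mset_commute)
qed

lemma quotient_iso_rest:
  "quotient_iso G_SO3_SL2
     (kerd sigma 2 \<inter> kerd (eta 0) 3 \<inter> kerd (eta 1) 3 \<inter> kerd (eta 2) 3 \<inter> kerd gamma_hat 3) alt_so3 [(3,1)]"
    (is "quotient_iso _ ?D _ _")
proof -
  have D: "t \<in> ?D \<longleftrightarrow> t \<in> torsion_space \<and> (\<forall>I J. Nten t I J = 0) \<and> (\<forall>I J. Qten t I J = 0) \<and> (\<forall>I J. Wten t I J = 0)" for t
    using joint_kernel[of t] kerd_sigma[of t] by blast
  show ?thesis
  proof (rule quotient_isoI[where \<Phi> = "[Sten]"], goal_cases)
    case 1 show ?case by simp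
  next
    case (2 j) then show ?case using intertw_Sten by simp
  next
    case (3 j t)
    then have t: "t \<in> torsion_space" and z: "\<And>I J. Qten t I J = 0" "\<And>I J. Wten t I J = 0" unfolding D by blast+
    have "irr (3, 1) (Sten t)"
    proof (rule irrI[OF supp_Sten])
      fix J assume "J \<in> idx_lists 2 1"
      then obtain c where J: "J = [c]" by (auto simp: idx_lists_def length_Suc_conv)
      have "Sten t [a, b, d] J = Sten t [b, a, d] J" "Sten t [a, b, d] J = Sten t [b, d, a] J" for a b d
        using Pten_sym[OF t, of a b d c] Pten_sym[OF t, of b d a c] Pten_sym[OF t, of d a b c]
        unfolding J Sten_apply by simp_all
      then show "symlist 3 3 (\<lambda>I. Sten t I J)" by (rule symlist_3I)
      have "Vten t [i] J = 0" for i by (simp add: Vten_def trI_def epJ_def z)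
      then show "trI (Sten t) [i] J = 0" for i using trI_Sten[OF t] z by (simp add: J)
    qed (simp_all add: symlist_lt2)
    then show ?case using 3 by simp
  next
    case (4 F)
    then have F: "irr (3, 1) (F 0)" by simp
    \<comment> \<open>\<open>Pten\<close> of the section is 2 S and the cyclic sum triples a
      symmetric tensor, hence 1/6.\<close>
    define S where "S = smul (1/6) (F 0)"
    interpret sect_data "\<lambda>I J. 0" S
    proof
      show "supp 3 1 S" unfolding S_def by (rule supp_smul[OF irr_supp[OF F]])
      show "S [j, i, k] J = S [i, j, k] J" for i j k J using irr_sym3(1)[OF F, of j i k J] by (simp add: S_def)
    qed (simp_all add: supp_def symlist_def)
    let ?t = "sect (\<lambda>I J. 0) S"
    have rot: "S [j, k, i] J = S [i, j, k] J" "S [k, i, j] J = S [i, j, k] J" for i j k J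
      using irr_sym3(2)[OF F, of j k i J] irr_sym3(2)[OF F, of k i j J] by (simp_all add: S_def)
    have N: "Nten ?t I J = 0" for I J unfolding Nten_sect by simp
    \<comment> \<open>Total symmetry makes the combination 2 S - S - S of \<open>epW_sect\<close>
      vanish.\<close>
    have P0: "epJ (Wten ?t) I J = 0" for I J
    proof (cases "I \<in> idx_lists 3 3 \<and> J \<in> idx_lists 2 1")
      case True
      then obtain i j k c where "I = [i, j, k]" "J = [c]" "i < 3" "j < 3" "k < 3" "c < 2"
        by (auto simp: idx_lists_def numeral_3_eq_3 length_Suc_conv)
      moreover have "S [j, k, i] [c] = S [i, j, k] [c]" "S [k, i, j] [c] = S [i, j, k] [c]" by (rule rot)+
      ultimately show ?thesis using epW_sect[of i j k c] by simp
    next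
      case False
      then show ?thesis using supp_epW[of ?t] unfolding supp_def by blast
    qed
    have W: "Wten ?t I J = 0" for I J
      by (rule W_zero[OF sect_space]) (simp_all add: trI_def N Vten_def Hten_def crI_def rotI_def P0 split: list.split)
    have Q: "Qten ?t I J = 0" for I J
    proof (cases "I \<in> idx_lists 3 1 \<and> J \<in> idx_lists 2 1")
      case True
      then obtain k c where IJ: "I = [k]" "J = [c]" "k < 3" "c < 2"
        by (auto simp: idx_lists_def length_Suc_conv)
      have "(\<Sum>m<3. S [k, m, m] [c]) = trI S [k] [c]"
        unfolding trI_def by (intro sum.cong refl rot)
      also have "\<dots> = 0" using irr_trace[OF F, of "[k]" "[c]"] by (simp add: S_def trI_def sum_divide_distrib[symmetric])
      finally show ?thesis using Qten_sect[OF IJ(3,4)] by (simp add: IJ)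
    next
      case False
      then show ?thesis using supp_Qten[of ?t] unfolding supp_def by blast
    qed
    have "Sten ?t = F 0"
    proof (rule supp_eqI[OF supp_Sten irr_supp[OF F]])
      fix I J assume "I \<in> idx_lists 3 3" "J \<in> idx_lists 2 1"
      then obtain i j k c where IJ: "I = [i, j, k]" "J = [c]" and lt: "i < 3" "j < 3" "k < 3" "c < 2"
        by (auto simp: idx_lists_def numeral_3_eq_3 length_Suc_conv)
      have "S [j, k, i] [c] = S [i, j, k] [c]" "S [k, i, j] [c] = S [i, j, k] [c]" by (rule rot)+
      then show "Sten ?t I J = F 0 I J"
        unfolding IJ Sten_apply using Pten_sect[OF lt] Pten_sect[OF lt(2,3,1,4)] Pten_sect[OF lt(3,1,2,4)] by (simp add: S_def)
    qed
    moreover have "?t \<in> ?D" unfolding D using sect_space N Q W by blast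
    ultimately show ?case by (intro bexI[of _ ?t]) simp_all
  next
    case (5 t)
    then have t: "t \<in> torsion_space" and z: "\<And>I J. Nten t I J = 0" "\<And>I J. Wten t I J = 0" unfolding D by blast+
    have alt: "t \<in> alt_so3 \<longleftrightarrow> (\<exists>f. t = altt f)" by (simp add: alt_so3_def altt_def)
    have "(\<forall>I J. Sten t I J = 0) \<longleftrightarrow> t \<in> alt_so3"
    proof
      assume "\<forall>I J. Sten t I J = 0"
      then have "t = altt (falt t)" by (intro torsion_eq_altt[OF t z]) blast
      then show "t \<in> alt_so3" unfolding alt by blast
    next
      assume "t \<in> alt_so3"
      then obtain f where "t = altt f" unfolding alt by blast
      then show "\<forall>I J. Sten t I J = 0" using Sten_altt by simp
    qed
    then show ?case by simp
  qed
qed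

theorem theorem2p3:
  shows
    \<comment> \<open>(1) d sigma: 4R + 2V + 2 S^2_0 V as SO(3)-module, B^3 + A^2 B^1 + A^4 B^1 as SO(3) x SL(2)-module\<close>
    "quotient_iso G_SO3 torsion_space (kerd sigma 2)
        [(0,0), (0,0), (0,0), (0,0), (1,0), (1,0), (2,0), (2,0)]
     \<and> quotient_iso G_SO3_SL2 torsion_space (kerd sigma 2) [(0,3), (1,1), (2,1)]
    \<comment> \<open>(2) each d eta_i: R + 2V + S^2_0 V; the three are in direct sum\<close>
     \<and> (\<forall>i<3. quotient_iso G_SO3 torsion_space (kerd (eta i) 3) [(0,0), (1,0), (1,0), (2,0)])
     \<and> frank (\<lambda>t (i, L). if i < 3 then dform (eta i) 3 t L else 0)
         = frank (dform (eta 0) 3) + frank (dform (eta 1) 3) + frank (dform (eta 2) 3)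
    \<comment> \<open>(3) d gamma_hat: R + 3V + S^2_0 V\<close>
     \<and> quotient_iso G_SO3 torsion_space (kerd gamma_hat 3) [(0,0), (1,0), (1,0), (1,0), (2,0)]
    \<comment> \<open>(4) d eta_i and d gamma_hat together: B^3 + A^2 B^1 + A^2 B^3 + A^4 B^3\<close>
     \<and> quotient_iso G_SO3_SL2 torsion_space
         (kerd (eta 0) 3 \<inter> kerd (eta 1) 3 \<inter> kerd (eta 2) 3 \<inter> kerd gamma_hat 3)
         [(0,3), (1,1), (1,3), (2,3)]
    \<comment> \<open>in particular: the undetermined part of the intrinsic torsion is A^6 B^1\<close>
     \<and> quotient_iso G_SO3_SL2
         (kerd sigma 2 \<inter> kerd (eta 0) 3 \<inter> kerd (eta 1) 3 \<inter> kerd (eta 2) 3 \<inter> kerd gamma_hat 3)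
         alt_so3 [(3,1)]"
proof (intro conjI allI impI)
  fix i :: nat assume "i < 3"
  then show "quotient_iso G_SO3 torsion_space (kerd (eta i) 3) [(0,0), (1,0), (1,0), (2,0)]"
    using quotient_iso_powc[OF ec_es[of i]] by (simp only: eta_ec_es)
qed (fact quotient_iso_sigma_SO3 quotient_iso_sigma frank_eta quotient_iso_gamma_hat
  quotient_iso_invariant_3forms quotient_iso_rest)+

end
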